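(* Let $k\geqslant 5$ and $n\geqslant \max\{2.16\times 10^{17},\ 9\times 2^{\lfloor \frac{k-1}{2}\rfloor}+3,\ \frac{625}{32}\lfloor\frac{k-3}{2}\rfloor^2+2\}$. Let $G$ be a planar graph on $n$ vertices that contains no member of $\Theta_k$ as a subgraph. Then $\rho(G)\leqslant \rho\big(K_2+H(\lceil\frac{k-3}{2}\rceil, \lfloor\frac{k-3}{2}\rfloor)\big)$, with equality if and only if $G\cong K_2+H(\lceil\frac{k-3}{2}\rceil, \lfloor\frac{k-3}{2}\rfloor)$.
   Context: All graphs are finite and simple. $\rho(G)$ denotes the spectral radius of the adjacency matrix of $G$. A Theta graph on $k$ vertices is a graph obtained from a cycle $C_k$ by adding one edge between two non-consecutive vertices of the cycle; $\Theta_k$ is the set of all Theta graphs on $k$ vertices (equivalently, the graphs $C_a\cdot C_{k+2-a}$ for $3\leqslant a\leqslant \lfloor k/2\rfloor+1$, where $C_a\cdot C_b$ is obtained from cycles $C_a$, $C_b$ by identifying an edge of one with an edge of the other). $P_m$ denotes the path on $m$ vertices, $\cup$ denotes vertex-disjoint union, and $cP_m$ denotes $c$ disjoint copies of $P_m$. For graphs $G_1,G_2$, $G_1+G_2$ denotes their join (disjoint union plus all edges between a vertex of $G_1$ and a vertex of $G_2$). For positive integers $n_1\geqslant n_2$ with $n_1<n-2$ ($n$ being the number of vertices), $H(n_1,n_2)$ is the graph on $n-2$ vertices defined by $H(n_1,n_2)=P_{n_1}\cup \frac{n-2-n_1}{n_2}P_{n_2}$ if $n_2$ divides $n-2-n_1$,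 and $H(n_1,n_2)=P_{n_1}\cup \lfloor \frac{n-2-n_1}{n_2}\rfloor P_{n_2}\cup P_{r}$ with $r=n-2-n_1-\lfloor \frac{n-2-n_1}{n_2}\rfloor n_2$ otherwise. *)

theory Defs
  imports "HOL-Analysis.Analysis"
begin

definition simple_graph :: "'a set \<Rightarrow> 'a set set \<Rightarrow> bool" where
  "simple_graph V E \<longleftrightarrow> finite V \<and> (\<forall>e\<in>E. \<exists>u v. e = {u, v} \<and> u \<in> V \<and> v \<in> V \<and> u \<noteq> v)"

definition adj_eigenvalue :: "'a set \<Rightarrow> 'a set set \<Rightarrow> complex \<Rightarrow> bool" where
  "adj_eigenvalue V E \<mu> \<longleftrightarrow> (\<exists>x :: 'a \<Rightarrow> complex. (\<exists>v\<in>V. x v \<noteq> 0) \<and>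
     (\<forall>v\<in>V. (\<Sum>u\<in>V. (if {u, v} \<in> E then 1 else 0) * x u) = \<mu> * x v))"

definition spectral_radius :: "'a set \<Rightarrow> 'a set set \<Rightarrow> real" where
  "spectral_radius V E = Max {cmod \<mu> | \<mu>. adj_eigenvalue V E \<mu>}"

definition planar :: "'a set \<Rightarrow> 'a set set \<Rightarrow> bool" where
  "planar V E \<longleftrightarrow> (\<exists>(p :: 'a \<Rightarrow> complex) (c :: 'a set \<Rightarrow> real \<Rightarrow> complex).
     inj_on p V \<and>
     (\<forall>e\<in>E. arc (c e) \<and> {pathstart (c e), pathfinish (c e)} = p ` e \<and>
              path_image (c e) \<inter> p ` V = p ` e) \<and>
     (\<forall>e\<in>E. \<forall>e'\<in>E. e \<noteq> e' \<longrightarrow> path_image (c e) \<inter> path_image (c e') \<subseteq> p ` (e \<inter> e')))"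

definition contains_theta :: "nat \<Rightarrow> 'a set \<Rightarrow> 'a set set \<Rightarrow> bool" where
  "contains_theta k V E \<longleftrightarrow> (\<exists>vs. length vs = k \<and> distinct vs \<and> set vs \<subseteq> V \<and>
     (\<forall>i<k. {vs ! i, vs ! ((i + 1) mod k)} \<in> E) \<and>
     (\<exists>i<k. \<exists>j<k. i \<noteq> j \<and> j \<noteq> (i + 1) mod k \<and> i \<noteq> (j + 1) mod k \<and> {vs ! i, vs ! j} \<in> E))"

fun paths_edges :: "nat \<Rightarrow> nat list \<Rightarrow> nat set set" where
  "paths_edges s [] = {}"
| "paths_edges s (l # ls) = {{s + i, s + i + 1} | i. i + 1 < l} \<union> paths_edges (s + l) ls"

text \<open>Component sizes of H(n1,n2) on n-2 vertices.\<close>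
definition H_parts :: "nat \<Rightarrow> nat \<Rightarrow> nat \<Rightarrow> nat list" where
  "H_parts n n1 n2 = (let q = (n - 2 - n1) div n2; r = (n - 2 - n1) mod n2 in
     n1 # replicate q n2 @ (if r = 0 then [] else [r]))"

text \<open>K_2 + H(n1,n2) on vertex set {0..<n}: vertices 0,1 form the K_2, vertices 2..n-1 carry H.\<close>
definition KH_vertices :: "nat \<Rightarrow> nat set" where
  "KH_vertices n = {0..<n}"

definition KH_edges :: "nat \<Rightarrow> nat \<Rightarrow> nat \<Rightarrow> nat set set" where
  "KH_edges n n1 n2 = {{0, 1}} \<union> {{a, b} | a b. a < 2 \<and> 2 \<le> b \<and> b < n} \<union> paths_edges 2 (H_parts n n1 n2)"

definition graph_iso :: "'a set \<Rightarrow> 'a set set \<Rightarrow> 'b set \<Rightarrow> 'b set set \<Rightarrow> bool" where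
  "graph_iso V E V' E' \<longleftrightarrow> (\<exists>f. bij_betw f V V' \<and>
     (\<forall>u\<in>V. \<forall>v\<in>V. {u, v} \<in> E \<longleftrightarrow> {f u, f v} \<in> E'))"

end

theory Submission imports Defs begin

text \<open>
  A theta curve argument (the Jordan curve theorem and an inversion) shows that a planar graph has no
  minor K(3,3) and that two vertices cannot have four common neighbours three of which form a triangle
  (a subdivision of K(5)). Without a minor K(3,3) a graph on m vertices has at most 5m edges, and any three vertices
  have at most two common neighbours.

  Let x be the Perron vector of G, with maximum 1 at u. The radius of K(2) joined to n - 2 isolated
  vertices gives \<open>\<rho>\<^sup>2 \<ge> 2 n - 4\<close>. Counting walks of length two then forces a second vertex v whose entry is
  close to 1, leaves at most n/20 exceptional vertices that are not common neighbours of u and v, and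
  makes all entries except those of u and v small. Joining the exceptional vertices to u and v instead
  of their old neighbours therefore increases the Rayleigh quotient. The resulting graph is the join of
  an edge uv with a graph H; nonplanarity makes H a linear forest, and the absence of theta graphs
  bounds the total length of any two of its paths by k - 3.

  The spectral radius \<open>\<lambda>\<close> of such a join satisfies \<open>\<lambda> = 1 + 2 \<Phi>\<close>, where \<open>\<Phi>\<close> is the sum of the entries of
  the inverse of \<open>\<lambda> - A(H)\<close>. Up to a term depending only on the number of vertices, a path with m
  vertices contributes to \<open>\<Phi>\<close> a negative multiple of g(m), where g is strictly concave with g(0) = 0.
  Concavity makes the path lengths of the extremal graph the unique minimizers of the sum of g.
\<close>

section \<open>Perron vectors and Rayleigh quotients\<close>

text \<open>The numbers \<open>lam\<close>, \<open>t\<close> and the function \<open>g\<close>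
  belong to one graph, so the radii of two joins are not values of a common formula at a common
  argument. Everything is therefore evaluated at the radius \<open>lam\<close> of the graph obtained
  from G: there \<open>lam = 1 + 2 * Phi\<close> is exact, while for the extremal graph the
  potential at this same \<open>lam\<close> serves as a test vector in the Rayleigh quotient.

  Restrictions on the forest are proved in G itself and not in the modified graph: the forest edges
  are old edges among common neighbours of u and v. The exceptional vertices become one-vertex
  paths, and a spare common neighbour stands in for them when a theta graph is built.

  The factors 5 and 10 in the constants stem from the edge bound 5m. The size 10^17 of n comes from
  the number of vertices with three neighbours of large degree, which is only bounded by 2 * 40000^3
  / 6. The role of \<open>32 * s\<^sup>2 \<le> N\<close> is to give \<open>lam \<ge> 8 * s\<close>;
  then all values of \<open>g\<close> at positive lengths are so close to 1 that the number of paths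
  decides when one path is too long.\<close>

definition adjop :: "'a set \<Rightarrow> 'a set set \<Rightarrow> ('a \<Rightarrow> real) \<Rightarrow> 'a \<Rightarrow> real" where
  "adjop V E y v = (\<Sum>u\<in>V. (if {u, v} \<in> E then 1 else 0) * y u)"

definition qform :: "'a set \<Rightarrow> 'a set set \<Rightarrow> ('a \<Rightarrow> real) \<Rightarrow> real" where
  "qform V E y = (\<Sum>v\<in>V. y v * adjop V E y v)"

lemma adjop_sym: "(\<Sum>v\<in>V. z v * adjop V E y v) = (\<Sum>v\<in>V. y v * adjop V E z v)"
proof -
  have "(\<Sum>v\<in>V. z v * adjop V E y v) = (\<Sum>v\<in>V. \<Sum>u\<in>V. (if {u, v} \<in> E then 1 else 0) * z v * y u)"
    by (simp add: adjop_def sum_distrib_left mult_ac)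
  also have "\<dots> = (\<Sum>u\<in>V. \<Sum>v\<in>V. (if {u, v} \<in> E then 1 else 0) * z v * y u)"
    by (rule sum.swap)
  also have "\<dots> = (\<Sum>v\<in>V. y v * adjop V E z v)"
    by (simp add: adjop_def sum_distrib_left mult_ac insert_commute)
  finally show ?thesis .
qed

lemma adjop_add: "adjop V E (\<lambda>v. y v + s * z v) v = adjop V E y v + s * adjop V E z v"
  by (simp add: adjop_def sum.distrib[symmetric] sum_distrib_left algebra_simps del: sum.distrib)

lemma qform_add: "qform V E (\<lambda>v. y v + s * z v) = qform V E y + 2 * s * (\<Sum>v\<in>V. z v * adjop V E y v) + s\<^sup>2 * qform V E z"
proof -
  have "qform V E (\<lambda>v. y v + s * z v) = qform V E y + s * (\<Sum>v\<in>V. z v * adjop V E y v)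
      + s * (\<Sum>v\<in>V. y v * adjop V E z v) + s\<^sup>2 * qform V E z"
    unfolding qform_def adjop_add
    by (simp add: sum.distrib sum_distrib_left algebra_simps power2_eq_square)
  thus ?thesis using adjop_sym[of y V E z] by (simp add: algebra_simps)
qed

text \<open>Allows a maximizer of the Rayleigh quotient to be sought among nonnegative
  vectors.\<close>

lemma qform_abs: "qform V E y \<le> qform V E (\<lambda>v. \<bar>y v\<bar>)"
  unfolding qform_def adjop_def sum_distrib_left
  apply (intro sum_mono)
  apply (auto simp: mult_ac)
  by (metis abs_ge_self abs_mult)

lemma qform_scale: "qform V E (\<lambda>v. c * y v) = c\<^sup>2 * qform V E y"
  by (simp add: qform_def adjop_def sum_distrib_left power2_eq_square algebra_simps)

text \<open>Functions on the whole type that vanish off \<open>V\<close> and have entries in [0,1]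
  form a product of compact sets; the unit sphere cuts out a closed part, so the continuous form
  attains its maximum there. By \<open>qform_abs\<close> nothing is lost by nonnegativity, and
  scaling reaches every \<open>y\<close>.\<close>

lemma ex_rayleigh_maximizer:
  assumes fin: "finite V" and ne: "V \<noteq> {}"
  obtains x L where "\<And>v. 0 \<le> x v" "(\<Sum>v\<in>V. (x v)\<^sup>2) = 1" "qform V E x = L"
    "\<And>y. qform V E y \<le> L * (\<Sum>v\<in>V. (y v)\<^sup>2)"
proof -
  define K where "K = {x :: 'a \<Rightarrow> real. (\<forall>v. x v \<in> (if v \<in> V then {0..1} else {0})) \<and> (\<Sum>v\<in>V. (x v)\<^sup>2) = 1}"
  have c0: "compact (Pi\<^sub>E UNIV (\<lambda>v. if v \<in> V then {0..1::real} else {0}))"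
    using compactin_PiE[of "\<lambda>v. euclidean :: real topology" UNIV "\<lambda>v. if v \<in> V then {0..1::real} else {0}"]
    by (simp add: euclidean_product_topology)
  have K_eq: "K = Pi\<^sub>E UNIV (\<lambda>v. if v \<in> V then {0..1::real} else {0}) \<inter> {x. (\<Sum>v\<in>V. (x v)\<^sup>2) = 1}"
    unfolding K_def by (auto simp: PiE_UNIV_domain Pi_def)
  have "closed {x :: 'a \<Rightarrow> real. (\<Sum>v\<in>V. (x v)\<^sup>2) = 1}"
    by (intro closed_Collect_eq continuous_intros continuous_on_product_coordinates)
  hence cK: "compact K" unfolding K_eq using c0 by (rule compact_Int_closed[rotated])
  obtain v0 where v0: "v0 \<in> V" using ne by auto
  have "(\<lambda>v. if v = v0 then 1 else 0) \<in> K"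
  proof -
    have "(\<Sum>v\<in>V. (if v = v0 then 1 else 0 :: real)\<^sup>2) = (\<Sum>v\<in>V. if v = v0 then 1 else 0)"
      by (rule sum.cong) auto
    also have "\<dots> = 1" using fin v0 by simp
    finally show ?thesis using v0 by (auto simp: K_def)
  qed
  hence neK: "K \<noteq> {}" by auto
  have "continuous_on K (qform V E)"
    unfolding qform_def adjop_def
    by (intro continuous_intros continuous_on_subset[OF continuous_on_product_coordinates]) auto
  from continuous_attains_sup[OF cK neK this] obtain x where x: "x \<in> K" and mx: "\<And>y. y \<in> K \<Longrightarrow> qform V E y \<le> qform V E x"
    by blast
  show thesis
  proof
    show "0 \<le> x v" for v using x unfolding K_def by (cases "v \<in> V") (auto dest!: spec[of _ v])
    show "(\<Sum>v\<in>V. (x v)\<^sup>2) = 1" using x unfolding K_def by auto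
    show "qform V E x = qform V E x" ..
    fix y :: "'a \<Rightarrow> real"
    define S where "S = (\<Sum>v\<in>V. (y v)\<^sup>2)"
    have S0: "S \<ge> 0" unfolding S_def by (simp add: sum_nonneg)
    show "qform V E y \<le> qform V E x * (\<Sum>v\<in>V. (y v)\<^sup>2)"
    proof (cases "S = 0")
      case True
      hence "\<forall>v\<in>V. y v = 0" unfolding S_def using fin by (simp add: sum_nonneg_eq_0_iff)
      thus ?thesis by (simp add: qform_def)
    next
      case False
      hence Sp: "S > 0" using S0 by simp
      define z where "z = (\<lambda>v. if v \<in> V then \<bar>y v\<bar> / sqrt S else 0)"
      have zS: "(\<Sum>v\<in>V. (z v)\<^sup>2) = 1"
      proof -
        have "(\<Sum>v\<in>V. (z v)\<^sup>2) = (\<Sum>v\<in>V. (y v)\<^sup>2 / S)"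
          by (rule sum.cong) (use Sp in \<open>auto simp: z_def power_divide\<close>)
        also have "\<dots> = 1" using Sp by (simp add: S_def sum_divide_distrib[symmetric])
        finally show ?thesis .
      qed
      have "z v \<le> 1" if "v \<in> V" for v
      proof -
        have "(z v)\<^sup>2 \<le> (\<Sum>v\<in>V. (z v)\<^sup>2)" using fin that by (intro member_le_sum) auto
        thus ?thesis using zS by (simp add: abs_square_le_1)
      qed
      hence "z \<in> K" unfolding K_def using zS Sp by (auto simp: z_def)
      hence "qform V E z \<le> qform V E x" by (rule mx)
      moreover have "qform V E z = qform V E (\<lambda>v. (1 / sqrt S) * \<bar>y v\<bar>)"
        unfolding qform_def adjop_def by (auto intro!: sum.cong simp: z_def)
      ultimately have "qform V E (\<lambda>v. \<bar>y v\<bar>) / S \<le> qform V E x"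
        using Sp by (simp add: qform_scale[of V E "1 / sqrt S", simplified] power_divide)
      hence "qform V E (\<lambda>v. \<bar>y v\<bar>) \<le> qform V E x * S" using Sp by (simp add: field_simps)
      with qform_abs[of V E y] show ?thesis unfolding S_def by linarith
    qed
  qed
qed

text \<open>First variation in the direction of the residual \<open>z\<close>: its squared norm
  \<open>Z\<close> satisfies 2 s Z <= s^2 B for all s, which fails at s = Z / B if Z > 0.\<close>

lemma rayleigh_eq_imp_eigen:
  assumes fin: "finite V" and L: "\<And>y. qform V E y \<le> L * (\<Sum>v\<in>V. (y v)\<^sup>2)"
    and eq: "qform V E x = L * (\<Sum>v\<in>V. (x v)\<^sup>2)" and v: "v \<in> V"
  shows "adjop V E x v = L * x v"
proof (rule ccontr)
  assume ne: "adjop V E x v \<noteq> L * x v"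
  define z where "z = (\<lambda>v. adjop V E x v - L * x v)"
  define Z where "Z = (\<Sum>v\<in>V. (z v)\<^sup>2)"
  have Zp: "Z > 0" unfolding Z_def
    using fin v ne by (intro sum_pos2[of _ v]) (auto simp: z_def)
  define B where "B = L * Z - qform V E z"
  have key: "2 * s * Z \<le> s\<^sup>2 * B" for s
  proof -
    have "(\<Sum>v\<in>V. (x v + s * z v)\<^sup>2) = (\<Sum>v\<in>V. (x v)\<^sup>2) + 2 * s * (\<Sum>v\<in>V. z v * x v) + s\<^sup>2 * Z"
      unfolding Z_def by (simp add: sum_distrib_left sum.distrib[symmetric] power2_eq_square algebra_simps del: sum.distrib)
    moreover have "(\<Sum>v\<in>V. z v * adjop V E x v) = Z + L * (\<Sum>v\<in>V. z v * x v)"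
      unfolding Z_def z_def by (simp add: sum_distrib_left sum.distrib[symmetric] power2_eq_square algebra_simps del: sum.distrib)
    ultimately show ?thesis
      using L[of "\<lambda>v. x v + s * z v"] eq unfolding qform_add B_def by (simp add: algebra_simps)
  qed
  have B0: "B > 0" using key[of 1] Zp by simp
  have "2 * (Z / B) * Z \<le> (Z / B)\<^sup>2 * B" by (rule key)
  also have "\<dots> = Z / B * Z" using B0 by (simp add: power2_eq_square)
  finally have "Z / B * Z \<le> 0" by linarith
  moreover have "Z / B * Z > 0" using Zp B0 by simp
  ultimately show False by linarith
qed

text \<open>Bessel's inequality for the standard unit vector at \<open>w\<close> bounds the sum of
  the squares \<open>(f i w)\<^sup>2\<close> by 1; summing over \<open>w\<close> counts the
  family.\<close>

lemma card_orthonormal_le: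
  fixes f :: "'b \<Rightarrow> 'a \<Rightarrow> real"
  assumes finV: "finite V" and fin: "finite M"
    and on: "\<And>i. i \<in> M \<Longrightarrow> (\<Sum>v\<in>V. (f i v)\<^sup>2) = 1"
    and og: "\<And>i j. i \<in> M \<Longrightarrow> j \<in> M \<Longrightarrow> i \<noteq> j \<Longrightarrow> (\<Sum>v\<in>V. f i v * f j v) = 0"
  shows "card M \<le> card V"
proof -
  have b: "(\<Sum>i\<in>M. (f i w)\<^sup>2) \<le> 1" if w: "w \<in> V" for w
  proof -
    define e where "e v = (if v = w then 1 else 0 :: real)" for v
    define s where "s v = (\<Sum>i\<in>M. f i w * f i v)" for v
    have es: "(\<Sum>v\<in>V. e v * s v) = (\<Sum>i\<in>M. (f i w)\<^sup>2)"
    proof -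
      have "(\<Sum>v\<in>V. e v * s v) = (\<Sum>v\<in>V. if v = w then s v else 0)" by (rule sum.cong) (auto simp: e_def)
      also have "\<dots> = s w" using finV w by simp
      finally show ?thesis by (simp add: s_def power2_eq_square)
    qed
    have ss: "(\<Sum>v\<in>V. s v * s v) = (\<Sum>i\<in>M. (f i w)\<^sup>2)"
    proof -
      have "(\<Sum>v\<in>V. s v * s v) = (\<Sum>v\<in>V. \<Sum>i\<in>M. \<Sum>j\<in>M. f i w * f j w * (f i v * f j v))"
        unfolding s_def sum_product by (intro sum.cong refl) (simp add: mult_ac)
      also have "\<dots> = (\<Sum>i\<in>M. \<Sum>j\<in>M. f i w * f j w * (\<Sum>v\<in>V. f i v * f j v))"
        by (subst sum.swap, rule sum.cong[OF refl], subst sum.swap, simp add: sum_distrib_left)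
      also have "\<dots> = (\<Sum>i\<in>M. \<Sum>j\<in>M. if i = j then (f i w)\<^sup>2 else 0)"
      proof (intro sum.cong refl)
        fix i j assume "i \<in> M" "j \<in> M"
        show "f i w * f j w * (\<Sum>v\<in>V. f i v * f j v) = (if i = j then (f i w)\<^sup>2 else 0)"
          using on[OF \<open>i \<in> M\<close>] og[OF \<open>i \<in> M\<close> \<open>j \<in> M\<close>] by (auto simp: power2_eq_square)
      qed
      also have "\<dots> = (\<Sum>i\<in>M. (f i w)\<^sup>2)" using fin by simp
      finally show ?thesis .
    qed
    have ee: "(\<Sum>v\<in>V. e v * e v) = 1"
    proof -
      have "(\<Sum>v\<in>V. e v * e v) = (\<Sum>v\<in>V. if v = w then 1 else 0)" by (rule sum.cong) (auto simp: e_def)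
      thus ?thesis using finV w by simp
    qed
    have "0 \<le> (\<Sum>v\<in>V. (e v - s v)\<^sup>2)" by (simp add: sum_nonneg)
    also have "\<dots> = (\<Sum>v\<in>V. e v * e v) - 2 * (\<Sum>v\<in>V. e v * s v) + (\<Sum>v\<in>V. s v * s v)"
      by (simp add: sum_distrib_left sum.distrib[symmetric] sum_subtractf[symmetric] power2_eq_square algebra_simps del: sum.distrib sum_subtractf)
    finally show ?thesis unfolding ee es ss by simp
  qed
  have "real (card M) = (\<Sum>i\<in>M. \<Sum>v\<in>V. (f i v)\<^sup>2)" using on by simp
  also have "\<dots> = (\<Sum>v\<in>V. \<Sum>i\<in>M. (f i v)\<^sup>2)" by (rule sum.swap)
  also have "\<dots> \<le> (\<Sum>v\<in>V. 1)" by (intro sum_mono b)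
  finally show ?thesis by simp
qed

text \<open>The matrix is symmetric, so the Hermitian form of an eigenvector is real and the
  eigenvalue with it; the real or the imaginary part of the eigenvector is then a nonzero real
  eigenvector.\<close>

lemma adj_eigenvalue_real:
  assumes fin: "finite V" and ev: "adj_eigenvalue V E \<mu>"
  shows "\<exists>m x. \<mu> = complex_of_real m \<and> (\<Sum>v\<in>V. (x v)\<^sup>2) = 1 \<and> (\<forall>v\<in>V. adjop V E x v = m * x v)"
proof -
  from ev obtain z where nz: "\<exists>v\<in>V. z v \<noteq> 0"
    and z: "\<And>v. v \<in> V \<Longrightarrow> (\<Sum>u\<in>V. (if {u, v} \<in> E then 1 else 0) * z u) = \<mu> * z v"
    unfolding adj_eigenvalue_def by blast
  define S where "S = (\<Sum>v\<in>V. cnj (z v) * z v)"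
  define T where "T = (\<Sum>v\<in>V. (cmod (z v))\<^sup>2)"
  have ST: "S = complex_of_real T" unfolding S_def T_def of_real_sum
    by (intro sum.cong refl) (simp only: complex_norm_square mult.commute)
  obtain v0 where v0: "v0 \<in> V" "z v0 \<noteq> 0" using nz by auto
  have Tp: "T > 0" unfolding T_def using fin v0 by (intro sum_pos2[of _ v0]) auto
  have 1: "\<mu> * S = (\<Sum>v\<in>V. \<Sum>u\<in>V. (if {u, v} \<in> E then 1 else 0) * cnj (z v) * z u)"
  proof -
    have "\<mu> * S = (\<Sum>v\<in>V. cnj (z v) * (\<mu> * z v))" by (simp add: S_def sum_distrib_left mult_ac)
    also have "\<dots> = (\<Sum>v\<in>V. cnj (z v) * (\<Sum>u\<in>V. (if {u, v} \<in> E then 1 else 0) * z u))" using z by simp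
    finally show ?thesis by (simp add: sum_distrib_left mult_ac)
  qed
  have "cnj (\<mu> * S) = (\<Sum>v\<in>V. \<Sum>u\<in>V. (if {u, v} \<in> E then 1 else 0) * z v * cnj (z u))"
    unfolding 1 by (auto intro!: sum.cong simp: cnj_sum)
  also have "\<dots> = (\<Sum>u\<in>V. \<Sum>v\<in>V. (if {u, v} \<in> E then 1 else 0) * z v * cnj (z u))" by (rule sum.swap)
  also have "\<dots> = \<mu> * S" unfolding 1 by (intro sum.cong refl) (auto simp: insert_commute)
  finally have "cnj \<mu> * S = \<mu> * S" by (simp add: ST)
  hence "cnj \<mu> = \<mu>" using ST Tp by auto
  then obtain m where m: "\<mu> = complex_of_real m" by (metis Reals_cnj_iff Reals_cases)
  have Re: "adjop V E (\<lambda>v. Re (z v)) v = m * Re (z v)" if "v \<in> V" for v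
    using arg_cong[OF z[OF that], of Re] unfolding adjop_def m by (simp add: if_distrib if_distribR cong: if_cong)
  have Im: "adjop V E (\<lambda>v. Im (z v)) v = m * Im (z v)" if "v \<in> V" for v
    using arg_cong[OF z[OF that], of Im] unfolding adjop_def m by (simp add: if_distrib if_distribR cong: if_cong)
  have "Re (z v0) \<noteq> 0 \<or> Im (z v0) \<noteq> 0" using v0 by (auto simp: complex_eq_iff)
  then obtain y where y0: "y v0 \<noteq> 0" and y: "\<And>v. v \<in> V \<Longrightarrow> adjop V E y v = m * y v"
    using Re Im by (elim disjE) auto
  define Y where "Y = (\<Sum>v\<in>V. (y v)\<^sup>2)"
  have Yp: "Y > 0" unfolding Y_def using fin v0 y0 by (intro sum_pos2[of _ v0]) auto
  have "(\<Sum>v\<in>V. (y v / sqrt Y)\<^sup>2) = 1" using Yp by (simp add: power_divide sum_divide_distrib[symmetric] Y_def[symmetric])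
  moreover have "adjop V E (\<lambda>v. y v / sqrt Y) v = m * (y v / sqrt Y)" if "v \<in> V" for v
    using y[OF that] by (simp add: adjop_def sum_divide_distrib[symmetric])
  ultimately show ?thesis using m by (intro exI[of _ m] exI[of _ "\<lambda>v. y v / sqrt Y"] conjI ballI)
qed

text \<open>Makes \<open>Max\<close> in \<open>spectral_radius\<close> meaningful. Eigenvectors of
  distinct eigenvalues are orthogonal, so there are at most \<open>card V\<close>
  eigenvalues.\<close>

lemma finite_adj_eigenvalues:
  assumes fin: "finite V"
  shows "finite {\<mu>. adj_eigenvalue V E \<mu>}"
proof (rule ccontr)
  assume "infinite {\<mu>. adj_eigenvalue V E \<mu>}"
  then obtain M where M: "finite M" "card M = Suc (card V)" "M \<subseteq> {\<mu>. adj_eigenvalue V E \<mu>}"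
    using infinite_arbitrarily_large by blast
  have "\<forall>\<mu>\<in>M. \<exists>m x. \<mu> = complex_of_real m \<and> (\<Sum>v\<in>V. (x v)\<^sup>2) = 1 \<and> (\<forall>v\<in>V. adjop V E x v = m * x v)"
    using adj_eigenvalue_real[OF fin] M by blast
  then obtain m x where mx: "\<And>\<mu>. \<mu> \<in> M \<Longrightarrow> \<mu> = complex_of_real (m \<mu>) \<and> (\<Sum>v\<in>V. (x \<mu> v)\<^sup>2) = 1 \<and> (\<forall>v\<in>V. adjop V E (x \<mu>) v = m \<mu> * x \<mu> v)"
    by metis
  have "card M \<le> card V"
  proof (rule card_orthonormal_le[OF fin M(1), of x])
    fix i j assume ij: "i \<in> M" "j \<in> M" "i \<noteq> j"
    have "m i \<noteq> m j" using mx ij by metis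
    have "(\<Sum>v\<in>V. x j v * adjop V E (x i) v) = (\<Sum>v\<in>V. x i v * adjop V E (x j) v)" by (rule adjop_sym)
    hence "m i * (\<Sum>v\<in>V. x i v * x j v) = m j * (\<Sum>v\<in>V. x i v * x j v)"
      using mx[OF ij(1)] mx[OF ij(2)] by (simp add: sum_distrib_left mult_ac)
    thus "(\<Sum>v\<in>V. x i v * x j v) = 0" using \<open>m i \<noteq> m j\<close> by simp
  qed (use mx in auto)
  thus False using M by simp
qed

text \<open>The maximum \<open>L\<close> of the Rayleigh quotient is an eigenvalue. A negative
  eigenvalue cannot exceed it in modulus, because replacing the entries of an eigenvector by their
  absolute values does not decrease the modulus of the form.\<close>

lemma spectral_radius_props:
  assumes fin: "finite V" and ne: "V \<noteq> {}"
  shows rayleigh_le: "qform V E y \<le> spectral_radius V E * (\<Sum>v\<in>V. (y v)\<^sup>2)"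
    and ex_perron_vector: "\<exists>x. (\<forall>v. 0 \<le> x v) \<and> (\<exists>v\<in>V. x v \<noteq> 0) \<and> (\<forall>v\<in>V. adjop V E x v = spectral_radius V E * x v)"
proof -
  obtain x L where x: "\<And>v. 0 \<le> x v" "(\<Sum>v\<in>V. (x v)\<^sup>2) = 1" "qform V E x = L"
    and L: "\<And>y. qform V E y \<le> L * (\<Sum>v\<in>V. (y v)\<^sup>2)"
    using ex_rayleigh_maximizer[OF assms, of E] by blast
  have xL: "adjop V E x v = L * x v" if "v \<in> V" for v
    by (rule rayleigh_eq_imp_eigen[OF fin L _ that]) (simp add: x)
  have x0: "\<exists>v\<in>V. x v \<noteq> 0" proof (rule ccontr)
    assume "\<not> ?thesis"
    hence "(\<Sum>v\<in>V. (x v)\<^sup>2) = 0" by simp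
    thus False using x(2) by simp
  qed
  have L0: "L \<ge> 0" using x(3) unfolding qform_def adjop_def
    by (auto intro!: sum_nonneg mult_nonneg_nonneg x(1))
  have "adj_eigenvalue V E (complex_of_real L)"
    unfolding adj_eigenvalue_def
  proof (intro exI[of _ "\<lambda>v. complex_of_real (x v)"] conjI ballI)
    fix v assume v: "v \<in> V"
    show "(\<Sum>u\<in>V. (if {u, v} \<in> E then 1 else 0) * complex_of_real (x u)) = complex_of_real L * complex_of_real (x v)"
      using arg_cong[OF xL[OF v], of complex_of_real] unfolding adjop_def by (simp add: if_distrib if_distribR cong: if_cong)
  qed (use x0 in auto)
  moreover have "cmod \<mu> \<le> L" if ev: "adj_eigenvalue V E \<mu>" for \<mu>
  proof -
    obtain m z where m: "\<mu> = complex_of_real m" and z: "(\<Sum>v\<in>V. (z v)\<^sup>2) = 1" "\<forall>v\<in>V. adjop V E z v = m * z v"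
      using adj_eigenvalue_real[OF fin ev] by blast
    have "qform V E z = (\<Sum>v\<in>V. m * (z v)\<^sup>2)" unfolding qform_def using z(2)
      by (intro sum.cong) (auto simp: power2_eq_square)
    hence "\<bar>m\<bar> = \<bar>qform V E z\<bar>" using z(1) by (simp add: sum_distrib_left[symmetric])
    also have "\<dots> \<le> qform V E (\<lambda>v. \<bar>z v\<bar>)"
      unfolding qform_def adjop_def sum_distrib_left
      by (rule order_trans[OF sum_abs], rule sum_mono, rule order_trans[OF sum_abs], rule sum_mono) (simp add: abs_mult)
    also have "\<dots> \<le> L" using L[of "\<lambda>v. \<bar>z v\<bar>"] z by simp
    finally show ?thesis using m by simp
  qed
  ultimately have "spectral_radius V E = L"
    unfolding spectral_radius_def using finite_adj_eigenvalues[OF fin, of E] L0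
    by (intro Max_eqI) (auto simp: intro!: exI[of _ "complex_of_real L"])
  thus "qform V E y \<le> spectral_radius V E * (\<Sum>v\<in>V. (y v)\<^sup>2)"
    and "\<exists>x. (\<forall>v. 0 \<le> x v) \<and> (\<exists>v\<in>V. x v \<noteq> 0) \<and> (\<forall>v\<in>V. adjop V E x v = spectral_radius V E * x v)"
    using L xL x(1) x0 by auto
qed

lemma rayleigh_eq_eigen:
  assumes "finite V" "V \<noteq> {}" "qform V E x = spectral_radius V E * (\<Sum>v\<in>V. (x v)\<^sup>2)" "v \<in> V"
  shows "adjop V E x v = spectral_radius V E * x v"
  using rayleigh_eq_imp_eigen[OF assms(1) rayleigh_le[OF assms(1,2)] assms(3,4)] .

lemma adj_eigenvalue_iso:
  assumes "bij_betw f V V'" "\<forall>u\<in>V. \<forall>v\<in>V. {u, v} \<in> E \<longleftrightarrow> {f u, f v} \<in> E'" "adj_eigenvalue V' E' \<mu>"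
  shows "adj_eigenvalue V E \<mu>"
proof -
  from assms(3) obtain z where nz: "\<exists>v\<in>V'. z v \<noteq> 0"
    and z: "\<And>v. v \<in> V' \<Longrightarrow> (\<Sum>u\<in>V'. (if {u, v} \<in> E' then 1 else 0) * z u) = \<mu> * z v"
    unfolding adj_eigenvalue_def by blast
  show ?thesis unfolding adj_eigenvalue_def
  proof (intro exI[of _ "z \<circ> f"] conjI ballI)
    show "\<exists>v\<in>V. (z \<circ> f) v \<noteq> 0" using nz assms(1) by (auto simp: bij_betw_def)
    fix v assume v: "v \<in> V"
    have "(\<Sum>u\<in>V'. (if {u, f v} \<in> E' then 1 else 0) * z u) = (\<Sum>u\<in>V. (if {f u, f v} \<in> E' then 1 else 0) * z (f u))"
      by (rule sum.reindex_bij_betw[OF assms(1), symmetric])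
    also have "\<dots> = (\<Sum>u\<in>V. (if {u, v} \<in> E then 1 else 0) * (z \<circ> f) u)"
      using assms(2) v by (intro sum.cong) auto
    finally show "(\<Sum>u\<in>V. (if {u, v} \<in> E then 1 else 0) * (z \<circ> f) u) = \<mu> * (z \<circ> f) v"
      using z[of "f v"] v assms(1) by (auto simp: bij_betw_def)
  qed
qed

lemma graph_iso_sym:
  assumes "graph_iso V E V' E'" shows "graph_iso V' E' V E"
proof -
  from assms obtain f where f: "bij_betw f V V'" "\<forall>u\<in>V. \<forall>v\<in>V. {u, v} \<in> E \<longleftrightarrow> {f u, f v} \<in> E'"
    unfolding graph_iso_def by blast
  show ?thesis unfolding graph_iso_def
    using f by (intro exI[of _ "inv_into V f"] conjI bij_betw_inv_into)
      (auto simp: bij_betw_inv_into_right bij_betwE bij_betw_apply[OF bij_betw_inv_into])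
qed

lemma spectral_radius_iso:
  assumes "graph_iso V E V' E'"
  shows "spectral_radius V E = spectral_radius V' E'"
proof -
  obtain f where f: "bij_betw f V V'" "\<forall>u\<in>V. \<forall>v\<in>V. {u, v} \<in> E \<longleftrightarrow> {f u, f v} \<in> E'"
    using assms unfolding graph_iso_def by blast
  obtain g where g: "bij_betw g V' V" "\<forall>u\<in>V'. \<forall>v\<in>V'. {u, v} \<in> E' \<longleftrightarrow> {g u, g v} \<in> E"
    using graph_iso_sym[OF assms] unfolding graph_iso_def by blast
  have "adj_eigenvalue V E \<mu> \<longleftrightarrow> adj_eigenvalue V' E' \<mu>" for \<mu>
    using adj_eigenvalue_iso[OF f] adj_eigenvalue_iso[OF g] by (rule iffI[rotated])
  thus ?thesis unfolding spectral_radius_def by simp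
qed

section \<open>Theta curves in the plane\<close>

lemma arc_join_loop:
  assumes "arc c1" "arc c2" "pathstart c1 = a" "pathfinish c1 = b" "pathstart c2 = a" "pathfinish c2 = b"
    "path_image c1 \<inter> path_image c2 = {a, b}"
  shows "simple_path (c1 +++ reversepath c2)" "pathfinish (c1 +++ reversepath c2) = pathstart (c1 +++ reversepath c2)"
    "path_image (c1 +++ reversepath c2) = path_image c1 \<union> path_image c2"
  using assms by (auto simp: simple_path_join_loop_eq arc_reversepath path_image_join)

lemma Jordan_arcs:
  fixes c1 c2 :: "real \<Rightarrow> complex"
  assumes "arc c1" "arc c2" "pathstart c1 = a" "pathfinish c1 = b" "pathstart c2 = a" "pathfinish c2 = b"
    "path_image c1 \<inter> path_image c2 = {a, b}"
  defines "J \<equiv> path_image c1 \<union> path_image c2"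
  shows "inside J \<noteq> {}" "open (inside J)" "connected (inside J)" "open (outside J)" "connected (outside J)"
    "bounded (inside J)" "\<not> bounded (outside J)" "inside J \<inter> outside J = {}" "inside J \<union> outside J = - J"
    "frontier (inside J) = J"
  using Jordan_inside_outside[OF arc_join_loop(1,2)[OF assms(1-7)]] unfolding arc_join_loop(3)[OF assms(1-7)] J_def
  by simp_all

lemma connected_inside_or_outside:
  assumes J: "open (inside J)" "open (outside J)" "inside J \<inter> outside J = {}" "inside J \<union> outside J = - J"
    and S: "connected S" "S \<inter> J = {}"
  shows "S \<subseteq> inside J \<or> S \<subseteq> outside J"
  using connectedD[OF S(1) J(1,2)] J(3,4) S(2) by blast

lemma arc_minus_ends:
  fixes c :: "real \<Rightarrow> 'b::t2_space"
  assumes "arc c" "pathstart c = a" "pathfinish c = b"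
  shows "connected (path_image c - {a, b})" "path_image c - {a, b} \<noteq> {}"
proof -
  have eq: "path_image c - {a, b} = c ` {0<..<1}"
    using assms unfolding arc_def path_image_def pathstart_def pathfinish_def inj_on_def
    by (auto simp: image_iff less_le)
  have "continuous_on {0<..<1} c" using assms(1) unfolding arc_def path_def
    by (meson continuous_on_subset greaterThanLessThan_subseteq_atLeastAtMost_iff order_refl)
  thus "connected (path_image c - {a, b})" unfolding eq by (intro connected_continuous_image) auto
  show "path_image c - {a, b} \<noteq> {}" unfolding eq by auto
qed

locale theta =
  fixes c1 c2 c3 :: "real \<Rightarrow> complex" and a b :: complex
  assumes arcs: "arc c1" "arc c2" "arc c3"
    and st: "pathstart c1 = a" "pathfinish c1 = b" "pathstart c2 = a" "pathfinish c2 = b" "pathstart c3 = a" "pathfinish c3 = b"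
    and int: "path_image c1 \<inter> path_image c2 = {a, b}" "path_image c1 \<inter> path_image c3 = {a, b}" "path_image c2 \<inter> path_image c3 = {a, b}"
begin

abbreviation "P1 \<equiv> path_image c1"
abbreviation "P2 \<equiv> path_image c2"
abbreviation "P3 \<equiv> path_image c3"

lemma ab: "a \<noteq> b" using arcs(1) st arc_distinct_ends by blast

lemma split:
  assumes "P3 \<inter> inside (P1 \<union> P2) \<noteq> {}"
  shows "inside(P1 \<union> P3) \<inter> inside(P2 \<union> P3) = {}"
        "inside(P1 \<union> P3) \<union> inside(P2 \<union> P3) \<union>
           (P3 - {a,b}) = inside(P1 \<union> P2)"
  using split_inside_simple_closed_curve[OF arc_imp_simple_path[OF arcs(1)] st(1,2) arc_imp_simple_path[OF arcs(2)] st(3,4)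
      arc_imp_simple_path[OF arcs(3)] st(5,6) ab int assms] by auto

lemma swap12: "theta c2 c1 c3 a b"
  by unfold_locales (use arcs st int in auto)

lemma swap23: "theta c1 c3 c2 a b"
  by unfold_locales (use arcs st int in auto)

lemma c3_side: "P3 - {a,b} \<subseteq> inside (P1 \<union> P2) \<or>
    P3 - {a,b} \<subseteq> outside (P1 \<union> P2)"
  using Jordan_arcs[OF arcs(1,2) st(1-4) int(1)] arc_minus_ends[OF arcs(3) st(5,6)] int
  by (intro connected_inside_or_outside) auto

lemma closure_inside_subset:
  "S \<subseteq> inside (P1 \<union> P2) \<Longrightarrow>
    closure S \<subseteq> inside (P1 \<union> P2) \<union> P1 \<union> P2"
  using closure_mono[of S "inside (P1 \<union> P2)"]
    Jordan_arcs(10)[OF arcs(1,2) st(1-4) int(1)] by (auto simp: closure_Un_frontier)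

text \<open>The third arc cuts the inside of the cycle into two regions, and \<open>S\<close> lies
  in one of them. The closure of that region misses the interior of one of the two boundary
  arcs.\<close>

lemma no_cross_inside:
  assumes S: "connected S" "S \<inter> (P1 \<union> P2 \<union> P3) = {}"
    and x: "x \<in> closure S" "x \<in> P1" "x \<notin> {a,b}"
    and y: "y \<in> closure S" "y \<in> P2" "y \<notin> {a,b}"
    and Sin: "S \<subseteq> inside (P1 \<union> P2)"
    and c3: "P3 \<inter> inside (P1 \<union> P2) \<noteq> {}"
  shows False
proof -
  note sp = split[OF c3]
  interpret t13: theta c1 c3 c2 a b by (rule swap23)
  interpret t21: theta c2 c1 c3 a b by (rule swap12)
  interpret t23: theta c2 c3 c1 a b by (rule t21.swap23)
  have J: "inside (P1 \<union> P2) \<inter> (P1 \<union> P2) = {}"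
    by (simp add: inside_no_overlap)
  have "S \<subseteq> inside(P1 \<union> P3) \<union> inside(P2 \<union> P3)"
    using sp Sin S by blast
  moreover have "open (inside(P1 \<union> P3))" "open (inside(P2 \<union> P3))"
    using Jordan_arcs(2)[OF t13.arcs(1,2) t13.st(1-4) t13.int(1)] Jordan_arcs(2)[OF t23.arcs(1,2) t23.st(1-4) t23.int(1)] by auto
  ultimately have "S \<subseteq> inside(P1 \<union> P3) \<or> S \<subseteq> inside(P2 \<union> P3)"
    using connectedD[OF S(1), of "inside(P1 \<union> P3)" "inside(P2 \<union> P3)"] sp(1) by blast
  thus False
  proof
    assume "S \<subseteq> inside(P1 \<union> P3)"
    from t13.closure_inside_subset[OF this] y have "y \<in> inside(P1 \<union> P3) \<union> P1 \<union> P3"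
      by blast
    thus False using y sp J int by blast
  next
    assume "S \<subseteq> inside(P2 \<union> P3)"
    from t23.closure_inside_subset[OF this] x have "x \<in> inside(P2 \<union> P3) \<union> P2 \<union> P3"
      by blast
    thus False using x sp J int by blast
  qed
qed

end

text \<open>With \<open>inverse 0 = 0\<close> the inversion is injective on the whole plane; its
  only discontinuity \<open>p\<close> lies off the curve.\<close>

lemma theta_invert:
  assumes "theta c1 c2 c3 a b" and p: "p \<notin> path_image c1 \<union> path_image c2 \<union> path_image c3"
  defines "f \<equiv> \<lambda>z. inverse (z - p)"
  shows "theta (f \<circ> c1) (f \<circ> c2) (f \<circ> c3) (f a) (f b)"
proof -
  interpret theta c1 c2 c3 a b by fact
  let ?T = "path_image c1 \<union> path_image c2 \<union> path_image c3"
  have inj: "inj f" unfolding f_def inj_def by simp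
  have cont: "continuous_on ?T f" unfolding f_def using p
    by (intro continuous_intros) auto
  have "arc (f \<circ> c)" if "arc c" "path_image c \<subseteq> ?T" for c
    using that inj cont unfolding arc_def
    by (auto intro!: path_continuous_image comp_inj_on inj_on_subset[OF inj] continuous_on_subset[OF cont])
  thus ?thesis
    using arcs st int image_Int[OF inj, symmetric]
    by unfold_locales (auto simp: path_image_compose pathstart_compose pathfinish_compose)
qed

text \<open>The value 0 stands for the image of the point at infinity.\<close>

lemma unbounded_invert:
  fixes P :: "complex set"
  assumes "\<not> bounded P" shows "0 \<in> closure ((\<lambda>z. inverse (z - p)) ` P)"
proof -
  have "\<exists>y\<in>(\<lambda>z. inverse (z - p)) ` P. dist y 0 < e" if e: "e > 0" for e :: real
  proof -
    obtain z where z: "z \<in> P" "norm z > norm p + 1 / e" using assms unfolding bounded_iff by (meson linorder_not_le)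
    have "norm (z - p) > 1 / e" using z norm_triangle_ineq2[of z p] by linarith
    hence "norm (inverse (z - p)) < e" using e
      by (simp add: norm_inverse) (metis divide_pos_pos inverse_eq_divide inverse_inverse_eq inverse_less_imp_less less_imp_inverse_less zero_less_one)
    thus ?thesis using z by auto
  qed
  thus ?thesis by (simp add: closure_approachable)
qed

context theta begin

text \<open>The inversion centred at a point inside the cycle exchanges its two sides.\<close>

lemma no_cross_outside:
  assumes S: "connected S" "S \<inter> (P1 \<union> P2 \<union> P3) = {}"
    and x: "x \<in> closure S" "x \<in> P1" "x \<notin> {a,b}"
    and y: "y \<in> closure S" "y \<in> P2" "y \<notin> {a,b}"
    and Sout: "S \<subseteq> outside (P1 \<union> P2)"
    and c3: "P3 \<inter> outside (P1 \<union> P2) \<noteq> {}"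
  shows False
proof -
  let ?J = "P1 \<union> P2"
  note J = Jordan_arcs[OF arcs(1,2) st(1-4) int(1)]
  obtain p where p: "p \<in> inside ?J" using J(1) by auto
  have c3o: "P3 - {a,b} \<subseteq> outside ?J"
  proof -
    have "a \<in> ?J" "b \<in> ?J" using int(1) by blast+
    hence "a \<notin> outside ?J" "b \<notin> outside ?J" using J(9) by blast+
    thus ?thesis using c3_side c3 J(8) by blast
  qed
  have pn: "p \<notin> ?J \<union> P3"
    using p c3o J(8,9) inside_no_overlap[of ?J] int by blast
  define f where "f = (\<lambda>z. inverse (z - p))"
  interpret t': theta "f \<circ> c1" "f \<circ> c2" "f \<circ> c3" "f a" "f b"
    unfolding f_def by (rule theta_invert[OF theta_axioms pn])
  have inj: "inj f" unfolding f_def inj_def by simp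
  have cont: "continuous_on (- {p}) f" unfolding f_def by (intro continuous_intros) auto
  have cont0: "isCont f z" if "z \<noteq> p" for z unfolding f_def using that by (intro continuous_intros) auto
  let ?J' = "path_image (f \<circ> c1) \<union> path_image (f \<circ> c2)"
  note J' = Jordan_arcs[OF t'.arcs(1,2) t'.st(1-4) t'.int(1)]
  have J'eq: "?J' = f ` ?J" by (simp add: path_image_compose image_Un)
  let ?O = "outside ?J"
  have pO: "p \<notin> ?O" using p J(8) by blast
  have f0: "f z = 0 \<longleftrightarrow> z = p" for z unfolding f_def by simp
  \<comment> \<open>Adjoining 0, the image of infinity, keeps the image of the outside connected, as
    0 is one of its limit points.\<close>
  have connO: "connected (insert 0 (f ` ?O))"
  proof (rule connected_intermediate_closure[of "f ` ?O"])
    show "connected (f ` ?O)"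
      using J(5) pO by (intro connected_continuous_image continuous_on_subset[OF cont]) auto
    show "insert 0 (f ` ?O) \<subseteq> closure (f ` ?O)"
      using unbounded_invert[OF J(7), of p] closure_subset[of "f ` ?O"] by (simp add: f_def)
  qed auto
  have disj: "insert 0 (f ` ?O) \<inter> ?J' = {}"
  proof -
    have "?O \<inter> ?J = {}" using J(9) by blast
    hence 1: "f ` ?O \<inter> f ` ?J = {}" using image_Int[OF inj, of ?O ?J] by simp
    have 2: "0 \<notin> f ` ?J"
    proof
      assume "0 \<in> f ` ?J"
      then obtain w where "w \<in> ?J" "f w = 0" by force
      thus False using f0 pn by simp
    qed
    show ?thesis unfolding J'eq using 1 2 by simp
  qed
  \<comment> \<open>Otherwise the outside of the new cycle, without 0, pulls back under the inverse
    map \<open>h\<close> into the outside of the old one, hence away from a ball around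
    \<open>p\<close>; this would make the new outside bounded.\<close>
  have "insert 0 (f ` ?O) \<subseteq> inside ?J'"
  proof (rule ccontr)
    assume "\<not> ?thesis"
    hence sub: "insert 0 (f ` ?O) \<subseteq> outside ?J'"
      using connected_inside_or_outside[OF J'(2,4,8,9) connO disj] by blast
    define h where "h = (\<lambda>w. p + inverse w)"
    have hf: "h (f z) = z" for z unfolding h_def f_def by simp
    have fh: "f (h w) = w" for w unfolding h_def f_def by simp
    have "connected (outside ?J' - {0})"
      using J'(4,5) by (intro connected_open_delete) auto
    hence "connected (h ` (outside ?J' - {0}))"
      unfolding h_def by (intro connected_continuous_image continuous_intros) auto
    moreover have "h ` (outside ?J' - {0}) \<inter> ?J = {}"
    proof -
      have "h w \<notin> ?J" if w: "w \<in> outside ?J'" for w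
      proof
        assume "h w \<in> ?J"
        hence "f (h w) \<in> ?J'" unfolding J'eq by (rule imageI)
        hence "w \<in> ?J'" unfolding fh .
        thus False using w J'(9) by blast
      qed
      thus ?thesis by auto
    qed
    ultimately have "h ` (outside ?J' - {0}) \<subseteq> inside ?J \<or> h ` (outside ?J' - {0}) \<subseteq> ?O"
      by (intro connected_inside_or_outside J)
    moreover obtain q where q: "q \<in> ?O" using J(7) by (metis bounded_empty ex_in_conv)
    moreover have "q \<in> h ` (outside ?J' - {0})"
    proof (rule image_eqI[of _ _ "f q"])
      show "q = h (f q)" by (simp only: hf)
      have "f q \<noteq> 0" using f0 q pO by auto
      moreover have "f q \<in> outside ?J'" using sub q by blast
      ultimately show "f q \<in> outside ?J' - {0}" by blast
    qed
    ultimately have hs: "h ` (outside ?J' - {0}) \<subseteq> ?O" using J(8) by blast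
    obtain r where r: "r > 0" "ball p r \<subseteq> inside ?J" using J(2) p open_contains_ball by blast
    have "norm w \<le> 1 / r" if w: "w \<in> outside ?J'" for w
    proof (cases "w = 0")
      case False
      hence "h w \<in> ?O" using hs w by auto
      hence "h w \<notin> ball p r" using r(2) J(8) by blast
      hence "norm (inverse w) \<ge> r" by (simp add: h_def dist_norm)
      hence "r \<le> 1 / norm w" by (simp add: norm_divide inverse_eq_divide)
      thus ?thesis using False r(1) by (simp add: field_simps)
    qed (use r in auto)
    hence "bounded (outside ?J')" unfolding bounded_iff by blast
    thus False using J'(7) by simp
  qed
  hence Oin: "f ` ?O \<subseteq> inside ?J'" by simp
  have xp: "x \<noteq> p" "y \<noteq> p" using x y pn by auto
  have cl: "f z \<in> closure (f ` S)" if z: "z \<in> closure S" "z \<noteq> p" for z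
  proof -
    obtain s where s: "\<And>n. s n \<in> S" "s \<longlonglongrightarrow> z" using z(1) unfolding closure_sequential by auto
    have "(\<lambda>n. f (s n)) \<longlonglongrightarrow> f z" using cont0[OF z(2)] s(2) by (rule isCont_tendsto_compose)
    thus ?thesis unfolding closure_sequential using s(1) by (intro exI[of _ "\<lambda>n. f (s n)"]) auto
  qed
  show False
  proof (rule t'.no_cross_inside[of "f ` S" "f x" "f y"])
    show "connected (f ` S)" using S(1) Sout pO by (intro connected_continuous_image continuous_on_subset[OF cont]) auto
    show "f ` S \<inter> (path_image (f \<circ> c1) \<union> path_image (f \<circ> c2) \<union> path_image (f \<circ> c3)) = {}"
      using S(2) inj by (auto simp: path_image_compose inj_def)
    show "f x \<in> closure (f ` S)" "f y \<in> closure (f ` S)" using cl x y xp by auto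
    show "f x \<in> path_image (f \<circ> c1)" "f y \<in> path_image (f \<circ> c2)" using x y by (auto simp: path_image_compose)
    show "f x \<notin> {f a, f b}" "f y \<notin> {f a, f b}" using x y inj by (auto simp: inj_def)
    show "f ` S \<subseteq> inside ?J'" using Oin Sout by auto
    show "path_image (f \<circ> c3) \<inter> inside ?J' \<noteq> {}"
      using c3 Oin by (auto simp: path_image_compose)
  qed
qed

text \<open>\<open>S\<close> touches the interiors of the first two arcs, so a third arc on the same
  side of their cycle would separate the two contacts. In this form the fact serves for both K(3,3)
  and K(5).\<close>

lemma opposite_sides:
  assumes S: "connected S" "S \<inter> (P1 \<union> P2 \<union> P3) = {}"
    and x: "x \<in> closure S" "x \<in> P1" "x \<notin> {a,b}"
    and y: "y \<in> closure S" "y \<in> P2" "y \<notin> {a,b}"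
  shows "(S \<subseteq> inside (P1 \<union> P2) \<and> P3 - {a,b} \<subseteq> outside (P1 \<union> P2)) \<or>
    (S \<subseteq> outside (P1 \<union> P2) \<and> P3 - {a,b} \<subseteq> inside (P1 \<union> P2))"
proof -
  let ?J = "P1 \<union> P2"
  note J = Jordan_arcs[OF arcs(1,2) st(1-4) int(1)]
  have "S \<subseteq> inside ?J \<or> S \<subseteq> outside ?J"
    using S by (intro connected_inside_or_outside J) auto
  moreover have "P3 - {a,b} \<noteq> {}" using arc_minus_ends[OF arcs(3) st(5,6)] by simp
  ultimately show ?thesis
    using c3_side no_cross_inside[OF S x y] no_cross_outside[OF S x y] by blast
qed

text \<open>If S lay outside the cycle of two of the arcs, the third arc would be inside and the second arc would be
  inside the cycle of the other two, hence inside its own cycle. If S lies inside all three cycles, the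
  insides coincide, and so do their frontiers.\<close>

lemma no_triple:
  assumes S: "connected S" "S \<inter> (P1 \<union> P2 \<union> P3) = {}"
    and x: "x \<in> closure S" "x \<in> P1" "x \<notin> {a,b}"
    and y: "y \<in> closure S" "y \<in> P2" "y \<notin> {a,b}"
    and z: "z \<in> closure S" "z \<in> P3" "z \<notin> {a,b}"
  shows False
proof -
  interpret t132: theta c1 c3 c2 a b by (rule swap23)
  interpret t213: theta c2 c1 c3 a b by (rule swap12)
  interpret t231: theta c2 c3 c1 a b by (rule t213.swap23)
  let ?I12 = "inside (P1 \<union> P2)"
  let ?I13 = "inside (P1 \<union> P3)"
  let ?I23 = "inside (P2 \<union> P3)"
  note J12 = Jordan_arcs[OF arcs(1,2) st(1-4) int(1)]
  note J13 = Jordan_arcs[OF t132.arcs(1,2) t132.st(1-4) t132.int(1)]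
  note J23 = Jordan_arcs[OF t231.arcs(1,2) t231.st(1-4) t231.int(1)]
  have n1: "P1 - {a,b} \<noteq> {}" using arc_minus_ends[OF arcs(1) st(1,2)] by simp
  have n2: "P2 - {a,b} \<noteq> {}" using arc_minus_ends[OF arcs(2) st(3,4)] by simp
  have n3: "P3 - {a,b} \<noteq> {}" using arc_minus_ends[OF arcs(3) st(5,6)] by simp
  have Sne: "S \<noteq> {}" using x by auto
  have o12: "(S \<subseteq> ?I12 \<and> P3 - {a,b} \<subseteq> outside (P1 \<union> P2)) \<or>
    (S \<subseteq> outside (P1 \<union> P2) \<and> P3 - {a,b} \<subseteq> ?I12)"
    by (rule opposite_sides[OF S x y])
  have o13: "(S \<subseteq> ?I13 \<and> P2 - {a,b} \<subseteq> outside (P1 \<union> P3)) \<or>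
    (S \<subseteq> outside (P1 \<union> P3) \<and> P2 - {a,b} \<subseteq> ?I13)"
    by (rule t132.opposite_sides[OF S(1) _ x z]) (use S in auto)
  have o23: "(S \<subseteq> ?I23 \<and> P1 - {a,b} \<subseteq> outside (P2 \<union> P3)) \<or>
    (S \<subseteq> outside (P2 \<union> P3) \<and> P1 - {a,b} \<subseteq> ?I23)"
    by (rule t231.opposite_sides[OF S(1) _ y z]) (use S in auto)
  have in12: "S \<subseteq> ?I12"
  proof (rule ccontr)
    assume "\<not> S \<subseteq> ?I12"
    with o12 have "S \<subseteq> outside (P1 \<union> P2)" and c3: "P3 - {a,b} \<subseteq> ?I12" by auto
    have "P3 \<inter> ?I12 \<noteq> {}" using c3 n3 by blast
    note sp = split[OF this]
    have "\<not> S \<subseteq> ?I13" using sp(2) J12(8) Sne \<open>S \<subseteq> outside _\<close> by blast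
    hence "P2 - {a,b} \<subseteq> ?I13" using o13 by blast
    hence "P2 - {a,b} \<subseteq> ?I12" using sp(2) by blast
    thus False using n2 inside_no_overlap[of "P1 \<union> P2"] by blast
  qed
  have in13: "S \<subseteq> ?I13"
  proof (rule ccontr)
    assume "\<not> S \<subseteq> ?I13"
    with o13 have "S \<subseteq> outside (P1 \<union> P3)" and c2: "P2 - {a,b} \<subseteq> ?I13" by auto
    have "P2 \<inter> ?I13 \<noteq> {}" using c2 n2 by blast
    note sp = t132.split[OF this]
    have "\<not> S \<subseteq> ?I12" using sp(2) J13(8) Sne \<open>S \<subseteq> outside _\<close> by blast
    thus False using in12 by blast
  qed
  have "P3 - {a,b} \<subseteq> outside (P1 \<union> P2)"
    using o12 in12 Sne J12(8) by blast
  hence "?I12 \<inter> (P1 \<union> P3) = {}"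
    using J12(8) inside_no_overlap[of "P1 \<union> P2"] int by blast
  hence "?I12 \<subseteq> ?I13"
    using connected_inside_or_outside[OF J13(2,4,8,9) J12(3)] in12 in13 Sne J13(8) by blast
  moreover have "P2 - {a,b} \<subseteq> outside (P1 \<union> P3)"
    using o13 in13 Sne J13(8) by blast
  hence "?I13 \<inter> (P1 \<union> P2) = {}"
    using J13(8) inside_no_overlap[of "P1 \<union> P3"] int by blast
  hence "?I13 \<subseteq> ?I12"
    using connected_inside_or_outside[OF J12(2,4,8,9) J13(3)] in12 in13 Sne J12(8) by blast
  ultimately have "?I12 = ?I13" by blast
  hence "P1 \<union> P2 = P1 \<union> P3" using J12(10) J13(10) by metis
  thus False using n2 int by blast
qed

end

section \<open>Nonplanarity of subdivided graphs\<close>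

lemma arc_minus_finish:
  fixes c :: "real \<Rightarrow> 'b::t2_space"
  assumes "arc c"
  shows "connected (path_image c - {pathfinish c})" "pathfinish c \<in> closure (path_image c - {pathfinish c})"
    "pathstart c \<in> path_image c - {pathfinish c}"
proof -
  have eq: "path_image c - {pathfinish c} = c ` {0..<1}"
    using assms unfolding arc_def path_image_def pathfinish_def inj_on_def
    by (auto simp: image_iff less_le)
  have cont: "continuous_on {0..1} c" using assms(1) unfolding arc_def path_def by simp
  have "continuous_on {0..<1} c" using cont by (rule continuous_on_subset) auto
  thus "connected (path_image c - {pathfinish c})" unfolding eq by (intro connected_continuous_image) auto
  have "c ` closure {0..<1} \<subseteq> closure (c ` {0..<1})"
    by (rule image_closure_subset) (use cont closure_subset[of "c ` {0..<1}"] in auto)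
  thus "pathfinish c \<in> closure (path_image c - {pathfinish c})" unfolding eq by (auto simp: pathfinish_def)
  show "pathstart c \<in> path_image c - {pathfinish c}" unfolding eq by (auto simp: pathstart_def)
qed

lemma closure_arc_minus_ends:
  fixes c :: "real \<Rightarrow> 'b::t2_space"
  assumes "arc c" "pathstart c = a" "pathfinish c = b"
  shows "a \<in> closure (path_image c - {a, b})" "b \<in> closure (path_image c - {a, b})"
proof -
  have eq: "path_image c - {a, b} = c ` {0<..<1}"
    using assms unfolding arc_def path_image_def pathstart_def pathfinish_def inj_on_def
    by (auto simp: image_iff less_le)
  have "continuous_on {0..1} c" using assms(1) unfolding arc_def path_def by simp
  hence "c ` closure {0<..<1} \<subseteq> closure (c ` {0<..<1})"
    by (intro image_closure_subset) (use closure_subset[of "c ` {0<..<1}"] in auto)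
  thus "a \<in> closure (path_image c - {a, b})" "b \<in> closure (path_image c - {a, b})"
    unfolding eq using assms(2,3) by (auto simp: pathfinish_def pathstart_def)
qed

text \<open>Joining at \<open>B j\<close> the arcs from \<open>A 0\<close> and \<open>A 1\<close>
  gives a theta curve. The open star at \<open>A 2\<close> is a connected set that reaches the
  interiors of all its three arcs, against \<open>no_triple\<close>.\<close>

lemma K33_arcs:
  fixes \<gamma> :: "nat \<Rightarrow> nat \<Rightarrow> real \<Rightarrow> complex"
  assumes arc: "\<And>i j. i < 3 \<Longrightarrow> j < 3 \<Longrightarrow> arc (\<gamma> i j)"
    and st: "\<And>i j. i < 3 \<Longrightarrow> j < 3 \<Longrightarrow> pathstart (\<gamma> i j) = A i"
    and fi: "\<And>i j. i < 3 \<Longrightarrow> j < 3 \<Longrightarrow> pathfinish (\<gamma> i j) = B j"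
    and int: "\<And>i j i' j'. i < 3 \<Longrightarrow> j < 3 \<Longrightarrow> i' < 3 \<Longrightarrow> j' < 3 \<Longrightarrow> i \<noteq> i' \<or> j \<noteq> j' \<Longrightarrow>
       path_image (\<gamma> i j) \<inter> path_image (\<gamma> i' j') \<subseteq> (if i = i' then {A i} else {}) \<union> (if j = j' then {B j} else {})"
  shows False
proof -
  have Aim: "A i \<in> path_image (\<gamma> i j)" "B j \<in> path_image (\<gamma> i j)" if "i < 3" "j < 3" for i j
    using st[OF that] fi[OF that] by (metis pathstart_in_path_image, metis pathfinish_in_path_image)
  have AB: "A i \<noteq> B j" if "i < 3" "j < 3" for i j
    using arc_distinct_ends[OF arc[OF that]] st[OF that] fi[OF that] by simp
  have A01: "A 0 \<noteq> A 1"
    using int[of 0 0 1 0] Aim[of 0 0] Aim[of 1 0] AB[of 0 0] by auto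
  define c where "c j = \<gamma> 0 j +++ reversepath (\<gamma> 1 j)" for j
  have cim: "path_image (c j) = path_image (\<gamma> 0 j) \<union> path_image (\<gamma> 1 j)" if "j < 3" for j
    unfolding c_def using fi[of 0 j] fi[of 1 j] that by (simp add: path_image_join)
  have carc: "arc (c j)" if j: "j < 3" for j
    unfolding c_def
    by (rule arc_join) (use j arc[of 0 j] arc[of 1 j] fi[of 0 j] fi[of 1 j] int[of 0 j 1 j] in \<open>auto simp: arc_reversepath\<close>)
  have cst: "pathstart (c j) = A 0" "pathfinish (c j) = A 1" if "j < 3" for j
    unfolding c_def using st that by auto
  have cint: "path_image (c j) \<inter> path_image (c j') = {A 0, A 1}" if j: "j < 3" "j' < 3" "j \<noteq> j'" for j j'
  proof
    show "path_image (c j) \<inter> path_image (c j') \<subseteq> {A 0, A 1}"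
      unfolding cim[OF j(1)] cim[OF j(2)]
      using int[of 0 j 0 j'] int[of 0 j 1 j'] int[of 1 j 0 j'] int[of 1 j 1 j'] j by auto
    show "{A 0, A 1} \<subseteq> path_image (c j) \<inter> path_image (c j')"
      unfolding cim[OF j(1)] cim[OF j(2)] using Aim j by auto
  qed
  interpret th: theta "c 0" "c 1" "c 2" "A 0" "A 1"
    by unfold_locales (simp_all add: carc cst cint)
  define S where "S = (\<Union>j\<in>{0,1,2}. path_image (\<gamma> 2 j) - {B j})"
  have c2: "connected (path_image (\<gamma> 2 j) - {B j})" "B j \<in> closure (path_image (\<gamma> 2 j) - {B j})"
     "A 2 \<in> path_image (\<gamma> 2 j) - {B j}" if "j < 3" for j
    using arc_minus_finish[OF arc[of 2 j]] st[of 2 j] fi[of 2 j] that by auto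
  have S: "connected S" unfolding S_def
  proof (rule connected_Union)
    have "A 2 \<in> (\<Inter>j\<in>{0,1,2}. path_image (\<gamma> 2 j) - {B j})" using c2(3) by auto
    thus "(\<Inter>j\<in>{0,1,2}. path_image (\<gamma> 2 j) - {B j}) \<noteq> {}" by blast
  qed (use c2 in auto)
  have clS: "B j \<in> closure S" if "j < 3" for j
  proof -
    have "j \<in> {0,1,2}" using that by auto
    hence "path_image (\<gamma> 2 j) - {B j} \<subseteq> S" unfolding S_def by blast
    thus ?thesis using closure_mono c2(2)[OF that] by blast
  qed
  have disj: "S \<inter> path_image (c j) = {}" if j: "j < 3" for j
  proof -
    have k: "(path_image (\<gamma> 2 j') - {B j'}) \<inter> path_image (\<gamma> i j) = {}" if "j' < 3" "i < 2" for i j'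
      using int[of 2 j' i j] that j by (cases "j = j'") auto
    show ?thesis unfolding S_def cim[OF j]
      using k[of 0 0] k[of 0 1] k[of 1 0] k[of 1 1] k[of 2 0] k[of 2 1] by auto
  qed
  have nAB: "B j \<notin> {A 0, A 1}" if "j < 3" for j using AB[of 0 j] AB[of 1 j] that by auto
  show False
    by (rule th.no_triple[OF S, of "B 0" "B 1" "B 2"])
      (use disj[of 0] disj[of 1] disj[of 2] clS nAB Aim cim in auto)
qed

section \<open>Paths, connected vertex sets and tripods\<close>

fun path_edges :: "'a list \<Rightarrow> 'a set set" where
  "path_edges (x # y # zs) = insert {x, y} (path_edges (y # zs))"
| "path_edges _ = {}"

lemma Union_path_edges: "\<Union> (path_edges vs) \<subseteq> set vs"
  by (induction vs rule: path_edges.induct) auto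

lemma path_edges_Cons: "path_edges (x # vs) = (if vs = [] then {} else insert {x, hd vs} (path_edges vs))"
  by (cases vs) auto

lemma path_edges_append:
  "path_edges (xs @ ys) = path_edges xs \<union> path_edges ys \<union> (if xs = [] \<or> ys = [] then {} else {{last xs, hd ys}})"
  by (induction xs rule: path_edges.induct) (auto simp: path_edges_Cons)

lemma path_edges_rev [simp]: "path_edges (rev xs) = path_edges xs"
  by (induction xs) (auto simp: path_edges_append path_edges_Cons last_rev insert_commute)

lemma path_edges_nth: "path_edges vs = {{vs ! i, vs ! (i + 1)} | i. i + 1 < length vs}"
proof (induction vs rule: path_edges.induct)
  case (1 x y zs)
  have "{{(x # y # zs) ! i, (x # y # zs) ! (i + 1)} | i. i + 1 < length (x # y # zs)} =
     insert {x, y} {{(y # zs) ! i, (y # zs) ! (i + 1)} | i. i + 1 < length (y # zs)}" (is "?L = ?R")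
  proof
    show "?L \<subseteq> ?R"
    proof
      fix e assume "e \<in> ?L"
      then obtain i where i: "e = {(x # y # zs) ! i, (x # y # zs) ! (i + 1)}" "i + 1 < length (x # y # zs)" by auto
      show "e \<in> ?R" using i by (cases i) auto
    qed
    show "?R \<subseteq> ?L"
    proof
      fix e assume "e \<in> ?R"
      then consider "e = {x, y}" | i where "e = {(y # zs) ! i, (y # zs) ! (i + 1)}" "i + 1 < length (y # zs)" by auto
      thus "e \<in> ?L"
      proof cases
        case 1 thus ?thesis by (auto intro!: exI[of _ 0])
      next
        case 2 thus ?thesis by (auto intro!: exI[of _ "Suc i"])
      qed
    qed
  qed
  thus ?case using 1 by simp
qed auto

lemma rtrancl_imp_path:
  assumes "(x, y) \<in> {(x, y). x \<in> B \<and> y \<in> B \<and> {x, y} \<in> E}\<^sup>*" "x \<in> B"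
  shows "\<exists>vs. vs \<noteq> [] \<and> hd vs = x \<and> last vs = y \<and> distinct vs \<and> set vs \<subseteq> B \<and> path_edges vs \<subseteq> E"
  using assms
proof (induction rule: converse_rtrancl_induct)
  case base thus ?case by (intro exI[of _ "[y]"]) auto
next
  case (step x z)
  then obtain vs where vs: "vs \<noteq> []" "hd vs = z" "last vs = y" "distinct vs" "set vs \<subseteq> B" "path_edges vs \<subseteq> E" by auto
  show ?case
  proof (cases "x \<in> set vs")
    case True
    then obtain a b where "vs = a @ x # b" by (meson split_list)
    thus ?thesis using vs by (intro exI[of _ "x # b"]) (auto simp: path_edges_append)
  next
    case False
    thus ?thesis using vs step by (intro exI[of _ "x # vs"]) (auto simp: path_edges_Cons)
  qed
qed

definition connected_in :: "'a set set \<Rightarrow> 'a set \<Rightarrow> bool" where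
  "connected_in E B \<longleftrightarrow> (\<forall>x\<in>B. \<forall>y\<in>B. (x, y) \<in> {(x, y). x \<in> B \<and> y \<in> B \<and> {x, y} \<in> E}\<^sup>*)"

lemma connected_in_singleton [simp]: "connected_in E {x}"
  by (simp add: connected_in_def)

lemma connected_in_path:
  assumes "connected_in E B" "x \<in> B" "y \<in> B"
  obtains vs where "vs \<noteq> []" "hd vs = x" "last vs = y" "distinct vs" "set vs \<subseteq> B" "path_edges vs \<subseteq> E"
  using assms rtrancl_imp_path[of x y B E] unfolding connected_in_def by blast

text \<open>A tripod with centre \<open>w\<close>. A leg may consist of \<open>w\<close> alone, so
  the three targets may coincide.\<close>

definition spider :: "'a set set \<Rightarrow> 'a set \<Rightarrow> (nat \<Rightarrow> 'a) \<Rightarrow> 'a \<Rightarrow> (nat \<Rightarrow> 'a list) \<Rightarrow> bool" where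
  "spider E B s w Q \<longleftrightarrow>
     (\<forall>i<3. Q i \<noteq> [] \<and> hd (Q i) = w \<and> last (Q i) = s i \<and> distinct (Q i) \<and> set (Q i) \<subseteq> B \<and> path_edges (Q i) \<subseteq> E)
     \<and> (\<forall>i<3. \<forall>j<3. i \<noteq> j \<longrightarrow> set (Q i) \<inter> set (Q j) \<subseteq> {w})"

text \<open>Take a path between two targets and cut a path from the third at its first vertex on the
  former; that vertex is the centre.\<close>

lemma connected_in_spider:
  assumes con: "connected_in E B" and s: "\<And>i. i < 3 \<Longrightarrow> s i \<in> B"
  shows "\<exists>w Q. spider E B s w Q"
proof -
  obtain R where R: "R \<noteq> []" "hd R = s 0" "last R = s 1" "distinct R" "set R \<subseteq> B" "path_edges R \<subseteq> E"
    using connected_in_path[OF con s[of 0] s[of 1]] by auto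
  obtain T where T: "T \<noteq> []" "hd T = s 2" "last T = s 0" "distinct T" "set T \<subseteq> B" "path_edges T \<subseteq> E"
    using connected_in_path[OF con s[of 2] s[of 0]] by auto
  have "\<exists>x\<in>set T. x \<in> set R" using R T by (metis hd_in_set last_in_set)
  then obtain ys w zs where T_eq: "T = ys @ w # zs" "w \<in> set R" "\<forall>y\<in>set ys. y \<notin> set R"
    using split_list_first_prop[of T "\<lambda>x. x \<in> set R"] by auto
  obtain r1 r2 where R_eq: "R = r1 @ w # r2" using T_eq(2) by (meson split_list)
  define Q :: "nat \<Rightarrow> 'a list" where "Q i = (if i = 0 then rev (r1 @ [w]) else if i = 1 then w # r2 else rev (ys @ [w]))" for i
  have "Q i \<noteq> [] \<and> hd (Q i) = w \<and> last (Q i) = s i \<and> distinct (Q i) \<and> set (Q i) \<subseteq> B \<and> path_edges (Q i) \<subseteq> E" if "i < 3" for i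
  proof -
    consider "i = 0" | "i = 1" | "i = 2" using \<open>i < 3\<close> by linarith
    thus ?thesis
    proof cases
      case 1 thus ?thesis using R unfolding R_eq Q_def
        by (cases r1) (auto simp: path_edges_append path_edges_Cons insert_commute last_rev hd_rev split: if_splits)
    next
      case 2 thus ?thesis using R unfolding R_eq Q_def
        by (auto simp: path_edges_append path_edges_Cons split: if_splits)
    next
      case 3 thus ?thesis using T unfolding T_eq(1) Q_def
        by (cases ys) (auto simp: path_edges_append path_edges_Cons insert_commute last_rev hd_rev split: if_splits)
    qed
  qed
  moreover have "set (Q i) \<inter> set (Q j) \<subseteq> {w}" if "i < 3" "j < 3" "i \<noteq> j" for i j
    using R(4) T_eq(3) that unfolding Q_def R_eq by auto
  ultimately show ?thesis unfolding spider_def by blast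
qed

text \<open>The branch sets are \<open>X 0, X 1, X 2\<close> and \<open>Y 0, Y 1, Y 2\<close>.\<close>

definition K33_minor :: "'a set set \<Rightarrow> bool" where
  "K33_minor E \<longleftrightarrow> (\<exists>X Y :: nat \<Rightarrow> 'a set.
     (\<forall>i<3. connected_in E (X i) \<and> connected_in E (Y i)) \<and>
     (\<forall>i<3. \<forall>j<3. X i \<inter> Y j = {} \<and> (i \<noteq> j \<longrightarrow> X i \<inter> X j = {} \<and> Y i \<inter> Y j = {}) \<and>
        (\<exists>s\<in>X i. \<exists>t\<in>Y j. {s, t} \<in> E)))"

locale drawing =
  fixes V :: "'a set" and E and p :: "'a \<Rightarrow> complex" and c :: "'a set \<Rightarrow> real \<Rightarrow> complex"
  assumes simple: "simple_graph V E"
    and inj: "inj_on p V"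
    and arcE: "\<And>e. e \<in> E \<Longrightarrow> arc (c e)"
    and endsE: "\<And>e. e \<in> E \<Longrightarrow> {pathstart (c e), pathfinish (c e)} = p ` e"
    and interE: "\<And>e e'. e \<in> E \<Longrightarrow> e' \<in> E \<Longrightarrow> e \<noteq> e' \<Longrightarrow> path_image (c e) \<inter> path_image (c e') \<subseteq> p ` (e \<inter> e')"
begin

definition img :: "'a set set \<Rightarrow> complex set" where "img F = (\<Union>e\<in>F. path_image (c e))"

lemma edge_subset: "e \<in> E \<Longrightarrow> e \<subseteq> V"
  using simple unfolding simple_graph_def by (auto dest!: bspec)

lemma img_Int: "F \<subseteq> E \<Longrightarrow> F' \<subseteq> E \<Longrightarrow> F \<inter> F' = {} \<Longrightarrow> img F \<inter> img F' \<subseteq> p ` (\<Union>F \<inter> \<Union>F')"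
  unfolding img_def using interE by (fastforce simp: subset_iff image_iff disjoint_iff)

lemma p_image: "e \<in> E \<Longrightarrow> p ` e \<subseteq> path_image (c e)"
  by (subst endsE[symmetric]) auto

lemma edge_arc:
  assumes "{x, y} \<in> E"
  obtains g where "arc g" "pathstart g = p x" "pathfinish g = p y" "path_image g = path_image (c {x, y})"
proof (cases "pathstart (c {x,y}) = p x")
  case True
  hence "pathfinish (c {x,y}) = p y" using endsE[OF assms] arc_distinct_ends[OF arcE[OF assms]]
    by (auto simp: doubleton_eq_iff)
  thus ?thesis using that[of "c {x,y}"] True arcE[OF assms] by auto
next
  case False
  hence "pathstart (c {x,y}) = p y" "pathfinish (c {x,y}) = p x" using endsE[OF assms]
    by (auto simp: doubleton_eq_iff)
  thus ?thesis using that[of "reversepath (c {x,y})"] arcE[OF assms] by (auto simp: arc_reversepath)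
qed

lemma path_arc:
  assumes "distinct vs" "length vs \<ge> 2" "path_edges vs \<subseteq> E"
  shows "\<exists>g. arc g \<and> pathstart g = p (hd vs) \<and> pathfinish g = p (last vs) \<and> path_image g = img (path_edges vs)"
  using assms
proof (induction vs rule: path_edges.induct)
  case (1 x y zs)
  obtain g where g: "arc g" "pathstart g = p x" "pathfinish g = p y" "path_image g = path_image (c {x, y})"
    using edge_arc[of x y] 1 by auto
  show ?case
  proof (cases zs)
    case Nil
    thus ?thesis using g by (intro exI[of _ g]) (auto simp: img_def)
  next
    case (Cons z zs')
    then obtain h where h: "arc h" "pathstart h = p y" "pathfinish h = p (last (y # zs))" "path_image h = img (path_edges (y # zs))"
      using 1 by auto
    have "{x,y} \<notin> path_edges (y # zs)" using 1 Union_path_edges[of "y # zs"] by auto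
    hence "path_image g \<inter> path_image h \<subseteq> p ` (\<Union>{{x,y}} \<inter> \<Union>(path_edges (y # zs)))"
      using img_Int[of "{{x,y}}" "path_edges (y # zs)"] 1 g h by (auto simp: img_def)
    also have "\<dots> \<subseteq> {p y}" using 1 Union_path_edges[of "y # zs"] by auto
    finally have "arc (g +++ h)" using g h by (intro arc_join) auto
    moreover have "path_image (g +++ h) = img (path_edges (x # y # zs))"
      using g h by (simp add: path_image_join img_def)
    ultimately show ?thesis using g h by (intro exI[of _ "g +++ h"]) auto
  qed
qed auto

lemma no_topological_K33:
  fixes P :: "nat \<Rightarrow> nat \<Rightarrow> 'a list"
  assumes P: "\<And>i j. i < 3 \<Longrightarrow> j < 3 \<Longrightarrow> distinct (P i j) \<and> length (P i j) \<ge> 2 \<and> path_edges (P i j) \<subseteq> E \<and> hd (P i j) = a i \<and> last (P i j) = b j"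
    and int: "\<And>i j i' j'. i < 3 \<Longrightarrow> j < 3 \<Longrightarrow> i' < 3 \<Longrightarrow> j' < 3 \<Longrightarrow> i \<noteq> i' \<or> j \<noteq> j' \<Longrightarrow>
       set (P i j) \<inter> set (P i' j') \<subseteq> (if i = i' then {a i} else {}) \<union> (if j = j' then {b j} else {})"
  shows False
proof -
  have "\<forall>i\<in>{..<3}. \<forall>j\<in>{..<3}. \<exists>g. arc g \<and> pathstart g = p (a i) \<and> pathfinish g = p (b j) \<and> path_image g = img (path_edges (P i j))"
  proof (intro ballI)
    fix i j :: nat assume ij: "i \<in> {..<3}" "j \<in> {..<3}"
    thus "\<exists>g. arc g \<and> pathstart g = p (a i) \<and> pathfinish g = p (b j) \<and> path_image g = img (path_edges (P i j))"
      using path_arc[of "P i j"] P[of i j] by auto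
  qed
  then obtain \<gamma> where \<gamma>: "\<And>i j. i < 3 \<Longrightarrow> j < 3 \<Longrightarrow> arc (\<gamma> i j) \<and> pathstart (\<gamma> i j) = p (a i) \<and> pathfinish (\<gamma> i j) = p (b j) \<and> path_image (\<gamma> i j) = img (path_edges (P i j))"
    by (simp only: bchoice_iff Ball_def lessThan_iff) metis
  show False
  proof (rule K33_arcs[of \<gamma> "\<lambda>i. p (a i)" "\<lambda>j. p (b j)"])
    fix i j i' j' :: nat assume ij: "i < 3" "j < 3" "i' < 3" "j' < 3" "i \<noteq> i' \<or> j \<noteq> j'"
    note I = int[OF ij]
    have E: "path_edges (P i j) \<subseteq> E" "path_edges (P i' j') \<subseteq> E" using P ij by auto
    have sub: "\<Union>(path_edges (P i j)) \<inter> \<Union>(path_edges (P i' j')) \<subseteq> (if i = i' then {a i} else {}) \<union> (if j = j' then {b j} else {})"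
      using I Union_path_edges[of "P i j"] Union_path_edges[of "P i' j'"] by blast
    have "path_edges (P i j) \<inter> path_edges (P i' j') = {}"
    proof (rule ccontr)
      assume "\<not> ?thesis"
      then obtain e where e: "e \<in> path_edges (P i j)" "e \<in> path_edges (P i' j')" by auto
      obtain x y where xy: "e = {x, y}" "x \<noteq> y" using e E simple unfolding simple_graph_def by blast
      have "e \<subseteq> (if i = i' then {a i} else {}) \<union> (if j = j' then {b j} else {})" using e sub by blast
      thus False using xy ij(5) by (auto split: if_splits)
    qed
    hence "path_image (\<gamma> i j) \<inter> path_image (\<gamma> i' j') \<subseteq> p ` (\<Union>(path_edges (P i j)) \<inter> \<Union>(path_edges (P i' j')))"
      using img_Int E \<gamma> ij by metis
    also have "\<dots> \<subseteq> (if i = i' then {p (a i)} else {}) \<union> (if j = j' then {p (b j)} else {})"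
      using sub by (auto split: if_splits)
    finally show "path_image (\<gamma> i j) \<inter> path_image (\<gamma> i' j') \<subseteq> (if i = i' then {p (a i)} else {}) \<union> (if j = j' then {p (b j)} else {})" .
  qed (use \<gamma> in auto)
qed

text \<open>Since K(3,3) has degree 3, the minor yields a subdivision: each branch set contains a
  tripod to the end points of its three edges, and the centre of the tripod becomes a branch
  vertex.\<close>

lemma no_K33_minor: "\<not> K33_minor E"
proof
  assume "K33_minor E"
  then obtain X Y :: "nat \<Rightarrow> 'a set" where
    XY: "\<forall>i<3. connected_in E (X i) \<and> connected_in E (Y i)"
     "\<forall>i<3. \<forall>j<3. X i \<inter> Y j = {} \<and> (i \<noteq> j \<longrightarrow> X i \<inter> X j = {} \<and> Y i \<inter> Y j = {}) \<and>
        (\<exists>s\<in>X i. \<exists>t\<in>Y j. {s, t} \<in> E)"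
    unfolding K33_minor_def by blast
  have con: "\<And>i. i < 3 \<Longrightarrow> connected_in E (X i)" "\<And>i. i < 3 \<Longrightarrow> connected_in E (Y i)"
    and dis: "\<And>i j. i < 3 \<Longrightarrow> j < 3 \<Longrightarrow> X i \<inter> Y j = {}" "\<And>i j. i < 3 \<Longrightarrow> j < 3 \<Longrightarrow> i \<noteq> j \<Longrightarrow> X i \<inter> X j = {}"
       "\<And>i j. i < 3 \<Longrightarrow> j < 3 \<Longrightarrow> i \<noteq> j \<Longrightarrow> Y i \<inter> Y j = {}"
    and ed: "\<And>i j. i < 3 \<Longrightarrow> j < 3 \<Longrightarrow> \<exists>s\<in>X i. \<exists>t\<in>Y j. {s, t} \<in> E"
    using XY by blast+
  obtain s t where st: "\<And>i j. i < 3 \<Longrightarrow> j < 3 \<Longrightarrow> s i j \<in> X i \<and> t i j \<in> Y j \<and> {s i j, t i j} \<in> E"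
    using ed by (metis (no_types))
  have "\<exists>w Q. spider E (X i) (s i) w Q" if "i < 3" for i
    by (rule connected_in_spider[OF con(1)[OF that]]) (use st that in blast)
  then obtain w Q where Q0: "\<And>i. i < 3 \<Longrightarrow> spider E (X i) (s i) (w i) (Q i)" by metis
  have Q: "Q i j \<noteq> [] \<and> hd (Q i j) = w i \<and> last (Q i j) = s i j \<and> distinct (Q i j) \<and> set (Q i j) \<subseteq> X i \<and> path_edges (Q i j) \<subseteq> E" if "i < 3" "j < 3" for i j
    using Q0[OF that(1)] that(2) unfolding spider_def by simp
  have Qi: "set (Q i j) \<inter> set (Q i j') \<subseteq> {w i}" if "i < 3" "j < 3" "j' < 3" "j \<noteq> j'" for i j j'
    using Q0[OF that(1)] that(2-) unfolding spider_def by simp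
  have "\<exists>w Q. spider E (Y j) (\<lambda>i. t i j) w Q" if "j < 3" for j
    by (rule connected_in_spider[OF con(2)[OF that]]) (use st that in blast)
  then obtain w' Q' where Q0': "\<And>j. j < 3 \<Longrightarrow> spider E (Y j) (\<lambda>i. t i j) (w' j) (Q' j)" by metis
  have Q': "Q' j i \<noteq> [] \<and> hd (Q' j i) = w' j \<and> last (Q' j i) = t i j \<and> distinct (Q' j i) \<and> set (Q' j i) \<subseteq> Y j \<and> path_edges (Q' j i) \<subseteq> E" if "i < 3" "j < 3" for i j
    using Q0'[OF that(2)] that(1) unfolding spider_def by simp
  have Qi': "set (Q' j i) \<inter> set (Q' j i') \<subseteq> {w' j}" if "i < 3" "i' < 3" "j < 3" "i \<noteq> i'" for i i' j
    using Q0'[OF that(3)] that(1,2,4) unfolding spider_def by simp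
  show False
  proof (rule no_topological_K33[of "\<lambda>i j. Q i j @ rev (Q' j i)" w w'])
    fix i j :: nat assume ij: "i < 3" "j < 3"
    have "Q i j \<noteq> []" "Q' j i \<noteq> []" using Q[OF ij] Q'[OF ij] by blast+
    hence l: "length (Q i j) \<ge> 1" "length (Q' j i) \<ge> 1" by (simp_all add: Suc_le_eq)
    have "set (Q i j) \<inter> set (Q' j i) = {}" using Q[OF ij] Q'[OF ij] dis(1)[OF ij] by blast
    thus "distinct (Q i j @ rev (Q' j i)) \<and> 2 \<le> length (Q i j @ rev (Q' j i)) \<and>
        path_edges (Q i j @ rev (Q' j i)) \<subseteq> E \<and> hd (Q i j @ rev (Q' j i)) = w i \<and> last (Q i j @ rev (Q' j i)) = w' j"
      using Q[OF ij] Q'[OF ij] st[OF ij] l by (auto simp: path_edges_append hd_rev last_rev)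
  next
    fix i j i' j' :: nat assume ij: "i < 3" "j < 3" "i' < 3" "j' < 3" "i \<noteq> i' \<or> j \<noteq> j'"
    have 1: "set (Q i j) \<subseteq> X i" "set (Q i' j') \<subseteq> X i'" "set (Q' j i) \<subseteq> Y j" "set (Q' j' i') \<subseteq> Y j'"
      using Q Q' ij by auto
    have 2: "X i \<inter> Y j' = {}" "X i' \<inter> Y j = {}" using dis ij by auto
    have 3: "set (Q i j) \<inter> set (Q i' j') \<subseteq> (if i = i' then {w i} else {})"
      using 1 dis(2)[of i i'] Qi[of i j j'] ij by auto
    have 4: "set (Q' j i) \<inter> set (Q' j' i') \<subseteq> (if j = j' then {w' j} else {})"
    proof (cases "j = j'")
      case True
      thus ?thesis using Qi'[of i i' j] ij by simp
    next
      case False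
      thus ?thesis using dis(3)[of j j'] 1 ij by auto
    qed
    have "set (Q i j @ rev (Q' j i)) \<inter> set (Q i' j' @ rev (Q' j' i')) \<subseteq>
       (set (Q i j) \<inter> set (Q i' j')) \<union> (set (Q' j i) \<inter> set (Q' j' i'))"
      using 1 2 by auto
    also have "\<dots> \<subseteq> (if i = i' then {w i} else {}) \<union> (if j = j' then {w' j} else {})" using 3 4 by blast
    finally show "set (Q i j @ rev (Q' j i)) \<inter> set (Q i' j' @ rev (Q' j' i')) \<subseteq> (if i = i' then {w i} else {}) \<union> (if j = j' then {w' j} else {})" .
  qed
qed

text \<open>The branch vertices are \<open>u\<close>, \<open>v\<close>, \<open>x\<close>,
  \<open>y\<close>, \<open>z\<close>, with \<open>w\<close> subdividing uv. With respect to the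
  cycle through \<open>u\<close>, \<open>x\<close>, \<open>v\<close>, \<open>y\<close>, the edge xy
  lies opposite to both \<open>w\<close> and \<open>z\<close>, so these two are on the same side.
  The path x, z, y also connects the two arcs, hence it lies opposite to \<open>w\<close> although
  it contains \<open>z\<close>.\<close>

lemma no_K5_subdivision:
  assumes dist: "distinct [u, v, w, x, y, z]"
    and E: "\<And>r. r \<in> {w, x, y, z} \<Longrightarrow> {u, r} \<in> E \<and> {r, v} \<in> E" "{x, y} \<in> E" "{z, x} \<in> E" "{z, y} \<in> E"
  shows False
proof -
  have "\<exists>g. arc g \<and> pathstart g = p u \<and> pathfinish g = p v \<and> path_image g = img {{u, r}, {r, v}}" if "r \<in> {w,x,y,z}" for r
    using path_arc[of "[u, r, v]"] E(1)[OF that] dist that by auto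
  then obtain g where g: "\<And>r. r \<in> {w,x,y,z} \<Longrightarrow> arc (g r) \<and> pathstart (g r) = p u \<and> pathfinish (g r) = p v \<and> path_image (g r) = img {{u, r}, {r, v}}"
    by metis
  have ga: "arc (g r)" "pathstart (g r) = p u" "pathfinish (g r) = p v" if "r \<in> {w,x,y,z}" for r
    using g[OF that] by auto
  have inV: "u \<in> V" "v \<in> V" "w \<in> V" "x \<in> V" "y \<in> V" "z \<in> V" using E(1) edge_subset by blast+
  have pin: "p r \<in> path_image (g r)" if "r \<in> {w,x,y,z}" for r
    using g[OF that] p_image E(1)[OF that] unfolding img_def by blast
  have gint: "path_image (g r) \<inter> path_image (g q) = {p u, p v}" if rq: "r \<in> {w,x,y,z}" "q \<in> {w,x,y,z}" "r \<noteq> q" for r q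
  proof
    have ne: "u \<noteq> r" "u \<noteq> q" "v \<noteq> r" "v \<noteq> q" "u \<noteq> v" using dist rq by auto
    have "{{u, r}, {r, v}} \<inter> {{u, q}, {q, v}} = {}" using rq(3) ne by (auto simp: doubleton_eq_iff)
    hence "path_image (g r) \<inter> path_image (g q) \<subseteq> p ` (\<Union>{{u, r}, {r, v}} \<inter> \<Union>{{u, q}, {q, v}})"
      using img_Int[of "{{u, r}, {r, v}}" "{{u, q}, {q, v}}"] g rq E(1) by simp
    also have "\<dots> \<subseteq> {p u, p v}" using ne rq by auto
    finally show "path_image (g r) \<inter> path_image (g q) \<subseteq> {p u, p v}" .
    show "{p u, p v} \<subseteq> path_image (g r) \<inter> path_image (g q)"
      using g[OF rq(1)] g[OF rq(2)] by (metis Int_iff empty_subsetI insert_subset pathfinish_in_path_image pathstart_in_path_image)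
  qed
  have chord: "path_image (c {s, t}) \<inter> path_image (g r) \<subseteq> p ` ({s,t} \<inter> {r})" if "{s,t} \<in> E" "s \<in> {w,x,y,z}" "t \<in> {w,x,y,z}" "r \<in> {w,x,y,z}" for s t r
  proof -
    have "{{s,t}} \<inter> {{u, r}, {r, v}} = {}" using dist that by (auto simp: doubleton_eq_iff)
    hence "path_image (c {s, t}) \<inter> path_image (g r) \<subseteq> p ` (\<Union>{{s,t}} \<inter> \<Union>{{u, r}, {r, v}})"
      using img_Int[of "{{s,t}}" "{{u, r}, {r, v}}"] that g[OF that(4)] E(1)[OF that(4)] by (simp add: img_def)
    also have "\<dots> \<subseteq> p ` ({s,t} \<inter> {r})" using dist that by auto
    finally show ?thesis .
  qed
  have neq: "p r \<noteq> p q" if "r \<in> {u,v,w,x,y,z}" "q \<in> {u,v,w,x,y,z}" "r \<noteq> q" for r q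
    using inj inV that unfolding inj_on_def by blast
  have xy: "p x \<notin> {p u, p v}" "p y \<notin> {p u, p v}" "p z \<notin> {p u, p v}" using neq dist by auto
  have d: "x \<noteq> y" "x \<noteq> w" "y \<noteq> w" "x \<noteq> z" "y \<noteq> z" using dist by auto
  interpret tw: theta "g x" "g y" "g w" "p u" "p v"
    by unfold_locales (simp_all add: ga gint[OF _ _ d(1)] gint[OF _ _ d(2)] gint[OF _ _ d(3)] gint[OF _ _ d(4)] gint[OF _ _ d(5)])
  interpret tz: theta "g x" "g y" "g z" "p u" "p v"
    by unfold_locales (simp_all add: ga gint[OF _ _ d(1)] gint[OF _ _ d(2)] gint[OF _ _ d(3)] gint[OF _ _ d(4)] gint[OF _ _ d(5)])
  let ?J = "path_image (g x) \<union> path_image (g y)"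
  obtain h where h: "arc h" "pathstart h = p x" "pathfinish h = p y" "path_image h = path_image (c {x, y})"
    using edge_arc[OF E(2)] by metis
  define S where "S = path_image h - {p x, p y}"
  have S: "connected S" "p x \<in> closure S" "p y \<in> closure S" "S \<noteq> {}"
    unfolding S_def using arc_minus_ends[OF h(1-3)] closure_arc_minus_ends[OF h(1-3)] by auto
  have Sd: "S \<inter> path_image (g r) = {}" if "r \<in> {w,x,y,z}" for r
    using chord[OF E(2) _ _ that] unfolding S_def h by auto
  have 1: "(S \<subseteq> inside ?J \<and> path_image (g w) - {p u, p v} \<subseteq> outside ?J) \<or> (S \<subseteq> outside ?J \<and> path_image (g w) - {p u, p v} \<subseteq> inside ?J)"
    by (rule tw.opposite_sides[OF S(1), of "p x" "p y"]) (use S Sd pin xy in auto)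
  have 2: "(S \<subseteq> inside ?J \<and> path_image (g z) - {p u, p v} \<subseteq> outside ?J) \<or> (S \<subseteq> outside ?J \<and> path_image (g z) - {p u, p v} \<subseteq> inside ?J)"
    by (rule tz.opposite_sides[OF S(1), of "p x" "p y"]) (use S Sd pin xy in auto)
  obtain h1 where h1: "arc h1" "pathstart h1 = p z" "pathfinish h1 = p x" "path_image h1 = path_image (c {z, x})"
    using edge_arc[OF E(3)] by metis
  obtain h2 where h2: "arc h2" "pathstart h2 = p z" "pathfinish h2 = p y" "path_image h2 = path_image (c {z, y})"
    using edge_arc[OF E(4)] by metis
  define T where "T = (path_image h1 - {p x}) \<union> (path_image h2 - {p y})"
  note m1 = arc_minus_finish[OF h1(1), unfolded h1(2,3)] and m2 = arc_minus_finish[OF h2(1), unfolded h2(2,3)]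
  have T: "connected T" unfolding T_def using m1 m2 by (intro connected_Un) auto
  have zT: "p z \<in> T" unfolding T_def using m1 by auto
  have clT: "p x \<in> closure T" "p y \<in> closure T" unfolding T_def closure_Un using m1 m2 by auto
  have Td: "T \<inter> path_image (g r) = {}" if "r \<in> {w,x,y}" for r
    using chord[OF E(3), of r] chord[OF E(4), of r] that dist unfolding T_def h1 h2 by auto
  have 3: "(T \<subseteq> inside ?J \<and> path_image (g w) - {p u, p v} \<subseteq> outside ?J) \<or> (T \<subseteq> outside ?J \<and> path_image (g w) - {p u, p v} \<subseteq> inside ?J)"
    by (rule tw.opposite_sides[OF T(1), of "p x" "p y"]) (use T Td clT pin xy in auto)
  have "p w \<in> path_image (g w) - {p u, p v}" "p z \<in> path_image (g z) - {p u, p v}"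
    using pin neq dist by auto
  moreover have "inside ?J \<inter> outside ?J = {}" by (simp add: inside_Int_outside)
  ultimately show False using 1 2 3 zT S(4) by blast
qed

end

lemma planar_imp_drawing:
  assumes "simple_graph V E" "planar V E"
  obtains p c where "drawing V E p c"
proof -
  from assms(2) obtain p :: "'a \<Rightarrow> complex" and c where pc: "inj_on p V"
    "\<forall>e\<in>E. arc (c e) \<and> {pathstart (c e), pathfinish (c e)} = p ` e \<and> path_image (c e) \<inter> p ` V = p ` e"
    "\<forall>e\<in>E. \<forall>e'\<in>E. e \<noteq> e' \<longrightarrow> path_image (c e) \<inter> path_image (c e') \<subseteq> p ` (e \<inter> e')"
    unfolding planar_def by (elim exE conjE)
  have "drawing V E p c" by unfold_locales (use pc assms(1) in simp_all)
  thus thesis by (rule that)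
qed

section \<open>Sparsity without a K33 minor\<close>

definition nb :: "'a set set \<Rightarrow> 'a \<Rightarrow> 'a set" where
  "nb E v = {w. {v, w} \<in> E}"

lemma mem_nb [simp]: "w \<in> nb E v \<longleftrightarrow> {v, w} \<in> E" by (simp add: nb_def)

lemma simple_graph_finite_edges: "simple_graph V E \<Longrightarrow> finite E"
  unfolding simple_graph_def by (rule finite_subset[of _ "Pow V"]) auto

lemma simple_graph_edge: "simple_graph V E \<Longrightarrow> {x, y} \<in> E \<Longrightarrow> x \<in> V \<and> y \<in> V \<and> x \<noteq> y"
  unfolding simple_graph_def by (metis doubleton_eq_iff)

lemma nb_subset: "simple_graph V E \<Longrightarrow> nb E v \<subseteq> V - {v}"
  using simple_graph_edge[of V E v] simple_graph_edge[of V E v v] by auto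

lemma finite_nb: "simple_graph V E \<Longrightarrow> finite (nb E v)"
  by (rule finite_subset[OF nb_subset]) (auto simp: simple_graph_def)

lemma simple_graph_subset: "simple_graph V E \<Longrightarrow> F \<subseteq> E \<Longrightarrow> \<Union>F \<subseteq> W \<Longrightarrow> finite W \<Longrightarrow> simple_graph W F"
  unfolding simple_graph_def by (metis (no_types, lifting) Union_upper insert_subset subset_iff)

lemma card_nb: "simple_graph V E \<Longrightarrow> card (nb E v) = card {e \<in> E. v \<in> e}"
proof -
  assume s: "simple_graph V E"
  have "bij_betw (\<lambda>w. {v, w}) (nb E v) {e \<in> E. v \<in> e}"
  proof (rule bij_betwI')
    fix e assume e: "e \<in> {e \<in> E. v \<in> e}"
    then obtain a b where "e = {a, b}" using s unfolding simple_graph_def by blast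
    thus "\<exists>w\<in>nb E v. e = {v, w}" using e by (auto simp: insert_commute)
  qed (auto simp: doubleton_eq_iff)
  thus ?thesis by (rule bij_betw_same_card)
qed

lemma handshake:
  assumes "simple_graph V E"
  shows "(\<Sum>v\<in>V. card (nb E v)) = 2 * card E"
proof -
  have fin: "finite V" "finite E" using assms simple_graph_finite_edges by (auto simp: simple_graph_def)
  have "(\<Sum>v\<in>V. card (nb E v)) = (\<Sum>v\<in>V. card {e \<in> E. v \<in> e})" using card_nb[OF assms] by simp
  also have "\<dots> = (\<Sum>e\<in>E. 2)"
  proof (rule sum_multicount_gen[OF fin])
    show "\<forall>e\<in>E. card {v \<in> V. v \<in> e} = 2"
    proof
      fix e assume "e \<in> E"
      then obtain u v where e: "e = {u, v}" "u \<in> V" "v \<in> V" "u \<noteq> v" using assms unfolding simple_graph_def by blast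
      have "{v \<in> V. v \<in> e} = {u, v}" using e by auto
      thus "card {v \<in> V. v \<in> e} = 2" using e by simp
    qed
  qed
  finally show ?thesis by simp
qed

lemma connected_in_mono: "connected_in E B \<Longrightarrow> E \<subseteq> E' \<Longrightarrow> connected_in E' B"
  using rtrancl_mono[of "{(x, y). x \<in> B \<and> y \<in> B \<and> {x, y} \<in> E}" "{(x, y). x \<in> B \<and> y \<in> B \<and> {x, y} \<in> E'}"]
  unfolding connected_in_def by blast

lemma K33_minor_mono: "K33_minor E \<Longrightarrow> E \<subseteq> E' \<Longrightarrow> K33_minor E'"
  unfolding K33_minor_def by (elim ex_forward) (use connected_in_mono in blast)

lemma K33_minorI_list:
  assumes "distinct [a0, a1, a2, b0, b1, b2]"
    "\<And>a b. a \<in> {a0, a1, a2} \<Longrightarrow> b \<in> {b0, b1, b2} \<Longrightarrow> {a, b} \<in> E"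
  shows "K33_minor E"
proof -
  define a where "a i = (if i = 0 then a0 else if i = 1 then a1 else a2)" for i :: nat
  define b where "b i = (if i = 0 then b0 else if i = 1 then b1 else b2)" for i :: nat
  have "a i \<noteq> b j" "{a i, b j} \<in> E" if "i < 3" "j < 3" for i j
    using assms(1) assms(2)[of "a i" "b j"] by (auto simp: a_def b_def)
  moreover have "a i \<noteq> a j" "b i \<noteq> b j" if "i < 3" "j < 3" "i \<noteq> j" for i j
    using assms(1) that by (auto simp: a_def b_def)
  ultimately show ?thesis unfolding K33_minor_def
    by (intro exI[of _ "\<lambda>i. {a i}"] exI[of _ "\<lambda>i. {b i}"]) auto
qed

lemma no_K33_card_common_nb:
  assumes s: "simple_graph V E" and nm: "\<not> K33_minor E" and d: "a \<noteq> b" "a \<noteq> c" "b \<noteq> c"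
  shows "card (nb E a \<inter> nb E b \<inter> nb E c) \<le> 2"
proof (rule ccontr)
  assume "\<not> ?thesis"
  hence "3 \<le> card (nb E a \<inter> nb E b \<inter> nb E c)" by simp
  then obtain T where T: "T \<subseteq> nb E a \<inter> nb E b \<inter> nb E c" "card T = 3"
    using obtain_subset_with_card_n by metis
  then obtain x y z where xyz: "T = {x, y, z}" "x \<noteq> y" "x \<noteq> z" "y \<noteq> z" by (auto simp: card_3_iff)
  have "K33_minor E"
  proof (rule K33_minorI_list[of a b c x y z])
    show "distinct [a, b, c, x, y, z]"
      using d xyz T simple_graph_edge[OF s] by fastforce
  qed (use T xyz in auto)
  thus False using nm by simp
qed

text \<open>The merged vertex keeps the name \<open>x\<close>. Parallel edges merge because edges
  are sets, and excluding z = x avoids a loop.\<close>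

definition contract :: "'a set set \<Rightarrow> 'a \<Rightarrow> 'a \<Rightarrow> 'a set set" where
  "contract E x y = {e \<in> E. y \<notin> e} \<union> {{x, z} | z. {y, z} \<in> E \<and> z \<noteq> x}"

lemma simple_graph_contract:
  assumes "simple_graph V E" "{x, y} \<in> E"
  shows "simple_graph (V - {y}) (contract E x y)"
  unfolding simple_graph_def
proof (intro conjI ballI)
  show "finite (V - {y})" using assms(1) by (simp add: simple_graph_def)
  fix e assume "e \<in> contract E x y"
  then consider "e \<in> E" "y \<notin> e" | z where "e = {x, z}" "{y, z} \<in> E" "z \<noteq> x" unfolding contract_def by blast
  thus "\<exists>u v. e = {u, v} \<and> u \<in> V - {y} \<and> v \<in> V - {y} \<and> u \<noteq> v"
  proof cases
    case 1
    then obtain u v where "e = {u, v}" "u \<in> V" "v \<in> V" "u \<noteq> v" using assms(1) unfolding simple_graph_def by blast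
    thus ?thesis using 1 by blast
  next
    case 2
    thus ?thesis using simple_graph_edge[OF assms] simple_graph_edge[OF assms(1) 2(2)] by blast
  qed
qed

text \<open>The edges lost are xy and, for each common neighbour, one of two edges that become
  parallel.\<close>

lemma card_contract:
  assumes s: "simple_graph V E" and xy: "{x, y} \<in> E"
  shows "card E \<le> card (contract E x y) + 1 + card (nb E x \<inter> nb E y)"
proof -
  have fin: "finite E" by (rule simple_graph_finite_edges[OF s])
  have finn: "finite (nb E y)" by (rule finite_nb[OF s])
  have neq: "x \<noteq> y" using simple_graph_edge[OF s xy] by simp
  define R where "R = nb E y - nb E x - {x}"
  have "E = {e \<in> E. y \<notin> e} \<union> {e \<in> E. y \<in> e}" by auto
  hence "card E = card ({e \<in> E. y \<notin> e} \<union> {e \<in> E. y \<in> e})" by simp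
  also have "\<dots> = card {e \<in> E. y \<notin> e} + card {e \<in> E. y \<in> e}"
    using fin by (intro card_Un_disjoint) auto
  also have "card {e \<in> E. y \<in> e} = card (nb E y)" by (rule card_nb[OF s, symmetric])
  also have "card (nb E y) = card (R \<union> {x} \<union> (nb E x \<inter> nb E y))"
    using xy by (intro arg_cong[of _ _ card]) (auto simp: R_def insert_commute)
  also have "\<dots> \<le> card R + 1 + card (nb E x \<inter> nb E y)"
    using card_Un_le[of "R \<union> {x}" "nb E x \<inter> nb E y"] card_Un_le[of R "{x}"] by simp
  finally have 1: "card E \<le> card {e \<in> E. y \<notin> e} + (card R + 1 + card (nb E x \<inter> nb E y))" by simp
  have "card {e \<in> E. y \<notin> e} + card R = card {e \<in> E. y \<notin> e} + card ((\<lambda>z. {x, z}) ` R)"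
    by (subst card_image) (auto simp: inj_on_def doubleton_eq_iff)
  also have "\<dots> = card ({e \<in> E. y \<notin> e} \<union> (\<lambda>z. {x, z}) ` R)"
    using fin finn by (intro card_Un_disjoint[symmetric]) (auto simp: R_def)
  also have "\<dots> \<le> card (contract E x y)"
  proof (rule card_mono)
    show "finite (contract E x y)"
      by (rule simple_graph_finite_edges[OF simple_graph_contract[OF s xy]])
    show "{e \<in> E. y \<notin> e} \<union> (\<lambda>z. {x, z}) ` R \<subseteq> contract E x y" by (auto simp: contract_def R_def)
  qed
  finally show ?thesis using 1 by simp
qed

lemma K33_minor_contract:
  assumes s: "simple_graph V E" and xy: "{x, y} \<in> E" and m: "K33_minor (contract E x y)"
  shows "K33_minor E"
proof -
  let ?C = "contract E x y"
  have neq: "x \<noteq> y" using simple_graph_edge[OF s xy] by simp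
  \<comment> \<open>Undoes the contraction on a branch set: \<open>y\<close> follows
    \<open>x\<close>. An old \<open>y\<close>, isolated after the contraction, is removed first,
    since branch sets are not confined to a vertex set.\<close>
  define f where "f B = (B - {y}) \<union> (if x \<in> B then {y} else {})" for B
  have Cy: "a \<noteq> y \<and> b \<noteq> y" if "{a, b} \<in> ?C" for a b
    using that neq simple_graph_edge[OF s] unfolding contract_def by (fastforce simp: doubleton_eq_iff)
  have step: "\<exists>a'\<in>(if a = x then {x, y} else {a}). \<exists>b'\<in>(if b = x then {x, y} else {b}). {a', b'} \<in> E" if "{a, b} \<in> ?C" for a b
    using that unfolding contract_def by (auto simp: doubleton_eq_iff insert_commute)
  have con: "connected_in E (f B)" if B: "connected_in ?C B" for B
  proof -
    let ?r = "{(a, b). a \<in> f B \<and> b \<in> f B \<and> {a, b} \<in> E}"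
    have syx: "(x, y) \<in> ?r" "(y, x) \<in> ?r" if "x \<in> B" using that xy neq by (auto simp: f_def insert_commute)
    have 1: "{(a, b). a \<in> B \<and> b \<in> B \<and> {a, b} \<in> ?C} \<subseteq> ?r\<^sup>*"
    proof safe
      fix a b assume ab: "a \<in> B" "b \<in> B" "{a, b} \<in> ?C"
      obtain a' b' where a': "a' \<in> (if a = x then {x, y} else {a})" and b': "b' \<in> (if b = x then {x, y} else {b})" and e: "{a', b'} \<in> E"
        using step[OF ab(3)] by blast
      have "a' \<in> f B" "b' \<in> f B" using a' b' ab Cy[OF ab(3)] neq by (auto simp: f_def split: if_splits)
      hence "(a', b') \<in> ?r" using e by auto
      moreover have "(a, a') \<in> ?r\<^sup>*" using a' syx ab by (auto split: if_splits)
      moreover have "(b', b) \<in> ?r\<^sup>*" using b' syx ab by (auto split: if_splits)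
      ultimately show "(a, b) \<in> ?r\<^sup>*" by (meson rtrancl.rtrancl_into_rtrancl rtrancl_trans)
    qed
    have 2: "(a, b) \<in> ?r\<^sup>*" if "a \<in> B" "b \<in> B" for a b
      using B that rtrancl_subset_rtrancl[OF 1] unfolding connected_in_def by blast
    define g where "g a = (if a = y then x else a)" for a
    have 3: "(a, g a) \<in> ?r\<^sup>*" "(g a, a) \<in> ?r\<^sup>*" "g a \<in> B" if "a \<in> f B" for a
      using that syx by (auto simp: f_def g_def split: if_splits)
    show ?thesis unfolding connected_in_def using 2 3 by (meson rtrancl_trans)
  qed
  from m obtain X Y :: "nat \<Rightarrow> 'a set" where
    XY: "\<forall>i<3. connected_in ?C (X i) \<and> connected_in ?C (Y i)"
     "\<forall>i<3. \<forall>j<3. X i \<inter> Y j = {} \<and> (i \<noteq> j \<longrightarrow> X i \<inter> X j = {} \<and> Y i \<inter> Y j = {}) \<and>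
        (\<exists>s\<in>X i. \<exists>t\<in>Y j. {s, t} \<in> ?C)"
    unfolding K33_minor_def by blast
  have dis: "f B \<inter> f B' = {}" if "B \<inter> B' = {}" for B B' using that by (auto simp: f_def)
  have ed: "\<exists>s\<in>f B. \<exists>t\<in>f B'. {s, t} \<in> E" if "\<exists>s\<in>B. \<exists>t\<in>B'. {s, t} \<in> ?C" for B B'
  proof -
    from that obtain a b where ab: "a \<in> B" "b \<in> B'" "{a, b} \<in> ?C" by auto
    obtain a' b' where a': "a' \<in> (if a = x then {x, y} else {a})" and b': "b' \<in> (if b = x then {x, y} else {b})" and e: "{a', b'} \<in> E"
      using step[OF ab(3)] by blast
    have "a' \<in> f B" "b' \<in> f B'" using a' b' ab Cy[OF ab(3)] neq by (auto simp: f_def split: if_splits)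
    thus ?thesis using e by blast
  qed
  show ?thesis unfolding K33_minor_def
    using XY con dis ed by (intro exI[of _ "\<lambda>i. f (X i)"] exI[of _ "\<lambda>i. f (Y i)"]) auto
qed

text \<open>Double counting of the paths of length two: there are at least 20 card N ordered ones, but at
  most 2 card N (card N - 1) if no two vertices have three common neighbours.\<close>

lemma dense_graph_codegree:
  assumes s: "simple_graph V E" and N: "N \<subseteq> V" "card N \<le> 10" "N \<noteq> {}"
    and deg: "\<And>w. w \<in> N \<Longrightarrow> card (nb E w \<inter> N) \<ge> 5"
  shows "\<exists>a\<in>N. \<exists>b\<in>N. a \<noteq> b \<and> card (nb E a \<inter> nb E b \<inter> N) \<ge> 3"
proof (rule ccontr)
  assume H: "\<not> (\<exists>a\<in>N. \<exists>b\<in>N. a \<noteq> b \<and> card (nb E a \<inter> nb E b \<inter> N) \<ge> 3)"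
  have le: "card (nb E a \<inter> nb E b \<inter> N) \<le> 2" if "a \<in> N" "b \<in> N" "a \<noteq> b" for a b
  proof -
    have "\<not> 3 \<le> card (nb E a \<inter> nb E b \<inter> N)" using that H by blast
    thus ?thesis by simp
  qed
  have fin: "finite N" using s N finite_subset by (auto simp: simple_graph_def)
  define T where "T = (SIGMA x:N. {(a, b). a \<in> nb E x \<inter> N \<and> b \<in> nb E x \<inter> N \<and> a \<noteq> b})"
  have finab: "finite {(a, b). a \<in> nb E x \<inter> N \<and> b \<in> nb E x \<inter> N \<and> a \<noteq> b}" for x
    by (rule finite_subset[of _ "N \<times> N"]) (use fin in auto)
  have "20 * card N \<le> card T"
  proof -
    have "20 \<le> card {(a, b). a \<in> nb E x \<inter> N \<and> b \<in> nb E x \<inter> N \<and> a \<noteq> b}" if x: "x \<in> N" for x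
    proof -
      have f: "finite (nb E x \<inter> N)" using fin by simp
      let ?k = "card (nb E x \<inter> N)"
      have "{(a, b). a \<in> nb E x \<inter> N \<and> b \<in> nb E x \<inter> N \<and> a \<noteq> b} = (SIGMA a:nb E x \<inter> N. (nb E x \<inter> N) - {a})" by auto
      also have "card \<dots> = (\<Sum>a\<in>nb E x \<inter> N. ?k - 1)" using f by (simp add: card_SigmaI)
      finally have "card {(a, b). a \<in> nb E x \<inter> N \<and> b \<in> nb E x \<inter> N \<and> a \<noteq> b} = ?k * (?k - 1)" by simp
      moreover have "5 * 4 \<le> ?k * (?k - 1)" using deg[OF x] by (intro mult_le_mono) auto
      ultimately show ?thesis by simp
    qed
    hence "(\<Sum>x\<in>N. 20) \<le> (\<Sum>x\<in>N. card {(a, b). a \<in> nb E x \<inter> N \<and> b \<in> nb E x \<inter> N \<and> a \<noteq> b})"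
      by (rule sum_mono)
    thus ?thesis unfolding T_def using fin finab by (subst card_SigmaI) auto
  qed
  also have "card T = card ((\<lambda>(x, a, b). ((a, b), x)) ` T)"
    by (rule card_image[symmetric]) (auto simp: inj_on_def)
  also have "(\<lambda>(x, a, b). ((a, b), x)) ` T = (SIGMA ab:{(a, b). a \<in> N \<and> b \<in> N \<and> a \<noteq> b}. nb E (fst ab) \<inter> nb E (snd ab) \<inter> N)"
    unfolding T_def by (auto simp: image_iff insert_commute)
  also have "card \<dots> = (\<Sum>ab\<in>{(a, b). a \<in> N \<and> b \<in> N \<and> a \<noteq> b}. card (nb E (fst ab) \<inter> nb E (snd ab) \<inter> N))"
    using fin by (intro card_SigmaI) (auto intro!: finite_subset[of "{(a, b). a \<in> N \<and> b \<in> N \<and> a \<noteq> b}" "N \<times> N"])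
  also have "\<dots> \<le> (\<Sum>ab\<in>{(a, b). a \<in> N \<and> b \<in> N \<and> a \<noteq> b}. 2)"
    by (intro sum_mono) (use le in auto)
  also have "\<dots> = 2 * card {(a, b). a \<in> N \<and> b \<in> N \<and> a \<noteq> b}" by simp
  also have "{(a, b). a \<in> N \<and> b \<in> N \<and> a \<noteq> b} = (SIGMA a:N. N - {a})" by auto
  also have "card \<dots> = card N * (card N - 1)" using fin by (simp add: card_SigmaI)
  also have "2 * \<dots> \<le> 2 * (card N * 9)" using N(2) by (intro mult_le_mono) auto
  finally show False using N(3) fin by simp
qed

text \<open>In a minimal counterexample every edge lies in at least five triangles, since contracting an edge with c
  common neighbours costs c + 1 edges and one vertex. The neighbourhood of a vertex of minimum degree (at
  most 10) then has minimum degree at least 5 and contains K(2,3).\<close>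

lemma card_edges_le:
  "simple_graph V E \<Longrightarrow> \<not> K33_minor E \<Longrightarrow> card E \<le> 5 * card V"
proof (induction "card V" arbitrary: V E rule: less_induct)
  case less
  show ?case
  proof (rule ccontr)
    assume "\<not> ?case"
    hence "5 * card V + 1 \<le> card E" by simp
    \<comment> \<open>The exact count fixes the degree sum at 10 m + 2, which is below 11 m once m
      >= 5; so some degree is at most 10.\<close>
    then obtain F where F: "F \<subseteq> E" "card F = 5 * card V + 1"
      using obtain_subset_with_card_n by metis
    have finV: "finite V" using less.prems by (simp add: simple_graph_def)
    have s: "simple_graph V F" using less.prems F unfolding simple_graph_def by blast
    have nm: "\<not> K33_minor F" using less.prems F K33_minor_mono by blast
    have common: "card (nb F x \<inter> nb F y) \<ge> 5" if xy: "{x, y} \<in> F" for x y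
    proof -
      have y: "y \<in> V" using simple_graph_edge[OF s xy] by simp
      have c: "card (V - {y}) < card V" using finV y by (rule card_Diff1_less)
      have c1: "card V \<ge> 1" using finV y by (auto simp: card_gt_0_iff Suc_le_eq)
      have "card (contract F x y) \<le> 5 * card (V - {y})"
        using less.hyps[OF c simple_graph_contract[OF s xy]] K33_minor_contract[OF s xy] nm by blast
      moreover have "card (V - {y}) = card V - 1" using y by simp
      ultimately show ?thesis using card_contract[OF s xy] F(2) c1 by simp
    qed
    have "V \<noteq> {}"
    proof
      assume "V = {}"
      hence "F = {}" using s by (auto simp: simple_graph_def)
      thus False using F by simp
    qed
    then obtain v where v: "v \<in> V" and mn: "\<And>w. w \<in> V \<Longrightarrow> card (nb F v) \<le> card (nb F w)"
      using ex_min_if_finite[of "(\<lambda>v. card (nb F v)) ` V"] finV by (auto simp: not_less)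
    let ?N = "nb F v"
    have vN: "v \<notin> ?N" using nb_subset[OF s, of v] by blast
    have Nne: "?N \<noteq> {}"
    proof
      assume e: "?N = {}"
      have "v \<notin> e" if "e \<in> F" for e
        using card_nb[OF s, of v] e that simple_graph_finite_edges[OF s] by (auto simp: card_eq_0_iff)
      hence "simple_graph (V - {v}) F" using s unfolding simple_graph_def by (metis Diff_iff empty_iff finite_Diff insertCI insert_iff)
      moreover have "card (V - {v}) < card V" using v finV by (intro card_Diff1_less)
      ultimately have "card F \<le> 5 * card (V - {v})" using less.hyps nm by blast
      thus False using F(2) \<open>card (V - {v}) < card V\<close> by simp
    qed
    then obtain w where w: "{v, w} \<in> F" by auto
    have big: "card V \<ge> 5"
    proof -
      have "card (nb F v \<inter> nb F w) \<le> card V" using nb_subset[OF s] finV by (intro card_mono) auto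
      thus ?thesis using common[OF w] by simp
    qed
    have "card V * card ?N = (\<Sum>w\<in>V. card ?N)" by simp
    also have "\<dots> \<le> (\<Sum>w\<in>V. card (nb F w))" by (intro sum_mono mn)
    also have "\<dots> = 2 * (5 * card V + 1)" using handshake[OF s] F by simp
    also have "\<dots> < card V * 11" using big by simp
    finally have "card ?N < 11" by (simp only: mult_less_cancel1)
    hence N10: "card ?N \<le> 10" by simp
    have deg: "card (nb F w \<inter> ?N) \<ge> 5" if "w \<in> ?N" for w
      using common[of v w] that by (simp add: Int_commute)
    have NV: "?N \<subseteq> V" using nb_subset[OF s] by blast
    obtain a b where ab: "a \<in> ?N" "b \<in> ?N" "a \<noteq> b" "card (nb F a \<inter> nb F b \<inter> ?N) \<ge> 3"
      using dense_graph_codegree[OF s NV N10 Nne deg] by blast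
    have "card (nb F a \<inter> nb F b \<inter> nb F v) \<le> 2"
    proof (rule no_K33_card_common_nb[OF s nm ab(3)])
      show "a \<noteq> v" "b \<noteq> v" using ab(1,2) vN by blast+
    qed
    thus False using ab(4) by simp
  qed
qed

locale k33_free =
  fixes V :: "'a set" and E :: "'a set set"
  assumes simple: "simple_graph V E" and nomin: "\<not> K33_minor E"
begin

lemma finV: "finite V" using simple by (simp add: simple_graph_def)

lemma sum_nb_inside:
  assumes "S \<subseteq> V" shows "(\<Sum>v\<in>S. card (nb E v \<inter> S)) \<le> 10 * card S"
proof -
  let ?F = "{e \<in> E. e \<subseteq> S}"
  have s: "simple_graph S ?F"
    by (rule simple_graph_subset[OF simple]) (use assms finV finite_subset in auto)
  have "nb E v \<inter> S = nb ?F v" if "v \<in> S" for v using that by auto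
  hence "(\<Sum>v\<in>S. card (nb E v \<inter> S)) = (\<Sum>v\<in>S. card (nb ?F v))" by simp
  also have "\<dots> = 2 * card ?F" by (rule handshake[OF s])
  also have "\<dots> \<le> 2 * (5 * card S)"
    using card_edges_le[OF s] nomin K33_minor_mono[of ?F E] by auto
  finally show ?thesis by simp
qed

text \<open>An edge between the two disjoint sets is counted only once, which saves the factor 2 of
  \<open>sum_nb_inside\<close>.\<close>

lemma sum_nb_between:
  assumes "S \<subseteq> V" "T \<subseteq> V" "S \<inter> T = {}"
  shows "(\<Sum>v\<in>S. card (nb E v \<inter> T)) \<le> 5 * (card S + card T)"
proof -
  let ?F = "{e \<in> E. \<exists>s\<in>S. \<exists>t\<in>T. e = {s, t}}"
  have fin: "finite S" "finite T" using assms(1,2) finV by (auto intro: finite_subset)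
  have s: "simple_graph (S \<union> T) ?F"
    by (rule simple_graph_subset[OF simple]) (use fin in auto)
  have "(\<Sum>v\<in>S. card (nb E v \<inter> T)) = card (SIGMA v:S. nb E v \<inter> T)" using fin by (simp add: card_SigmaI)
  also have "\<dots> = card ((\<lambda>(s, t). {s, t}) ` (SIGMA v:S. nb E v \<inter> T))"
    by (rule card_image[symmetric]) (use assms(3) in \<open>auto simp: inj_on_def doubleton_eq_iff\<close>)
  also have "\<dots> \<le> card ?F"
    by (rule card_mono) (use simple_graph_finite_edges[OF s] in auto)
  also have "\<dots> \<le> 5 * card (S \<union> T)"
    using card_edges_le[OF s] nomin K33_minor_mono[of ?F E] by auto
  also have "card (S \<union> T) = card S + card T" using fin assms(3) by (rule card_Un_disjoint)
  finally show ?thesis .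
qed

end

section \<open>Two dominating vertices\<close>

text \<open>Here F is a set of edges on R, so this is the join of the edge uv with the graph (R, F).\<close>

definition join2 :: "'a \<Rightarrow> 'a \<Rightarrow> 'a set \<Rightarrow> 'a set set \<Rightarrow> 'a set set" where
  "join2 u v R F = {{u, v}} \<union> {{w, z} | w z. w \<in> {u, v} \<and> z \<in> R} \<union> F"

lemma adjop_nb:
  assumes "simple_graph V E" shows "adjop V E y v = (\<Sum>w\<in>nb E v. y w)"
proof -
  have fin: "finite V" using assms by (simp add: simple_graph_def)
  have "adjop V E y v = (\<Sum>w\<in>V. if w \<in> nb E v then y w else 0)"
    unfolding adjop_def by (intro sum.cong) (auto simp: insert_commute)
  also have "\<dots> = (\<Sum>w\<in>V \<inter> nb E v. y w)" using fin by (simp add: sum.If_cases Int_def)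
  also have "V \<inter> nb E v = nb E v" using nb_subset[OF assms, of v] by auto
  finally show ?thesis .
qed

context k33_free begin

lemma nbV: "nb E v \<subseteq> V" using nb_subset[OF simple, of v] by auto

lemma fin_nb [simp]: "finite (nb E v)" by (rule finite_nb[OF simple])

lemma not_self: "{v} \<notin> E" using simple_graph_edge[OF simple, of v v] by auto

lemma sum_nb_le: 
  assumes "S \<subseteq> V"
  shows "(\<Sum>v\<in>S. real (card (nb E v))) \<le> 10 * real (card V)"
proof -
  have "(\<Sum>v\<in>S. real (card (nb E v))) \<le> (\<Sum>v\<in>V. real (card (nb E v)))"
    using finV assms by (intro sum_mono2) auto
  also have "\<dots> = real (\<Sum>v\<in>V. card (nb E v \<inter> V))" using nbV by (simp add: Int_absorb2)
  also have "\<dots> \<le> real (10 * card V)" using sum_nb_inside[of V] by (intro of_nat_mono) simp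
  finally show ?thesis by simp
qed

lemma sum_nb_inside_real:
  assumes "S \<subseteq> T" "T \<subseteq> V" shows "(\<Sum>v\<in>S. real (card (nb E v \<inter> T))) \<le> 10 * real (card T)"
proof -
  have "finite T" using finV assms finite_subset by blast
  hence "(\<Sum>v\<in>S. real (card (nb E v \<inter> T))) \<le> (\<Sum>v\<in>T. real (card (nb E v \<inter> T)))"
    using assms by (intro sum_mono2) auto
  also have "\<dots> = real (\<Sum>v\<in>T. card (nb E v \<inter> T))" by simp
  also have "\<dots> \<le> real (10 * card T)" using sum_nb_inside[OF assms(2)] by (intro of_nat_mono)
  finally show ?thesis by simp
qed

lemma sum_nb_between_real:
  assumes "S \<subseteq> V" "T \<subseteq> V" "S \<inter> T = {}"
  shows "(\<Sum>v\<in>S. real (card (nb E v \<inter> T))) \<le> 5 * (real (card S) + real (card T))"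
proof -
  have "(\<Sum>v\<in>S. real (card (nb E v \<inter> T))) = real (\<Sum>v\<in>S. card (nb E v \<inter> T))" by simp
  also have "\<dots> \<le> real (5 * (card S + card T))" using sum_nb_between[OF assms] by (intro of_nat_mono)
  finally show ?thesis by simp
qed

lemma sum_nb_swap:
  fixes f :: "'a \<Rightarrow> 'a \<Rightarrow> real"
  assumes "S \<subseteq> V" "T \<subseteq> V"
  shows "(\<Sum>z\<in>S. \<Sum>w\<in>nb E z \<inter> T. f z w) = (\<Sum>w\<in>T. \<Sum>z\<in>nb E w \<inter> S. f z w)"
proof -
  have fin: "finite S" "finite T" using assms finV finite_subset by auto
  have "(\<Sum>z\<in>S. \<Sum>w\<in>nb E z \<inter> T. f z w) = (\<Sum>z\<in>S. \<Sum>w\<in>T. if {z, w} \<in> E then f z w else 0)"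
    using fin by (intro sum.cong[OF refl, of S]) (simp add: sum.If_cases Int_def conj_commute)
  also have "\<dots> = (\<Sum>w\<in>T. \<Sum>z\<in>S. if {z, w} \<in> E then f z w else 0)" by (rule sum.swap)
  also have "\<dots> = (\<Sum>w\<in>T. \<Sum>z\<in>nb E w \<inter> S. f z w)"
    using fin by (intro sum.cong[OF refl, of T]) (simp add: sum.If_cases Int_def conj_commute insert_commute)
  finally show ?thesis .
qed

text \<open>Every nonempty subset of \<open>T\<close> has a vertex with at most 10 neighbours in it.
  Removing such vertices one by one charges each edge to the end removed first, which pays at most
  10 \<open>a\<close> times its entry; ordered pairs count each edge twice. The bound is linear in
  the sum of \<open>x\<close>, as \<open>qform_gain\<close> requires.\<close>

lemma sum_edges_le:
  fixes x :: "'a \<Rightarrow> real"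
  assumes "T \<subseteq> V" "\<And>z. z \<in> T \<Longrightarrow> 0 \<le> x z" "\<And>z. z \<in> T \<Longrightarrow> x z \<le> a" "0 \<le> a"
  shows "(\<Sum>z\<in>T. \<Sum>w\<in>nb E z \<inter> T. x z * x w) \<le> 20 * a * (\<Sum>z\<in>T. x z)"
  using assms
proof (induction "card T" arbitrary: T)
  case 0
  hence "T = {}" using finV finite_subset[of T V] by (auto simp: card_eq_0_iff)
  thus ?case by simp
next
  case (Suc k)
  have fin: "finite T" using Suc.prems finV finite_subset by blast
  have "\<exists>z\<in>T. card (nb E z \<inter> T) \<le> 10"
  proof (rule ccontr)
    assume "\<not> ?thesis"
    hence "(\<Sum>z\<in>T. 11) \<le> (\<Sum>z\<in>T. card (nb E z \<inter> T))" by (intro sum_mono) (auto simp: not_le)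
    also have "\<dots> \<le> 10 * card T" by (rule sum_nb_inside) (use Suc.prems in auto)
    finally show False using Suc.hyps(2) by simp
  qed
  then obtain z0 where z0: "z0 \<in> T" "card (nb E z0 \<inter> T) \<le> 10" by auto
  define T' where "T' = T - {z0}"
  have T'V: "T' \<subseteq> V" "{z0} \<subseteq> V" using Suc.prems z0 by (auto simp: T'_def)
  have z0n: "nb E z0 \<inter> T = nb E z0 \<inter> T'" using not_self by (auto simp: T'_def)
  define s where "s = (\<Sum>w\<in>nb E z0 \<inter> T. x w)"
  have "s \<le> (\<Sum>w\<in>nb E z0 \<inter> T. a)" unfolding s_def using Suc.prems by (intro sum_mono) auto
  also have "\<dots> = real (card (nb E z0 \<inter> T)) * a" by simp
  also have "\<dots> \<le> 10 * a" using z0(2) Suc.prems by (intro mult_right_mono) auto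
  finally have s: "s \<le> 10 * a" .
  have IH: "(\<Sum>z\<in>T'. \<Sum>w\<in>nb E z \<inter> T'. x z * x w) \<le> 20 * a * (\<Sum>z\<in>T'. x z)"
    by (rule Suc.hyps(1)) (use Suc.prems Suc.hyps(2) z0 in \<open>auto simp: T'_def\<close>)
  have eq: "(\<Sum>w\<in>nb E z \<inter> T. x z * x w) = (\<Sum>w\<in>nb E z \<inter> T'. x z * x w) + (\<Sum>w\<in>nb E z \<inter> {z0}. x z * x w)" for z
  proof -
    have "nb E z \<inter> T = (nb E z \<inter> T') \<union> (nb E z \<inter> {z0})" using z0 by (auto simp: T'_def)
    thus ?thesis using fin by (simp only:) (rule sum.union_disjoint, auto simp: T'_def)
  qed
  have "(\<Sum>z\<in>T. \<Sum>w\<in>nb E z \<inter> T. x z * x w) = (\<Sum>w\<in>nb E z0 \<inter> T. x z0 * x w) + (\<Sum>z\<in>T'. \<Sum>w\<in>nb E z \<inter> T. x z * x w)"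
    unfolding T'_def using fin z0 by (simp add: sum.remove)
  also have "(\<Sum>z\<in>T'. \<Sum>w\<in>nb E z \<inter> T. x z * x w) = (\<Sum>z\<in>T'. \<Sum>w\<in>nb E z \<inter> T'. x z * x w) + (\<Sum>z\<in>T'. \<Sum>w\<in>nb E z \<inter> {z0}. x z * x w)"
    unfolding eq by (rule sum.distrib)
  also have "(\<Sum>z\<in>T'. \<Sum>w\<in>nb E z \<inter> {z0}. x z * x w) = (\<Sum>w\<in>{z0}. \<Sum>z\<in>nb E w \<inter> T'. x z * x w)"
    by (rule sum_nb_swap[OF T'V])
  also have "\<dots> = (\<Sum>w\<in>nb E z0 \<inter> T. x z0 * x w)" by (simp add: z0n mult.commute)
  finally have "(\<Sum>z\<in>T. \<Sum>w\<in>nb E z \<inter> T. x z * x w) = 2 * (x z0 * s) + (\<Sum>z\<in>T'. \<Sum>w\<in>nb E z \<inter> T'. x z * x w)"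
    by (simp add: s_def sum_distrib_left)
  also have "\<dots> \<le> 2 * (x z0 * (10 * a)) + 20 * a * (\<Sum>z\<in>T'. x z)"
    using IH s Suc.prems(2)[OF z0(1)] by (intro add_mono mult_left_mono) auto
  also have "\<dots> = 20 * a * (\<Sum>z\<in>T. x z)" using fin z0 by (simp add: sum.remove T'_def algebra_simps)
  finally show ?case .
qed

end

locale perron = k33_free V E for V :: "'a set" and E +
  fixes x :: "'a \<Rightarrow> real" and \<rho> :: real and u :: 'a
  assumes big: "real (card V) \<ge> 2.16 * 10 ^ 17"
    and x0: "\<And>v. 0 \<le> x v"
    and eigen: "\<And>v. v \<in> V \<Longrightarrow> adjop V E x v = \<rho> * x v"
    and rho0: "\<rho> \<ge> 0" and rho: "\<rho>\<^sup>2 \<ge> 2 * real (card V) - 4"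
    and u: "u \<in> V" "x u = 1" and x1: "\<And>v. v \<in> V \<Longrightarrow> x v \<le> 1"
begin

abbreviation "n \<equiv> real (card V)"

lemma eig: "v \<in> V \<Longrightarrow> \<rho> * x v = (\<Sum>w\<in>nb E v. x w)"
  using eigen adjop_nb[OF simple] by metis

lemma eig2: assumes "v \<in> V" shows "\<rho>\<^sup>2 * x v = (\<Sum>w\<in>nb E v. \<Sum>z\<in>nb E w. x z)"
proof -
  have "\<rho>\<^sup>2 * x v = \<rho> * (\<Sum>w\<in>nb E v. x w)" using eig[OF assms] by (simp add: power2_eq_square mult.assoc)
  also have "\<dots> = (\<Sum>w\<in>nb E v. \<rho> * x w)" by (rule sum_distrib_left)
  also have "\<dots> = (\<Sum>w\<in>nb E v. \<Sum>z\<in>nb E w. x z)"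
    by (intro sum.cong refl eig) (use nbV in blast)
  finally show ?thesis .
qed

lemma sum_x_le_card: "S \<subseteq> V \<Longrightarrow> (\<Sum>z\<in>S. x z) \<le> real (card S)"
  using sum_mono[of S x "\<lambda>_. 1"] x1 by (auto simp: subset_iff)

lemma rho_large: "\<rho> \<ge> 6.5 * 10 ^ 8"
proof (rule ccontr)
  assume "\<not> ?thesis"
  hence "\<rho>\<^sup>2 < (6.5 * 10 ^ 8)\<^sup>2" using rho0 by (intro power_strict_mono) auto
  thus False using rho big by (simp add: power2_eq_square)
qed

text \<open>Two-step walks from v through vertices whose entry is at least 0.00015 (there are few of them, by the
  degree sum) are counted with weight 1, all others with weight 0.00015.\<close>

lemma rough_bound:
  assumes v: "v \<in> V"
  shows "\<rho>\<^sup>2 * x v \<le> 5 * real (card (nb E v)) + 0.00305 * n"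
proof -
  \<comment> \<open>The threshold makes the two error terms nearly equal: 15 * 0.000103 from large
    entries and 10 * 0.00015 from small ones, together at most 0.00305.\<close>
  define L where "L = {w \<in> V. x w \<ge> 0.00015}"
  have LV: "L \<subseteq> V" by (auto simp: L_def)
  have finL: "finite L" using LV finV finite_subset by blast
  have "(0.00015 * (6.5 * 10 ^ 8)) * real (card L) = (\<Sum>w\<in>L. (6.5 * 10 ^ 8) * 0.00015)" by simp
  also have "\<dots> \<le> (\<Sum>w\<in>L. \<rho> * x w)" using rho_large rho0 by (intro sum_mono mult_mono) (auto simp: L_def)
  also have "\<dots> = (\<Sum>w\<in>L. \<Sum>z\<in>nb E w. x z)" using eig LV by (intro sum.cong) auto
  also have "\<dots> \<le> (\<Sum>w\<in>L. real (card (nb E w)))" using sum_x_le_card nbV by (intro sum_mono) auto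
  also have "\<dots> \<le> 10 * n" by (rule sum_nb_le[OF LV])
  finally have cL: "real (card L) \<le> 0.000103 * n" by simp
  have "\<rho>\<^sup>2 * x v = (\<Sum>w\<in>nb E v. \<Sum>z\<in>nb E w. x z)" by (rule eig2[OF v])
  also have "\<dots> \<le> (\<Sum>w\<in>nb E v. real (card (nb E w \<inter> L)) + 0.00015 * real (card (nb E w)))"
  proof (rule sum_mono)
    fix w
    have "(\<Sum>z\<in>nb E w. x z) \<le> (\<Sum>z\<in>nb E w. (if z \<in> L then 1 else 0) + 0.00015)"
    proof (rule sum_mono)
      fix z assume "z \<in> nb E w"
      hence zV: "z \<in> V" using nbV by blast
      show "x z \<le> (if z \<in> L then 1 else 0) + 0.00015"
        using x1[OF zV] zV by (cases "z \<in> L") (auto simp: L_def)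
    qed
    also have "\<dots> = real (card (nb E w \<inter> L)) + 0.00015 * real (card (nb E w))"
      by (simp add: sum.distrib sum.If_cases)
    finally show "(\<Sum>z\<in>nb E w. x z) \<le> \<dots>" .
  qed
  also have "\<dots> = (\<Sum>w\<in>nb E v. real (card (nb E w \<inter> L))) + 0.00015 * (\<Sum>w\<in>nb E v. real (card (nb E w)))"
    by (simp add: sum.distrib sum_distrib_left)
  also have "(\<Sum>w\<in>nb E v. real (card (nb E w))) \<le> 10 * n" by (rule sum_nb_le[OF nbV])
  also have "(\<Sum>w\<in>nb E v. real (card (nb E w \<inter> L))) = 
     (\<Sum>w\<in>nb E v \<inter> L. real (card (nb E w \<inter> L))) + (\<Sum>w\<in>nb E v - L. real (card (nb E w \<inter> L)))"
    by (rule sum.Int_Diff) simp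
  also have "(\<Sum>w\<in>nb E v \<inter> L. real (card (nb E w \<inter> L))) \<le> 10 * real (card L)"
    by (rule sum_nb_inside_real) (use LV in auto)
  also have "(\<Sum>w\<in>nb E v - L. real (card (nb E w \<inter> L))) \<le> 5 * (real (card (nb E v - L)) + real (card L))"
    by (rule sum_nb_between_real) (use LV nbV[of v] in auto)
  also have "real (card (nb E v - L)) \<le> real (card (nb E v))" by (intro of_nat_mono card_mono) auto
  finally show ?thesis using cL by simp
qed

text \<open>Large degree instead of large entry: the degree sum then bounds \<open>L\<close> by an
  absolute constant and not only by a small fraction of n, and \<open>card_M\<close> builds on
  this.\<close>

definition L where "L = {w \<in> V. real (card (nb E w)) \<ge> n / 4000}"

lemma LV: "L \<subseteq> V" by (auto simp: L_def)

lemma finL: "finite L" using LV finV finite_subset by blast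

lemma card_L: "card L \<le> 40000"
proof -
  have "n / 4000 * real (card L) = (\<Sum>w\<in>L. n / 4000)" by simp
  also have "\<dots> \<le> (\<Sum>w\<in>L. real (card (nb E w)))" by (intro sum_mono) (auto simp: L_def)
  also have "\<dots> \<le> 10 * n" by (rule sum_nb_le[OF LV])
  finally have "n * (real (card L) - 40000) \<le> 0" by (simp add: algebra_simps)
  hence "real (card L) \<le> 40000" using big by (simp add: mult_le_0_iff)
  thus ?thesis by simp
qed

text \<open>Here 5 / 4000 + 0.00305 = 0.0043, and division by 2 n - 4 leaves at most 0.0022.\<close>

lemma small_off_L:
  assumes v: "v \<in> V - L" shows "x v \<le> 0.0022"
proof -
  have "real (card (nb E v)) < n / 4000" using v by (auto simp: L_def)
  hence "\<rho>\<^sup>2 * x v \<le> 0.0043 * n" using rough_bound[of v] v by simp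
  moreover have "(2 * n - 4) * x v \<le> \<rho>\<^sup>2 * x v" using rho x0 by (intro mult_right_mono) auto
  ultimately have "(2 * n - 4) * x v \<le> 0.0043 * n" by simp
  moreover have "(2 * n - 4) * 0.0022 \<ge> 0.0043 * n" using big by simp
  ultimately have "(2 * n - 4) * x v \<le> (2 * n - 4) * 0.0022" by linarith
  moreover have "2 * n - 4 > 0" using big by simp
  ultimately show ?thesis by (simp only: mult_le_cancel_left_pos)
qed

lemma uL: "u \<in> L" using small_off_L[of u] u by auto

definition M where "M = {w \<in> V. card (nb E w \<inter> L) \<ge> 3}"

text \<open>The bound is 2 * 40000^3 / 6, two vertices for each triple in \<open>L\<close>. Its size
  dictates how large n has to be.\<close>

lemma card_M: "real (card M) \<le> 2.2 * 10 ^ 13"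
proof -
  define TT where "TT = {T. T \<subseteq> L \<and> card T = 3}"
  have finT: "finite TT" unfolding TT_def using finL by simp
  have "M \<subseteq> (\<Union>T\<in>TT. {w \<in> V. T \<subseteq> nb E w})"
  proof
    fix w assume w: "w \<in> M"
    hence "3 \<le> card (nb E w \<inter> L)" by (simp add: M_def)
    then obtain T where T: "T \<subseteq> nb E w \<inter> L" "card T = 3" by (rule obtain_subset_with_card_n) blast
    hence "T \<in> TT" by (simp add: TT_def)
    moreover have "w \<in> V" using w by (simp add: M_def)
    ultimately show "w \<in> (\<Union>T\<in>TT. {w \<in> V. T \<subseteq> nb E w})" using T by blast
  qed
  hence "card M \<le> card (\<Union>T\<in>TT. {w \<in> V. T \<subseteq> nb E w})" using finT finV by (intro card_mono) auto
  also have "\<dots> \<le> (\<Sum>T\<in>TT. card {w \<in> V. T \<subseteq> nb E w})" by (rule card_UN_le[OF finT])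
  also have "\<dots> \<le> (\<Sum>T\<in>TT. 2)"
  proof (rule sum_mono)
    fix T assume "T \<in> TT"
    then obtain a b c where T: "T = {a, b, c}" "a \<noteq> b" "a \<noteq> c" "b \<noteq> c" by (auto simp: TT_def card_3_iff)
    have "{w \<in> V. T \<subseteq> nb E w} \<subseteq> nb E a \<inter> nb E b \<inter> nb E c" by (auto simp: T insert_commute)
    hence "card {w \<in> V. T \<subseteq> nb E w} \<le> card (nb E a \<inter> nb E b \<inter> nb E c)" by (intro card_mono) auto
    also have "\<dots> \<le> 2" by (rule no_K33_card_common_nb[OF simple nomin T(2-4)])
    finally show "card {w \<in> V. T \<subseteq> nb E w} \<le> 2" .
  qed
  also have "\<dots> = 2 * (card L choose 3)" unfolding TT_def using n_subsets[OF finL, of 3] by simp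
  finally have 1: "card M \<le> 2 * (card L choose 3)" .
  have "(card L choose 3) * fact 3 \<le> card L ^ 3" by (rule binomial_fact_pow)
  also have "\<dots> \<le> 40000 ^ 3" using card_L by (intro power_mono) auto
  finally have "(card L choose 3) * 6 \<le> 40000 ^ 3" by (simp add: fact_numeral)
  hence "real (card M) \<le> 2 * 40000 ^ 3 / 6" using 1 by simp
  thus ?thesis by simp
qed

text \<open>Only boundedly many vertices w have more than two neighbours in L, because any three vertices of L have
  at most two common neighbours.\<close>

lemma refined_bound:
  assumes v: "v \<in> V" and c: "c \<ge> 0"
    and good: "\<And>w. w \<in> nb E v \<Longrightarrow> card (nb E w \<inter> L) \<le> 2 \<Longrightarrow> (\<Sum>z\<in>nb E w \<inter> L. x z) \<le> c"
  shows "\<rho>\<^sup>2 * x v \<le> c * real (card (nb E v)) + 0.023 * n"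
proof -
  have MV: "M \<subseteq> V" by (auto simp: M_def)
  have finM: "finite M" using MV finV finite_subset by blast
  have "\<rho>\<^sup>2 * x v = (\<Sum>w\<in>nb E v. \<Sum>z\<in>nb E w. x z)" by (rule eig2[OF v])
  also have "\<dots> \<le> (\<Sum>w\<in>nb E v. (\<Sum>z\<in>nb E w \<inter> L. x z) + 0.0022 * real (card (nb E w)))"
  proof (rule sum_mono)
    fix w
    have "(\<Sum>z\<in>nb E w. x z) = (\<Sum>z\<in>nb E w \<inter> L. x z) + (\<Sum>z\<in>nb E w - L. x z)" by (rule sum.Int_Diff) simp
    also have "(\<Sum>z\<in>nb E w - L. x z) \<le> (\<Sum>z\<in>nb E w - L. 0.0022)"
      using small_off_L nbV[of w] by (intro sum_mono) auto
    also have "\<dots> = 0.0022 * real (card (nb E w - L))" by simp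
    also have "\<dots> \<le> 0.0022 * real (card (nb E w))" by (intro mult_left_mono of_nat_mono card_mono) auto
    finally show "(\<Sum>z\<in>nb E w. x z) \<le> (\<Sum>z\<in>nb E w \<inter> L. x z) + 0.0022 * real (card (nb E w))" by simp
  qed
  also have "\<dots> = (\<Sum>w\<in>nb E v. \<Sum>z\<in>nb E w \<inter> L. x z) + 0.0022 * (\<Sum>w\<in>nb E v. real (card (nb E w)))"
    by (simp add: sum.distrib sum_distrib_left)
  also have "(\<Sum>w\<in>nb E v. real (card (nb E w))) \<le> 10 * n" by (rule sum_nb_le[OF nbV])
  also have "(\<Sum>w\<in>nb E v. \<Sum>z\<in>nb E w \<inter> L. x z) = 
     (\<Sum>w\<in>nb E v \<inter> L. \<Sum>z\<in>nb E w \<inter> L. x z) + (\<Sum>w\<in>nb E v - L. \<Sum>z\<in>nb E w \<inter> L. x z)"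
    by (rule sum.Int_Diff) simp
  also have "(\<Sum>w\<in>nb E v \<inter> L. \<Sum>z\<in>nb E w \<inter> L. x z) \<le> (\<Sum>w\<in>nb E v \<inter> L. real (card (nb E w \<inter> L)))"
    using nbV LV by (intro sum_mono sum_x_le_card) auto
  also have "\<dots> \<le> 10 * real (card L)"
    by (rule sum_nb_inside_real) (use LV in auto)
  also have "(\<Sum>w\<in>nb E v - L. \<Sum>z\<in>nb E w \<inter> L. x z) =
     (\<Sum>w\<in>(nb E v - L) \<inter> M. \<Sum>z\<in>nb E w \<inter> L. x z) + (\<Sum>w\<in>(nb E v - L) - M. \<Sum>z\<in>nb E w \<inter> L. x z)"
    by (rule sum.Int_Diff) simp
  also have "(\<Sum>w\<in>(nb E v - L) \<inter> M. \<Sum>z\<in>nb E w \<inter> L. x z) \<le> (\<Sum>w\<in>(nb E v - L) \<inter> M. real (card (nb E w \<inter> L)))"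
    using nbV LV by (intro sum_mono sum_x_le_card) auto
  also have "\<dots> \<le> 5 * (real (card ((nb E v - L) \<inter> M)) + real (card L))"
    by (rule sum_nb_between_real) (use LV MV in auto)
  also have "real (card ((nb E v - L) \<inter> M)) \<le> real (card M)" using finM by (intro of_nat_mono card_mono) auto
  also have "(\<Sum>w\<in>(nb E v - L) - M. \<Sum>z\<in>nb E w \<inter> L. x z) \<le> (\<Sum>w\<in>(nb E v - L) - M. c)"
  proof (rule sum_mono)
    fix w assume w: "w \<in> nb E v - L - M"
    hence "card (nb E w \<inter> L) \<le> 2" using nbV[of v] by (auto simp: M_def)
    thus "(\<Sum>z\<in>nb E w \<inter> L. x z) \<le> c" using good w by blast
  qed
  also have "\<dots> = c * real (card (nb E v - L - M))" by simp
  also have "\<dots> \<le> c * real (card (nb E v))" using c by (intro mult_left_mono of_nat_mono card_mono) auto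
  finally have "\<rho>\<^sup>2 * x v \<le> 10 * real (card L) + (5 * (real (card M) + real (card L)) + c * real (card (nb E v))) + 0.0022 * (10 * n)"
    by simp
  moreover have "real (card L) \<le> 40000" using card_L by simp
  \<comment> \<open>The terms in \<open>card L\<close> and \<open>card M\<close> add up to about 1.1
    * 10^14, which the lower bound on n puts below 0.001 n; the remaining 0.022 n comes from the
    entries off \<open>L\<close>.\<close>
  ultimately show ?thesis using card_M big by simp
qed

text \<open>\<open>v\<close> carries the second largest entry. A middle vertex with at most two
  neighbours in \<open>L\<close> has \<open>u\<close> among them, so it contributes at most 1 +
  \<open>x v\<close> to the two-step walks from \<open>u\<close>. Hence 2 n - 4 <= (1 + x v) n +
  0.023 n, which gives 0.976; the degree bounds come from the same inequality for \<open>u\<close>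
  and its analogue for \<open>v\<close>.\<close>

lemma second_vertex:
  obtains v where "v \<in> V" "v \<noteq> u" "x v \<ge> 0.976" "real (card (nb E u)) \<ge> 0.988 * n" "real (card (nb E v)) \<ge> 0.964 * n"
proof -
  have "V - {u} \<noteq> {}"
  proof
    assume "V - {u} = {}"
    hence "card V \<le> card {u}" by (intro card_mono) auto
    thus False using big by simp
  qed
  hence "Max (x ` (V - {u})) \<in> x ` (V - {u})" using finV by (intro Max_in) auto
  then obtain v where v: "v \<in> V" "v \<noteq> u" and v_max: "Max (x ` (V - {u})) = x v" by auto
  have mx: "x w \<le> x v" if "w \<in> V - {u}" for w
    unfolding v_max[symmetric] using that finV by (intro Max_ge) auto
  have deg: "real (card (nb E w)) \<le> n" for w using nbV[of w] finV by (intro of_nat_mono card_mono)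
  have "\<rho>\<^sup>2 * x u \<le> (1 + x v) * real (card (nb E u)) + 0.023 * n"
  proof (rule refined_bound[OF u(1)])
    fix w assume w: "w \<in> nb E u" "card (nb E w \<inter> L) \<le> 2"
    have uw: "u \<in> nb E w \<inter> L" using w uL by (auto simp: insert_commute)
    have "(\<Sum>z\<in>nb E w \<inter> L. x z) = x u + (\<Sum>z\<in>nb E w \<inter> L - {u}. x z)" using uw by (simp add: sum.remove)
    also have "(\<Sum>z\<in>nb E w \<inter> L - {u}. x z) \<le> (\<Sum>z\<in>nb E w \<inter> L - {u}. x v)"
      using mx LV by (intro sum_mono) auto
    also have "\<dots> = real (card (nb E w \<inter> L - {u})) * x v" by simp
    also have "\<dots> \<le> 1 * x v" using w(2) uw x0 by (intro mult_right_mono) auto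
    finally show "(\<Sum>z\<in>nb E w \<inter> L. x z) \<le> 1 + x v" using u by simp
  qed (use x0[of v] in auto)
  hence 1: "2 * n - 4 \<le> (1 + x v) * real (card (nb E u)) + 0.023 * n" using rho u by simp
  have "(1 + x v) * real (card (nb E u)) \<le> (1 + x v) * n" using deg x0[of v] by (intro mult_left_mono) auto
  hence "1977 / 1000 * n - 4 \<le> n + x v * n" using 1 by (simp add: algebra_simps)
  moreover have "n \<ge> 1000000" using big by simp
  ultimately have "976 / 1000 * n \<le> x v * n" by linarith
  hence xv: "x v \<ge> 0.976" using big by simp
  have "(1 + x v) * real (card (nb E u)) \<le> 2 * real (card (nb E u))" using x1[OF v(1)] by (intro mult_right_mono) auto
  hence du: "real (card (nb E u)) \<ge> 0.988 * n" using 1 big by simp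
  have "\<rho>\<^sup>2 * x v \<le> 2 * real (card (nb E v)) + 0.023 * n"
  proof (rule refined_bound[OF v(1)])
    fix w assume w: "w \<in> nb E v" "card (nb E w \<inter> L) \<le> 2"
    have "(\<Sum>z\<in>nb E w \<inter> L. x z) \<le> real (card (nb E w \<inter> L))" using LV by (intro sum_x_le_card) auto
    thus "(\<Sum>z\<in>nb E w \<inter> L. x z) \<le> 2" using w(2) by linarith
  qed auto
  moreover have "(2 * n - 4) * 0.976 \<le> \<rho>\<^sup>2 * x v" using rho xv big by (intro mult_mono) auto
  ultimately have "real (card (nb E v)) \<ge> 0.964 * n" using big by simp
  thus thesis using that v xv du by blast
qed

end

section \<open>Replacing the exceptional vertices\<close>

text \<open>Ordered pairs are counted, so an edge inside \<open>A\<close> enters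
  \<open>bil E x A A\<close> twice.\<close>

definition bil :: "'a set set \<Rightarrow> ('a \<Rightarrow> real) \<Rightarrow> 'a set \<Rightarrow> 'a set \<Rightarrow> real" where
  "bil E x A B = (\<Sum>z\<in>A. \<Sum>w\<in>B. if {z, w} \<in> E then x z * x w else 0)"

lemma bil_sym: "bil E x A B = bil E x B A"
  unfolding bil_def by (subst sum.swap) (intro sum.cong refl, auto simp: insert_commute mult.commute)

lemma bil_Un_left: "finite A \<Longrightarrow> finite A' \<Longrightarrow> A \<inter> A' = {} \<Longrightarrow> bil E x (A \<union> A') B = bil E x A B + bil E x A' B"
  unfolding bil_def by (rule sum.union_disjoint)

lemma bil_Un_right: "finite B \<Longrightarrow> finite B' \<Longrightarrow> B \<inter> B' = {} \<Longrightarrow> bil E x A (B \<union> B') = bil E x A B + bil E x A B'"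
  using bil_Un_left[of B B' E x A] by (simp add: bil_sym)

lemma bil_diag_Un:
  assumes "finite A" "finite B" "A \<inter> B = {}"
  shows "bil E x (A \<union> B) (A \<union> B) = bil E x A A + 2 * bil E x A B + bil E x B B"
  using assms by (simp add: bil_Un_left bil_Un_right bil_sym[of E x B A])

lemma bil_nb: "finite B \<Longrightarrow> bil E x A B = (\<Sum>z\<in>A. \<Sum>w\<in>nb E z \<inter> B. x z * x w)"
  unfolding bil_def by (intro sum.cong[OF refl, of A]) (simp add: sum.If_cases Int_def conj_commute)

lemma qform_bil: "qform V E x = bil E x V V"
  unfolding qform_def bil_def adjop_def sum_distrib_left by (intro sum.cong refl) (auto simp: insert_commute)

lemma simple_join2:
  assumes "finite R" "u \<notin> R" "v \<notin> R" "u \<noteq> v" "simple_graph R F"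
  shows "simple_graph ({u, v} \<union> R) (join2 u v R F)"
  unfolding simple_graph_def
proof (intro conjI ballI)
  show "finite ({u, v} \<union> R)" using assms by simp
  fix e assume "e \<in> join2 u v R F"
  then consider "e = {u, v}" | w z where "e = {w, z}" "w \<in> {u, v}" "z \<in> R" | "e \<in> F" unfolding join2_def by blast
  thus "\<exists>a b. e = {a, b} \<and> a \<in> {u, v} \<union> R \<and> b \<in> {u, v} \<union> R \<and> a \<noteq> b"
  proof cases
    case 1 thus ?thesis using assms by blast
  next
    case 2 thus ?thesis using assms by blast
  next
    case 3 thus ?thesis using assms(5) unfolding simple_graph_def by blast
  qed
qed

locale perron_pair = perron V E x \<rho> u for V :: "'a set" and E x \<rho> u +
  fixes v :: 'a
  assumes v: "v \<in> V" "v \<noteq> u" "x v \<ge> 0.976"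
    and du: "real (card (nb E u)) \<ge> 0.988 * n" and dv: "real (card (nb E v)) \<ge> 0.964 * n"
begin

definition R where "R = V - {u, v}"
definition C where "C = nb E u \<inter> nb E v"
definition D where "D = R - C"

lemma CR: "C \<subseteq> R" unfolding C_def R_def using nbV not_self by auto
lemma R_eq: "R = C \<union> D" "C \<inter> D = {}" using CR by (auto simp: D_def)
lemma V_eq: "V = {u, v} \<union> R" "{u, v} \<inter> R = {}" using u v by (auto simp: R_def)
lemma finR [simp]: "finite R" using finV by (simp add: R_def)
lemma finC [simp]: "finite C" using CR finR finite_subset by blast
lemma finD [simp]: "finite D" by (simp add: D_def)
lemma RV: "R \<subseteq> V" "C \<subseteq> V" "D \<subseteq> V" using V_eq R_eq by auto

text \<open>A vertex of \<open>D\<close> is missed by \<open>u\<close> or by \<open>v\<close>, which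
  miss at most 0.012 n and 0.036 n vertices.\<close>

lemma card_D: "real (card D) \<le> n / 20"
proof -
  have c: "real (card (V - nb E w)) = n - real (card (nb E w))" for w
    using card_Diff_subset[OF fin_nb nbV, of w] card_mono[OF finV nbV, of w] by simp
  have "D \<subseteq> (V - nb E u) \<union> (V - nb E v)" by (auto simp: D_def R_def C_def)
  hence "card D \<le> card ((V - nb E u) \<union> (V - nb E v))" using finV by (intro card_mono) auto
  also have "\<dots> \<le> card (V - nb E u) + card (V - nb E v)" by (rule card_Un_le)
  finally have "real (card D) \<le> real (card (V - nb E u)) + real (card (V - nb E v))" by simp
  thus ?thesis unfolding c using du dv by simp
qed

lemma card_nb_C: "z \<in> R \<Longrightarrow> card (nb E z \<inter> C) \<le> 2"
  using no_K33_card_common_nb[OF simple nomin, of z u v] v unfolding C_def R_def by (simp add: Int_assoc)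

text \<open>A crude consequence of \<rho>^2 <= 6 n, which makes the walks through \<open>u\<close>
  and \<open>v\<close> in \<open>others_small\<close> negligible.\<close>

lemma rho_small: "\<rho> \<le> n / 1000000"
proof (rule ccontr)
  assume "\<not> ?thesis"
  hence "(n / 1000000)\<^sup>2 < \<rho>\<^sup>2" using big by (intro power_strict_mono) auto
  also have "\<rho>\<^sup>2 \<le> 5 * real (card (nb E u)) + 0.00305 * n" using rough_bound[OF u(1)] u by simp
  also have "real (card (nb E u)) \<le> n" using nbV finV by (intro of_nat_mono card_mono)
  finally have "n * n < 6000000000000 * n" by (simp add: power2_eq_square)
  hence "n < 6000000000000" using big by (simp add: mult_less_cancel_right)
  thus False using big by simp
qed

lemma nb_split: "(\<Sum>z\<in>nb E w. f z) = (\<Sum>z\<in>nb E w \<inter> {u, v}. f z) + (\<Sum>z\<in>nb E w \<inter> R. f z)"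
proof -
  have "nb E w - {u, v} = nb E w \<inter> R" using nbV by (auto simp: R_def)
  thus ?thesis using sum.Int_Diff[of "nb E w" f "{u, v}"] by simp
qed

text \<open>Two-step walks from the vertex \<open>y\<close> of largest entry in \<open>R\<close>.
  Those through \<open>u\<close> or \<open>v\<close> give at most 2 \<rho>. In \<open>R\<close> the
  vertex \<open>y\<close> has at most \<open>card D\<close> + 2 neighbours, each with at most two
  neighbours in \<open>C\<close>. Up to small terms this leaves 1.3 n \<open>x y\<close> <= 0.1 n,
  and 0.1 / 1.3 < 0.0775.\<close>

lemma others_small: "z \<in> R \<Longrightarrow> x z \<le> 0.0775"
proof -
  assume z: "z \<in> R"
  have "Max (x ` R) \<in> x ` R" using z by (intro Max_in) auto
  then obtain y where y: "y \<in> R" and y_max: "Max (x ` R) = x y" by auto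
  have mx: "x w \<le> x y" if "w \<in> R" for w
    unfolding y_max[symmetric] using that by (intro Max_ge) auto
  define W where "W = nb E y \<inter> R"
  have finW: "finite W" by (simp add: W_def)
  have WR: "W \<subseteq> R" by (auto simp: W_def)
  have cW: "real (card W) \<le> real (card D) + 2"
  proof -
    have "W \<subseteq> D \<union> (nb E y \<inter> C)" by (auto simp: W_def D_def)
    hence "card W \<le> card (D \<union> (nb E y \<inter> C))" by (intro card_mono) auto
    also have "\<dots> \<le> card D + card (nb E y \<inter> C)" by (rule card_Un_le)
    finally show ?thesis using card_nb_C[OF y] by simp
  qed
  have uv2: "(\<Sum>t\<in>nb E w \<inter> {u, v}. f t) \<le> 2 * c" if "\<And>t. t \<in> {u, v} \<Longrightarrow> f t \<le> c" "0 \<le> c" for w f and c :: real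
  proof -
    have "(\<Sum>t\<in>nb E w \<inter> {u, v}. f t) \<le> (\<Sum>t\<in>nb E w \<inter> {u, v}. c)" by (intro sum_mono that) auto
    also have "\<dots> = real (card (nb E w \<inter> {u, v})) * c" by simp
    also have "\<dots> \<le> real (card {u, v}) * c" using that by (intro mult_right_mono of_nat_mono card_mono) auto
    also have "card {u, v} = 2" using v by simp
    finally show ?thesis by simp
  qed
  have "\<rho>\<^sup>2 * x y = (\<Sum>w\<in>nb E y. \<Sum>t\<in>nb E w. x t)" using eig2 y RV by blast
  also have "\<dots> = (\<Sum>w\<in>nb E y \<inter> {u, v}. \<Sum>t\<in>nb E w. x t) + (\<Sum>w\<in>W. \<Sum>t\<in>nb E w. x t)"
    unfolding W_def by (rule nb_split)
  also have "(\<Sum>w\<in>nb E y \<inter> {u, v}. \<Sum>t\<in>nb E w. x t) \<le> 2 * \<rho>"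
  proof (rule uv2)
    fix t assume "t \<in> {u, v}"
    hence t: "t \<in> V" using u v by auto
    have "(\<Sum>t\<in>nb E t. x t) = \<rho> * x t" using eig[OF t] by simp
    also have "\<dots> \<le> \<rho> * 1" using x1[OF t] rho0 by (intro mult_left_mono) auto
    finally show "(\<Sum>t\<in>nb E t. x t) \<le> \<rho>" by simp
  qed (rule rho0)
  also have "(\<Sum>w\<in>W. \<Sum>t\<in>nb E w. x t) \<le> (\<Sum>w\<in>W. 2 + x y * (2 + real (card (nb E w \<inter> D))))"
  proof (rule sum_mono)
    fix w assume w: "w \<in> W"
    have "(\<Sum>t\<in>nb E w. x t) = (\<Sum>t\<in>nb E w \<inter> {u, v}. x t) + (\<Sum>t\<in>nb E w \<inter> R. x t)" by (rule nb_split)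
    also have "(\<Sum>t\<in>nb E w \<inter> {u, v}. x t) \<le> 2 * 1" by (rule uv2) (use x1 u v in auto)
    also have "(\<Sum>t\<in>nb E w \<inter> R. x t) \<le> (\<Sum>t\<in>nb E w \<inter> R. x y)" using mx by (intro sum_mono) auto
    also have "\<dots> = x y * real (card (nb E w \<inter> R))" by simp
    also have "\<dots> \<le> x y * (2 + real (card (nb E w \<inter> D)))"
    proof (rule mult_left_mono)
      have "nb E w \<inter> R = (nb E w \<inter> C) \<union> (nb E w \<inter> D)" using R_eq by auto
      hence "card (nb E w \<inter> R) \<le> card (nb E w \<inter> C) + card (nb E w \<inter> D)" using card_Un_le by metis
      thus "real (card (nb E w \<inter> R)) \<le> 2 + real (card (nb E w \<inter> D))" using card_nb_C[of w] w WR by auto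
    qed (rule x0)
    finally show "(\<Sum>t\<in>nb E w. x t) \<le> 2 + x y * (2 + real (card (nb E w \<inter> D)))" by simp
  qed
  also have "\<dots> = 2 * real (card W) + x y * (2 * real (card W) + (\<Sum>w\<in>W. real (card (nb E w \<inter> D))))"
    by (simp add: sum.distrib sum_distrib_left distrib_left)
  \<comment> \<open>Sparsity gives 10 \<open>card D\<close> for the vertices of \<open>W\<close> in
    \<open>D\<close>; at most two vertices of \<open>W\<close> lie in \<open>C\<close>, and each of
    them sees at most all of \<open>D\<close>.\<close>
  also have "(\<Sum>w\<in>W. real (card (nb E w \<inter> D))) \<le> 12 * real (card D)"
  proof -
    have "(\<Sum>w\<in>W. real (card (nb E w \<inter> D))) = (\<Sum>w\<in>W \<inter> D. real (card (nb E w \<inter> D))) + (\<Sum>w\<in>W - D. real (card (nb E w \<inter> D)))"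
      by (rule sum.Int_Diff[OF finW])
    also have "(\<Sum>w\<in>W \<inter> D. real (card (nb E w \<inter> D))) \<le> 10 * real (card D)"
      by (rule sum_nb_inside_real) (use RV in auto)
    also have "(\<Sum>w\<in>W - D. real (card (nb E w \<inter> D))) \<le> (\<Sum>w\<in>W - D. real (card D))"
      by (intro sum_mono of_nat_mono card_mono) auto
    also have "\<dots> = real (card (W - D)) * real (card D)" by simp
    also have "\<dots> \<le> 2 * real (card D)"
    proof (rule mult_right_mono)
      have "W - D \<subseteq> nb E y \<inter> C" by (auto simp: W_def D_def)
      hence "card (W - D) \<le> card (nb E y \<inter> C)" by (intro card_mono) auto
      thus "real (card (W - D)) \<le> 2" using card_nb_C[OF y] by simp
    qed simp
    finally show ?thesis by simp
  qed
  finally have "\<rho>\<^sup>2 * x y \<le> 2 * \<rho> + (2 * real (card W) + x y * (2 * real (card W) + 12 * real (card D)))"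
    using x0[of y] by (simp add: mult_left_mono)
  also have "\<dots> \<le> n / 500000 + (2 * (n / 20 + 2) + x y * (2 * (n / 20 + 2) + 12 * (n / 20)))"
    using rho_small cW card_D x0[of y] by (intro add_mono mult_left_mono) auto
  finally have 1: "\<rho>\<^sup>2 * x y \<le> n / 500000 + (2 * (n / 20 + 2) + x y * (2 * (n / 20 + 2) + 12 * (n / 20)))" .
  have "(2 * n - 4) * x y \<le> \<rho>\<^sup>2 * x y" using rho x0 by (intro mult_right_mono) auto
  hence "(13 / 10 * n - 8) * x y \<le> 50001 / 500000 * n + 4" using 1 by (simp add: algebra_simps)
  also have "\<dots> \<le> (13 / 10 * n - 8) * 0.0775" using big by simp
  finally have "x y \<le> 0.0775" using big by (subst (asm) mult_le_cancel_left_pos) auto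
  thus "x z \<le> 0.0775" using mx[OF z] by simp
qed

definition F where "F = {e \<in> E. e \<subseteq> C}"

lemma simple_F: "simple_graph R F"
  by (rule simple_graph_subset[OF simple]) (use CR in \<open>auto simp: F_def\<close>)

lemma simple_E': "simple_graph V (join2 u v R F)"
  using simple_join2[OF finR _ _ _ simple_F, of u v] V_eq v by simp

text \<open>A vertex \<open>z\<close> of \<open>D\<close> misses \<open>u\<close> or
  \<open>v\<close>, so joining it to both gains at least 2 * 0.976 \<open>x z\<close>. The edges
  lost cost at most 2 * 0.155 per unit of entry towards \<open>C\<close>, where there are two
  neighbours with entries at most 0.0775, and 20 * 0.0775 = 1.55 inside \<open>D\<close>. The
  balance 1.952 - 0.31 - 1.55 = 0.092 explains 0.09; likewise a new edge uv brings 2 * 0.976 >=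
  1.9.\<close>

lemma qform_gain:
  "qform V (join2 u v R F) x \<ge> qform V E x + (if {u, v} \<in> E then 0 else 1.9) + 0.09 * (\<Sum>z\<in>D. x z)"
proof -
  let ?E' = "join2 u v R F"
  let ?U = "{u, v}"
  define \<sigma> where "\<sigma> = (\<Sum>z\<in>D. x z)"
  have \<sigma>0: "\<sigma> \<ge> 0" unfolding \<sigma>_def by (intro sum_nonneg x0)
  have q: "qform V G x = bil G x ?U ?U + 2 * bil G x ?U R + (bil G x C C + 2 * bil G x D C + bil G x D D)" for G
  proof -
    have "qform V G x = bil G x (?U \<union> R) (?U \<union> R)" using V_eq(1) qform_bil by metis
    also have "\<dots> = bil G x ?U ?U + 2 * bil G x ?U R + bil G x R R" using V_eq by (intro bil_diag_Un) auto
    also have "bil G x R R = bil G x (C \<union> D) (C \<union> D)" using R_eq by simp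
    also have "\<dots> = bil G x C C + 2 * bil G x C D + bil G x D D" using R_eq by (intro bil_diag_Un) auto
    finally show ?thesis by (simp add: bil_sym[of G x C D])
  qed
  have nuv: "u \<notin> R" "v \<notin> R" using V_eq by auto
  have E'R: "{z, w} \<in> ?E' \<longleftrightarrow> {z, w} \<in> E \<and> z \<in> C \<and> w \<in> C" if "z \<in> R" "w \<in> R" for z w
    using that nuv unfolding join2_def F_def by (auto simp: doubleton_eq_iff)
  have E'U: "{w, z} \<in> ?E'" if "w \<in> ?U" "z \<in> R" for z w
    using that unfolding join2_def by blast
  have E's: "{u} \<notin> ?E'" "{v} \<notin> ?E'" "{u, v} \<in> ?E'"
    using simple_graph_edge[OF simple_E', of u u] simple_graph_edge[OF simple_E', of v v] by (auto simp: join2_def)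
  have xuv: "x u = 1" "0.976 \<le> x v" using u v by auto
  have UU: "bil ?E' x ?U ?U \<ge> bil E x ?U ?U + (if {u, v} \<in> E then 0 else 1.9)"
    using v(2) E's not_self xuv unfolding bil_def by (auto simp: insert_commute)
  have UR: "bil ?E' x ?U R \<ge> bil E x ?U R + 0.976 * \<sigma>"
  proof -
    have "bil E x R ?U + 0.976 * \<sigma> = (\<Sum>z\<in>R. (\<Sum>w\<in>?U. if {z, w} \<in> E then x z * x w else 0) + (if z \<in> D then 0.976 * x z else 0))"
    proof -
      have "0.976 * \<sigma> = (\<Sum>z\<in>R. if z \<in> D then 0.976 * x z else 0)"
        unfolding \<sigma>_def sum_distrib_left by (rule sum.mono_neutral_cong_left) (use R_eq in auto)
      thus ?thesis by (simp only: bil_def sum.distrib)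
    qed
    also have "\<dots> \<le> (\<Sum>z\<in>R. (\<Sum>w\<in>?U. if {z, w} \<in> ?E' then x z * x w else 0))"
    proof (rule sum_mono)
      fix z assume z: "z \<in> R"
      have e: "{z, u} \<in> ?E'" "{z, v} \<in> ?E'" using E'U[of u z] E'U[of v z] z by (auto simp: insert_commute)
      have xz: "0.976 * x z \<le> x z * x v" "0 \<le> x z * x v"
        using mult_left_mono[OF xuv(2) x0[of z]] x0 by (simp_all add: mult.commute)
      have "\<not> ({z, u} \<in> E \<and> {z, v} \<in> E)" if "z \<in> D" using that by (auto simp: D_def C_def insert_commute)
      thus "(\<Sum>w\<in>?U. if {z, w} \<in> E then x z * x w else 0) + (if z \<in> D then 0.976 * x z else 0)
         \<le> (\<Sum>w\<in>?U. if {z, w} \<in> ?E' then x z * x w else 0)"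
        using v(2) e xuv xz x0[of z] by auto
    qed
    finally show ?thesis by (simp add: bil_def[symmetric] bil_sym[of _ x ?U R])
  qed
  have CC: "bil ?E' x C C = bil E x C C" unfolding bil_def
    using E'R CR by (intro sum.cong refl) (auto simp: subset_iff)
  have DC: "bil ?E' x D C = 0" "bil ?E' x D D = 0" unfolding bil_def
    using E'R R_eq by (auto intro!: sum.neutral)
  have dc: "bil E x D C \<le> 0.155 * \<sigma>"
  proof -
    have "bil E x D C = (\<Sum>z\<in>D. x z * (\<Sum>w\<in>nb E z \<inter> C. x w))" by (simp add: bil_nb sum_distrib_left)
    also have "\<dots> \<le> (\<Sum>z\<in>D. x z * 0.155)"
    proof (intro sum_mono mult_left_mono x0)
      fix z assume z: "z \<in> D"
      have "(\<Sum>w\<in>nb E z \<inter> C. x w) \<le> (\<Sum>w\<in>nb E z \<inter> C. 0.0775)" using others_small CR by (intro sum_mono) auto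
      also have "\<dots> = real (card (nb E z \<inter> C)) * 0.0775" by simp
      also have "\<dots> \<le> 2 * 0.0775" using card_nb_C[of z] z R_eq by (intro mult_right_mono) auto
      finally show "(\<Sum>w\<in>nb E z \<inter> C. x w) \<le> 0.155" by simp
    qed
    also have "\<dots> = 0.155 * \<sigma>" unfolding \<sigma>_def sum_distrib_right[symmetric] by (rule mult.commute)
    finally show ?thesis .
  qed
  have dd: "bil E x D D \<le> 1.55 * \<sigma>"
  proof -
    have "bil E x D D \<le> 20 * 0.0775 * (\<Sum>z\<in>D. x z)"
      unfolding bil_nb[OF finD] by (rule sum_edges_le) (use RV x0 others_small R_eq in auto)
    thus ?thesis by (simp add: \<sigma>_def)
  qed
  have *: "QE' \<ge> QE + c + 0.09 * s" if "QE' = a' + 2 * b' + (cc + 2 * 0 + 0)" "QE = a + 2 * b + (cc + 2 * d + e)"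
    "a' \<ge> a + c" "b' \<ge> b + 0.976 * s" "d \<le> 0.155 * s" "e \<le> 1.55 * s" "s \<ge> 0" for QE' QE a' b' a b cc d e c s :: real
    using that by simp
  show ?thesis unfolding \<sigma>_def[symmetric]
    by (rule *[OF _ q[of E] UU UR dc dd \<sigma>0]) (simp only: q[of ?E'] CC DC)
qed

lemma E_eq_join2: assumes "D = {}" "{u, v} \<in> E" shows "E = join2 u v R F"
proof
  show "join2 u v R F \<subseteq> E"
  proof
    fix e assume "e \<in> join2 u v R F"
    then consider "e = {u, v}" | w z where "e = {w, z}" "w \<in> {u, v}" "z \<in> R" | "e \<in> F" unfolding join2_def by blast
    thus "e \<in> E"
    proof cases
      case 1 thus ?thesis using assms by simp
    next
      case 2
      hence "z \<in> C" using assms R_eq by simp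
      thus ?thesis using 2 by (auto simp: C_def)
    next
      case 3 thus ?thesis by (simp add: F_def)
    qed
  qed
  show "E \<subseteq> join2 u v R F"
  proof
    fix e assume e: "e \<in> E"
    then obtain s t where st: "e = {s, t}" "s \<in> V" "t \<in> V" "s \<noteq> t" using simple unfolding simple_graph_def by blast
    have RC: "R = C" using assms R_eq by simp
    consider "s \<in> R" "t \<in> R" | "s \<in> {u,v}" "t \<in> R" | "s \<in> R" "t \<in> {u, v}" | "s \<in> {u, v}" "t \<in> {u, v}"
      using st V_eq by blast
    thus "e \<in> join2 u v R F"
    proof cases
      case 1
      hence "e \<in> F" using e RC st by (simp add: F_def)
      thus ?thesis by (simp add: join2_def)
    next
      case 2 thus ?thesis using st unfolding join2_def by blast
    next
      case 3
      hence "e = {t, s}" using st by auto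
      thus ?thesis using 3 unfolding join2_def by blast
    next
      case 4
      hence "e = {u, v}" using st by auto
      thus ?thesis by (simp add: join2_def)
    qed
  qed
qed

text \<open>If the radii agree, the gain vanishes: uv is an edge, the entries on \<open>D\<close>
  are 0, and \<open>x\<close> maximizes the Rayleigh quotient of the new graph, so it is an
  eigenvector there. A vertex of \<open>D\<close> would then have entry 0 next to its neighbour
  \<open>u\<close> with entry 1.\<close>

lemma spectral_gain:
  assumes r: "\<rho> = spectral_radius V E"
  shows "spectral_radius V E \<le> spectral_radius V (join2 u v R F)"
    and "spectral_radius V E = spectral_radius V (join2 u v R F) \<Longrightarrow> E = join2 u v R F"
proof -
  let ?E' = "join2 u v R F"
  have ne: "V \<noteq> {}" using u by auto
  define S where "S = (\<Sum>z\<in>V. (x z)\<^sup>2)"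
  have Sp: "S > 0" unfolding S_def using finV u by (intro sum_pos2[of _ u]) auto
  have \<sigma>0: "(\<Sum>z\<in>D. x z) \<ge> 0" by (intro sum_nonneg x0)
  have qE: "qform V E x = \<rho> * S"
    unfolding qform_def S_def using eigen by (simp add: sum_distrib_left power2_eq_square mult_ac)
  have qE': "qform V ?E' x \<le> spectral_radius V ?E' * S" unfolding S_def by (rule rayleigh_le[OF finV ne])
  have "\<rho> * S \<le> spectral_radius V ?E' * S" using qE qE' qform_gain \<sigma>0 by (simp split: if_splits)
  thus "spectral_radius V E \<le> spectral_radius V ?E'" using Sp r by simp
  assume eq: "spectral_radius V E = spectral_radius V ?E'"
  hence q2: "qform V ?E' x \<le> \<rho> * S" using qE' r by simp
  have uvE: "{u, v} \<in> E" using qform_gain qE q2 \<sigma>0 by (simp split: if_splits)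
  have s0: "(\<Sum>z\<in>D. x z) \<le> 0" using qform_gain qE q2 uvE by simp
  have q3: "qform V ?E' x = spectral_radius V ?E' * (\<Sum>z\<in>V. (x z)\<^sup>2)"
    using qform_gain qE q2 uvE \<sigma>0 eq r unfolding S_def[symmetric] by simp
  have "D = {}"
  proof (rule ccontr)
    assume "D \<noteq> {}"
    then obtain z where z: "z \<in> D" by auto
    have "x z = 0" using s0 z x0 sum_nonneg_eq_0_iff[OF finD, of x] \<sigma>0 by auto
    moreover have "adjop V ?E' x z = spectral_radius V ?E' * x z"
      by (rule rayleigh_eq_eigen[OF finV ne q3]) (use z RV in auto)
    ultimately have "(\<Sum>w\<in>nb ?E' z. x w) = 0" using adjop_nb[OF simple_E'] by simp
    moreover have "u \<in> nb ?E' z" using z R_eq unfolding join2_def by (auto simp: insert_commute)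
    ultimately have "x u = 0" using sum_nonneg_eq_0_iff[OF finite_nb[OF simple_E', of z], of x] x0 by auto
    thus False using u by simp
  qed
  thus "E = ?E'" using E_eq_join2 uvE by blast
qed

end

section \<open>Joins of an edge with a linear forest\<close>

locale path_resolvent =
  fixes t lam :: real
  assumes t: "0 < t" "t < 1" and lam: "lam * t = t\<^sup>2 + 1"
begin

lemma lam2: "lam > 2"
proof -
  have "0 < (1 - t)\<^sup>2" using t by simp
  hence "2 * t < lam * t" using lam by (simp add: power2_eq_square algebra_simps)
  thus ?thesis using t by simp
qed

text \<open>The solution of \<open>lam * y i = y (i - 1) + y (i + 1) + 1\<close> with zero boundary values at 0 and m + 1, where t is the smaller
  root of the characteristic equation; g is the correction that appears when phi is summed.\<close>

definition phi :: "nat \<Rightarrow> nat \<Rightarrow> real" where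
  "phi m i = (1 - (t ^ i + t ^ (m + 1 - i)) / (1 + t ^ (m + 1))) / (lam - 2)"

definition g :: "nat \<Rightarrow> real" where "g m = (1 - t ^ m) / (1 + t ^ (m + 1))"

lemma phi_0 [simp]: "phi m 0 = 0" and phi_end [simp]: "phi m (Suc m) = 0"
proof -
  have "1 + t ^ (m + 1) > 0" using t by (intro add_pos_pos) auto
  thus "phi m 0 = 0" "phi m (Suc m) = 0" unfolding phi_def by simp_all
qed

text \<open>The constant 1 / (lam - 2) is a particular solution, while \<open>t ^ i\<close> and
  \<open>t ^ (m + 1 - i)\<close> solve the homogeneous recursion because
  \<open>lam * t = t\<^sup>2 + 1\<close>.\<close>

lemma phi_rec:
  assumes "j < m"
  shows "lam * phi m (Suc j) = phi m j + phi m (Suc (Suc j)) + 1"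
proof -
  \<comment> \<open>Writing \<open>m\<close> as \<open>Suc (j + k)\<close> removes the truncated
    subtraction from all exponents.\<close>
  obtain k where m: "m = Suc (j + k)" using less_imp_Suc_add[OF assms] by blast
  define Q where "Q = 1 + t ^ (m + 1)"
  have Q: "Q > 0" unfolding Q_def using t by (intro add_pos_pos) auto
  have e1: "lam * t ^ Suc j = t ^ j + t ^ Suc (Suc j)" for j
  proof -
    have "lam * t ^ Suc j = (lam * t) * t ^ j" by simp
    thus ?thesis unfolding lam by (simp add: power2_eq_square algebra_simps)
  qed
  have p: "phi m j = (1 - (t ^ j + t ^ Suc (Suc k)) / Q) / (lam - 2)"
     "phi m (Suc j) = (1 - (t ^ Suc j + t ^ Suc k) / Q) / (lam - 2)"
     "phi m (Suc (Suc j)) = (1 - (t ^ Suc (Suc j) + t ^ k) / Q) / (lam - 2)"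
  proof -
    have "m + 1 - j = Suc (Suc k)" "m + 1 - Suc j = Suc k" "m + 1 - Suc (Suc j) = k" unfolding m by simp_all
    thus "phi m j = (1 - (t ^ j + t ^ Suc (Suc k)) / Q) / (lam - 2)"
     "phi m (Suc j) = (1 - (t ^ Suc j + t ^ Suc k) / Q) / (lam - 2)"
     "phi m (Suc (Suc j)) = (1 - (t ^ Suc (Suc j) + t ^ k) / Q) / (lam - 2)"
      unfolding phi_def Q_def by (simp_all only:)
  qed
  have eq: "lam * (1 - (t ^ Suc j + t ^ Suc k) / Q) = (1 - (t ^ j + t ^ Suc (Suc k)) / Q) + (1 - (t ^ Suc (Suc j) + t ^ k) / Q) + (lam - 2)"
  proof -
    have "lam * ((t ^ Suc j + t ^ Suc k) / Q) = (t ^ j + t ^ Suc (Suc k)) / Q + (t ^ Suc (Suc j) + t ^ k) / Q"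
      using e1[of j] e1[of k] by (simp only: times_divide_eq_right distrib_left add_divide_distrib[symmetric]) (simp add: algebra_simps)
    thus ?thesis by (simp add: algebra_simps)
  qed
  have frac: "l * (a / d) = b / d + c / d + 1" if "l * a = b + c + d" "d \<noteq> 0" for l a b c d :: real
    using that by (simp add: field_simps)
  show ?thesis unfolding p by (rule frac[OF eq]) (use lam2 in simp)
qed

lemma sum_phi: "(\<Sum>i<m. phi m (Suc i)) = (real m - 2 * t / (1 - t) * g m) / (lam - 2)"
proof -
  define Q where "Q = 1 + t ^ (m + 1)"
  have Q: "Q > 0" unfolding Q_def using t by (intro add_pos_pos) auto
  have s1: "(\<Sum>i<m. t ^ Suc i) = t * (1 - t ^ m) / (1 - t)"
    using t by (simp add: sum_distrib_left[symmetric] sum_gp_strict)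
  have s2: "(\<Sum>i<m. t ^ (m - i)) = (\<Sum>i<m. t ^ Suc i)"
    by (rule sum.reindex_bij_witness[of _ "\<lambda>i. m - Suc i" "\<lambda>i. m - Suc i"]) (auto simp: Suc_diff_Suc simp del: power_Suc)
  have "(\<Sum>i<m. phi m (Suc i)) = (\<Sum>i<m. (1 - (t ^ Suc i + t ^ (m - i)) / Q)) / (lam - 2)"
    unfolding phi_def Q_def sum_divide_distrib by simp
  also have "(\<Sum>i<m. (1 - (t ^ Suc i + t ^ (m - i)) / Q)) = real m - ((\<Sum>i<m. t ^ Suc i) + (\<Sum>i<m. t ^ (m - i))) / Q"
    by (simp only: sum_subtractf sum_divide_distrib[symmetric] sum.distrib) simp
  also have "\<dots> = real m - 2 * t / (1 - t) * g m"
    unfolding s2 s1 g_def Q_def[symmetric] by (simp add: field_simps)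
  finally show ?thesis .
qed

end

text \<open>A linear forest is given by the vertex sequences of its paths, with isolated vertices as
  singleton lists. Empty lists are excluded because the lengths later serve as positive parts of the
  number of forest vertices.\<close>

definition lf_ok :: "'a \<Rightarrow> 'a \<Rightarrow> 'a list list \<Rightarrow> bool" where
  "lf_ok u v vss \<longleftrightarrow> distinct (u # v # concat vss) \<and> [] \<notin> set vss"

definition lf_V :: "'a \<Rightarrow> 'a \<Rightarrow> 'a list list \<Rightarrow> 'a set" where
  "lf_V u v vss = {u, v} \<union> set (concat vss)"

definition lf_F :: "'a list list \<Rightarrow> 'a set set" where
  "lf_F vss = (\<Union>vs\<in>set vss. path_edges vs)"

definition lf_E :: "'a \<Rightarrow> 'a \<Rightarrow> 'a list list \<Rightarrow> 'a set set" where
  "lf_E u v vss = join2 u v (set (concat vss)) (lf_F vss)"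

lemma simple_path_edges: "distinct vs \<Longrightarrow> simple_graph (set vs) (path_edges vs)"
  unfolding simple_graph_def path_edges_nth
  by (auto simp: nth_eq_iff_index_eq)
    (metis (no_types, lifting) Suc_lessD lessI less_not_refl nth_eq_iff_index_eq nth_mem)

lemma simple_lf_F: assumes "lf_ok u v vss" shows "simple_graph (set (concat vss)) (lf_F vss)"
  unfolding simple_graph_def
proof (intro conjI ballI)
  fix e assume "e \<in> lf_F vss"
  then obtain vs where vs: "vs \<in> set vss" "e \<in> path_edges vs" by (auto simp: lf_F_def)
  have "distinct vs" using assms vs by (auto simp: lf_ok_def distinct_concat_iff)
  from simple_path_edges[OF this] vs(2) obtain a b where "e = {a, b} \<and> a \<in> set vs \<and> b \<in> set vs \<and> a \<noteq> b"
    unfolding simple_graph_def by blast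
  thus "\<exists>a b. e = {a, b} \<and> a \<in> set (concat vss) \<and> b \<in> set (concat vss) \<and> a \<noteq> b" using vs(1) by auto
qed simp

lemma simple_lf_E: assumes "lf_ok u v vss" shows "simple_graph (lf_V u v vss) (lf_E u v vss)"
  unfolding lf_V_def lf_E_def
  by (rule simple_join2[OF _ _ _ _ simple_lf_F[OF assms]]) (use assms in \<open>auto simp: lf_ok_def\<close>)

lemma lf_index_unique:
  assumes "lf_ok u v vss" "vs \<in> set vss" "vs' \<in> set vss" "i < length vs" "j < length vs'" "vs ! i = vs' ! j"
  shows "vs = vs' \<and> i = j"
proof -
  have d: "distinct (concat vss)" using assms by (simp add: lf_ok_def)
  have "set vs \<inter> set vs' \<noteq> {}" using assms(4-6) nth_mem by fastforce
  hence "vs = vs'" using d assms(2,3) unfolding distinct_concat_iff by blast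
  moreover have "distinct vs" using d assms(2) unfolding distinct_concat_iff by blast
  ultimately show ?thesis using assms(4-6) by (simp add: nth_eq_iff_index_eq)
qed

lemma sum_lf:
  fixes f :: "'a \<Rightarrow> real"
  assumes "lf_ok u v vss"
  shows "(\<Sum>w\<in>set (concat vss). f w) = (\<Sum>vs\<leftarrow>vss. \<Sum>i<length vs. f (vs ! i))"
proof -
  have d: "distinct (concat vss)" using assms by (simp add: lf_ok_def)
  have "(\<Sum>w\<in>set (concat vss). f w) = sum_list (map f (concat vss))"
    by (rule sum_list_distinct_conv_sum_set[OF d, symmetric])
  also have "\<dots> = (\<Sum>vs\<leftarrow>vss. sum_list (map f vs))" by (induction vss) auto
  also have "\<dots> = (\<Sum>vs\<leftarrow>vss. \<Sum>i<length vs. f (vs ! i))"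
    by (simp add: sum_list_sum_nth atLeast0LessThan)
  finally show ?thesis .
qed

lemma nb_lf_F:
  assumes ok: "lf_ok u v vss" and vs: "vs \<in> set vss" "i < length vs"
  shows "(\<Sum>z\<in>nb (lf_F vss) (vs ! i). f z) =
     (if i = 0 then 0 else f (vs ! (i - 1))) + (if Suc i < length vs then f (vs ! Suc i) else (0::real))"
proof -
  have dv: "distinct vs" using ok vs by (auto simp: lf_ok_def distinct_concat_iff)
  have "nb (lf_F vss) (vs ! i) = (if i = 0 then {} else {vs ! (i - 1)}) \<union> (if Suc i < length vs then {vs ! Suc i} else {})"
  proof (intro equalityI subsetI)
    fix z assume "z \<in> nb (lf_F vss) (vs ! i)"
    then obtain ws where ws: "ws \<in> set vss" "{vs ! i, z} \<in> path_edges ws" by (auto simp: lf_F_def)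
    then obtain j where j: "{vs ! i, z} = {ws ! j, ws ! (j + 1)}" "j + 1 < length ws" unfolding path_edges_nth by auto
    then consider "vs ! i = ws ! j" "z = ws ! (j + 1)" | "vs ! i = ws ! (j + 1)" "z = ws ! j"
      by (auto simp: doubleton_eq_iff)
    thus "z \<in> (if i = 0 then {} else {vs ! (i - 1)}) \<union> (if Suc i < length vs then {vs ! Suc i} else {})"
    proof cases
      case 1
      hence "vs = ws \<and> i = j" using lf_index_unique[OF ok vs(1) ws(1) vs(2), of j] j by simp
      thus ?thesis using 1 j by auto
    next
      case 2
      hence "vs = ws \<and> i = j + 1" using lf_index_unique[OF ok vs(1) ws(1) vs(2), of "j + 1"] j by simp
      thus ?thesis using 2 by auto
    qed
  next
    fix z assume z: "z \<in> (if i = 0 then {} else {vs ! (i - 1)}) \<union> (if Suc i < length vs then {vs ! Suc i} else {})"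
    have "{vs ! i, z} \<in> path_edges vs"
    proof (cases "i \<noteq> 0 \<and> z = vs ! (i - 1)")
      case True
      thus ?thesis using vs unfolding path_edges_nth by (auto intro!: exI[of _ "i - 1"] simp: insert_commute)
    next
      case False
      thus ?thesis using z vs unfolding path_edges_nth by (auto intro!: exI[of _ i] split: if_splits)
    qed
    thus "z \<in> nb (lf_F vss) (vs ! i)" using vs by (auto simp: lf_F_def)
  qed
  moreover have "vs ! (i - 1) \<noteq> vs ! Suc i" if "i \<noteq> 0" "Suc i < length vs"
    using that dv by (simp add: nth_eq_iff_index_eq)
  ultimately show ?thesis by auto
qed

lemma mem_join2:
  "{a, z} \<in> join2 u v R F \<longleftrightarrow> {a, z} = {u, v} \<or> (a \<in> {u, v} \<and> z \<in> R) \<or> (z \<in> {u, v} \<and> a \<in> R) \<or> {a, z} \<in> F"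
proof -
  have "{a, z} \<in> {{w, z} | w z. w \<in> {u, v} \<and> z \<in> R} \<longleftrightarrow> (a \<in> {u, v} \<and> z \<in> R) \<or> (z \<in> {u, v} \<and> a \<in> R)"
  proof
    assume "{a, z} \<in> {{w, z} | w z. w \<in> {u, v} \<and> z \<in> R}"
    then obtain w y where "{a, z} = {w, y}" "w \<in> {u, v}" "y \<in> R" by blast
    thus "(a \<in> {u, v} \<and> z \<in> R) \<or> (z \<in> {u, v} \<and> a \<in> R)" unfolding doubleton_eq_iff by blast
  next
    assume "(a \<in> {u, v} \<and> z \<in> R) \<or> (z \<in> {u, v} \<and> a \<in> R)"
    moreover have "{a, z} = {z, a}" by (rule insert_commute)
    ultimately show "{a, z} \<in> {{w, z} | w z. w \<in> {u, v} \<and> z \<in> R}" by blast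
  qed
  thus ?thesis unfolding join2_def by blast
qed

lemma nb_lf_E:
  assumes ok: "lf_ok u v vss"
  shows "nb (lf_E u v vss) u = insert v (set (concat vss))" "nb (lf_E u v vss) v = insert u (set (concat vss))"
    "w \<in> set (concat vss) \<Longrightarrow> nb (lf_E u v vss) w = {u, v} \<union> nb (lf_F vss) w"
proof -
  have un: "u \<notin> set (concat vss)" "v \<notin> set (concat vss)" "u \<noteq> v" using ok by (auto simp: lf_ok_def)
  have F: "a \<in> set (concat vss) \<and> b \<in> set (concat vss)" if "{a, b} \<in> lf_F vss" for a b
    using simple_graph_edge[OF simple_lf_F[OF ok] that] by simp
  have nF: "{u, a} \<notin> lf_F vss" "{v, a} \<notin> lf_F vss" for a using F un by blast+
  show "nb (lf_E u v vss) u = insert v (set (concat vss))"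
    using un nF unfolding lf_E_def nb_def mem_join2 doubleton_eq_iff by blast
  show "nb (lf_E u v vss) v = insert u (set (concat vss))"
    using un nF unfolding lf_E_def nb_def mem_join2 doubleton_eq_iff by blast
  show "nb (lf_E u v vss) w = {u, v} \<union> nb (lf_F vss) w" if "w \<in> set (concat vss)"
    using un that unfolding lf_E_def nb_def mem_join2 doubleton_eq_iff by blast
qed

context path_resolvent begin

text \<open>A vertex determines its path and its position by \<open>lf_index_unique\<close>, so the
  solutions on the separate paths fit together to one function.\<close>

lemma ex_potential:
  assumes ok: "lf_ok u v vss"
  obtains f where "\<And>vs i. vs \<in> set vss \<Longrightarrow> i < length vs \<Longrightarrow> f (vs ! i) = phi (length vs) (Suc i)"
proof -
  define P where "P w p \<longleftrightarrow> fst p \<in> set vss \<and> snd p < length (fst p) \<and> fst p ! snd p = w" for w and p :: "'a list \<times> nat"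
  define f where "f w = (let p = (SOME p. P w p) in phi (length (fst p)) (Suc (snd p)))" for w
  have "f (vs ! i) = phi (length vs) (Suc i)" if "vs \<in> set vss" "i < length vs" for vs i
  proof -
    have "P (vs ! i) (vs, i)" using that by (simp add: P_def)
    hence "P (vs ! i) (SOME p. P (vs ! i) p)" by (rule someI)
    hence "fst (SOME p. P (vs ! i) p) = vs \<and> snd (SOME p. P (vs ! i) p) = i" unfolding P_def
      by (intro lf_index_unique[OF ok _ that(1) _ that(2)]) simp_all
    thus ?thesis by (simp add: f_def)
  qed
  thus thesis by (rule that)
qed

definition Phi :: "nat list \<Rightarrow> real" where
  "Phi ms = (real (sum_list ms) - 2 * t / (1 - t) * (\<Sum>m\<leftarrow>ms. g m)) / (lam - 2)"

lemma potential_props: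
  assumes ok: "lf_ok u v vss"
    and f: "\<And>vs i. vs \<in> set vss \<Longrightarrow> i < length vs \<Longrightarrow> f (vs ! i) = phi (length vs) (Suc i)"
  shows potential_sum: "(\<Sum>w\<in>set (concat vss). f w) = Phi (map length vss)"
    and potential_eq: "w \<in> set (concat vss) \<Longrightarrow> lam * f w = (\<Sum>z\<in>nb (lf_F vss) w. f z) + 1"
proof -
  have "(\<Sum>w\<in>set (concat vss). f w) = (\<Sum>vs\<leftarrow>vss. \<Sum>i<length vs. f (vs ! i))" by (rule sum_lf[OF ok])
  also have "\<dots> = (\<Sum>vs\<leftarrow>vss. (real (length vs) - 2 * t / (1 - t) * g (length vs)) / (lam - 2))"
  proof (intro arg_cong[of _ _ sum_list] map_cong refl)
    fix vs assume "vs \<in> set vss"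
    hence "(\<Sum>i<length vs. f (vs ! i)) = (\<Sum>i<length vs. phi (length vs) (Suc i))" using f by simp
    thus "(\<Sum>i<length vs. f (vs ! i)) = (real (length vs) - 2 * t / (1 - t) * g (length vs)) / (lam - 2)"
      by (simp only: sum_phi)
  qed
  also have "\<dots> = Phi (map length vss)"
    unfolding Phi_def by (induction vss) (simp_all add: add_divide_distrib diff_divide_distrib distrib_left)
  finally show "(\<Sum>w\<in>set (concat vss). f w) = Phi (map length vss)" .
  assume "w \<in> set (concat vss)"
  then obtain vs i where vs: "vs \<in> set vss" "i < length vs" "w = vs ! i" by (auto simp: in_set_conv_nth)
  \<comment> \<open>The zero boundary values of \<open>phi\<close> stand for the missing neighbours
    at the two ends of a path.\<close>
  have "(if i = 0 then 0 else f (vs ! (i - 1))) = phi (length vs) i"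
    using f[OF vs(1), of "i - 1"] vs(2) by (cases i) auto
  moreover have "(if Suc i < length vs then f (vs ! Suc i) else 0) = phi (length vs) (Suc (Suc i))"
  proof (cases "Suc i < length vs")
    case False
    hence "Suc (Suc i) = Suc (length vs)" using vs(2) by simp
    thus ?thesis using False by simp
  qed (use f[OF vs(1)] in auto)
  ultimately have "(\<Sum>z\<in>nb (lf_F vss) w. f z) = phi (length vs) i + phi (length vs) (Suc (Suc i))"
    unfolding vs(3) nb_lf_F[OF ok vs(1,2)] by simp
  thus "lam * f w = (\<Sum>z\<in>nb (lf_F vss) w. f z) + 1"
    using phi_rec[OF vs(2)] f[OF vs(1,2)] vs(3) by simp
qed

text \<open>Pair the Perron vector with the potential f, which satisfies \<open>(lam - A) f = 1\<close> on the forest.\<close>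

lemma lf_eigen_Phi:
  assumes ok: "lf_ok u v vss" and sr: "lam = spectral_radius (lf_V u v vss) (lf_E u v vss)"
  shows "lam = 1 + 2 * Phi (map length vss)"
proof -
  let ?V = "lf_V u v vss" and ?E = "lf_E u v vss" and ?R = "set (concat vss)" and ?F = "lf_F vss"
  have un: "u \<notin> ?R" "v \<notin> ?R" "u \<noteq> v" using ok by (auto simp: lf_ok_def)
  have fin: "finite ?V" "?V \<noteq> {}" by (auto simp: lf_V_def)
  obtain x where x: "\<forall>w. 0 \<le> x w" "\<exists>w\<in>?V. x w \<noteq> 0" "\<forall>w\<in>?V. adjop ?V ?E x w = lam * x w"
    using ex_perron_vector[OF fin, of ?E] unfolding sr by blast
  have e: "lam * x w = (\<Sum>z\<in>nb ?E w. x z)" if "w \<in> ?V" for w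
    using x(3) that adjop_nb[OF simple_lf_E[OF ok]] by metis
  have eu: "lam * x u = x v + (\<Sum>w\<in>?R. x w)" "lam * x v = x u + (\<Sum>w\<in>?R. x w)"
    using e[of u] e[of v] un unfolding nb_lf_E(1,2)[OF ok] lf_V_def by auto
  have FR: "nb ?F w \<subseteq> ?R" for w using nb_subset[OF simple_lf_F[OF ok], of w] by blast
  have ew: "lam * x w = x u + x v + (\<Sum>z\<in>nb ?F w. x z)" if w: "w \<in> ?R" for w
  proof -
    have "lam * x w = (\<Sum>z\<in>{u, v} \<union> nb ?F w. x z)" using e[of w] w nb_lf_E(3)[OF ok w] by (simp add: lf_V_def)
    also have "\<dots> = (\<Sum>z\<in>{u, v}. x z) + (\<Sum>z\<in>nb ?F w. x z)"
      using un FR[of w] finite_nb[OF simple_lf_F[OF ok]] by (intro sum.union_disjoint) auto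
    finally show ?thesis using un by simp
  qed
  obtain f where f: "\<And>vs i. vs \<in> set vss \<Longrightarrow> i < length vs \<Longrightarrow> f (vs ! i) = phi (length vs) (Suc i)"
    using ex_potential[OF ok] by blast
  let ?s = "x u + x v"
  have sym: "(\<Sum>w\<in>?R. x w * (\<Sum>z\<in>nb ?F w. f z)) = (\<Sum>w\<in>?R. f w * (\<Sum>z\<in>nb ?F w. x z))"
    using adjop_sym[of x ?R ?F f] unfolding adjop_nb[OF simple_lf_F[OF ok]] .
  have "(\<Sum>w\<in>?R. x w) = (\<Sum>w\<in>?R. x w * (lam * f w - (\<Sum>z\<in>nb ?F w. f z)))"
    using potential_eq[OF ok f] by (intro sum.cong refl) simp
  also have "\<dots> = lam * (\<Sum>w\<in>?R. x w * f w) - (\<Sum>w\<in>?R. f w * (\<Sum>z\<in>nb ?F w. x z))"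
    unfolding sym[symmetric] by (simp add: sum_subtractf sum_distrib_left algebra_simps)
  also have "\<dots> = (\<Sum>w\<in>?R. f w * (lam * x w - (\<Sum>z\<in>nb ?F w. x z)))"
    by (simp add: sum_subtractf sum_distrib_left algebra_simps)
  also have "\<dots> = (\<Sum>w\<in>?R. ?s * f w)"
    using ew by (intro sum.cong refl) simp
  also have "\<dots> = ?s * Phi (map length vss)"
    using potential_sum[OF ok f] by (simp only: sum_distrib_left[symmetric])
  finally have sR: "(\<Sum>w\<in>?R. x w) = ?s * Phi (map length vss)" .
  have "?s \<noteq> 0"
  proof
    assume s: "?s = 0"
    hence "x u = 0" "x v = 0" using x(1) by (smt (verit))+
    moreover have "\<forall>w\<in>?R. x w = 0" using sR s x(1) by (simp add: sum_nonneg_eq_0_iff)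
    ultimately show False using x(2) by (auto simp: lf_V_def)
  qed
  moreover have "lam * ?s = ?s * (1 + 2 * Phi (map length vss))"
    using eu sR by (simp add: algebra_simps)
  ultimately show ?thesis by simp
qed

text \<open>Here \<open>lam\<close> may differ from the radius of this graph. The test vector is 1
  at \<open>u\<close> and \<open>v\<close> and twice the potential on the forest. It satisfies the
  eigenvalue equation on the forest, and at each of \<open>u\<close> and \<open>v\<close> it exceeds
  it by \<open>1 + 2 * Phi (map length vss) - lam\<close>.\<close>

lemma lf_rayleigh:
  assumes ok: "lf_ok u v vss" and ge: "lam \<le> 1 + 2 * Phi (map length vss)"
  shows "lam \<le> spectral_radius (lf_V u v vss) (lf_E u v vss)"
    and "lam < 1 + 2 * Phi (map length vss) \<Longrightarrow> lam < spectral_radius (lf_V u v vss) (lf_E u v vss)"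
proof -
  let ?V = "lf_V u v vss" and ?E = "lf_E u v vss" and ?R = "set (concat vss)" and ?F = "lf_F vss"
  have un: "u \<notin> ?R" "v \<notin> ?R" "u \<noteq> v" using ok by (auto simp: lf_ok_def)
  have fin: "finite ?V" "?V \<noteq> {}" by (auto simp: lf_V_def)
  have FR: "nb ?F w \<subseteq> ?R" for w using nb_subset[OF simple_lf_F[OF ok], of w] by blast
  obtain f where f: "\<And>vs i. vs \<in> set vss \<Longrightarrow> i < length vs \<Longrightarrow> f (vs ! i) = phi (length vs) (Suc i)"
    using ex_potential[OF ok] by blast
  define y where "y w = (if w \<in> {u, v} then 1 else 2 * f w)" for w
  have yR: "y w = 2 * f w" if "w \<in> ?R" for w using that un by (auto simp: y_def)
  have sR: "(\<Sum>w\<in>?R. y w) = 2 * Phi (map length vss)"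
    using yR potential_sum[OF ok f] by (simp add: sum_distrib_left[symmetric])
  let ?a = "1 + 2 * Phi (map length vss)"
  have au: "adjop ?V ?E y u = ?a" "adjop ?V ?E y v = ?a"
    using un sR unfolding adjop_nb[OF simple_lf_E[OF ok]] nb_lf_E(1,2)[OF ok] by (auto simp: y_def)
  have aw: "adjop ?V ?E y w = lam * y w" if w: "w \<in> ?R" for w
  proof -
    have "adjop ?V ?E y w = (\<Sum>z\<in>{u, v} \<union> nb ?F w. y z)"
      unfolding adjop_nb[OF simple_lf_E[OF ok]] nb_lf_E(3)[OF ok w] ..
    also have "\<dots> = (\<Sum>z\<in>{u, v}. y z) + (\<Sum>z\<in>nb ?F w. y z)"
      using un FR[of w] finite_nb[OF simple_lf_F[OF ok]] by (intro sum.union_disjoint) auto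
    also have "(\<Sum>z\<in>nb ?F w. y z) = 2 * (\<Sum>z\<in>nb ?F w. f z)"
      unfolding sum_distrib_left by (rule sum.cong[OF refl], rule yR) (use FR[of w] in blast)
    also have "(\<Sum>z\<in>{u, v}. y z) = 2" using un by (simp add: y_def)
    finally show ?thesis using potential_eq[OF ok f w] yR[OF w] by simp
  qed
  define S where "S = (\<Sum>w\<in>?V. (y w)\<^sup>2)"
  have Vsum: "(\<Sum>w\<in>?V. h w) = h u + h v + (\<Sum>w\<in>?R. h w)" for h :: "'a \<Rightarrow> real"
  proof -
    have "(\<Sum>w\<in>{u, v} \<union> ?R. h w) = (\<Sum>w\<in>{u, v}. h w) + (\<Sum>w\<in>?R. h w)" using un by (intro sum.union_disjoint) auto
    thus ?thesis using un by (simp add: lf_V_def)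
  qed
  have yu: "y u = 1" "y v = 1" by (auto simp: y_def)
  have Sp: "S > 0" unfolding S_def using fin yu by (intro sum_pos2[of _ u]) (auto simp: lf_V_def)
  have "qform ?V ?E y = ?a + ?a + (\<Sum>w\<in>?R. lam * (y w)\<^sup>2)"
    unfolding qform_def Vsum au yu using aw by (simp add: power2_eq_square mult_ac)
  moreover have "S = 2 + (\<Sum>w\<in>?R. (y w)\<^sup>2)" unfolding S_def Vsum yu by simp
  ultimately have "qform ?V ?E y = lam * S + 2 * (?a - lam)"
    by (simp add: sum_distrib_left[symmetric] algebra_simps)
  hence le: "lam * S + 2 * (?a - lam) \<le> spectral_radius ?V ?E * S"
    using rayleigh_le[OF fin, of ?E y] by (simp add: S_def)
  hence "lam * S \<le> spectral_radius ?V ?E * S" using ge by simp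
  thus "lam \<le> spectral_radius ?V ?E" using Sp by simp
  assume "lam < ?a"
  hence "lam * S < spectral_radius ?V ?E * S" using le by simp
  thus "lam < spectral_radius ?V ?E" using Sp by simp
qed

lemma Phi_mono:
  assumes "sum_list ms = sum_list ms'"
  shows "(\<Sum>m\<leftarrow>ms'. g m) \<le> (\<Sum>m\<leftarrow>ms. g m) \<Longrightarrow> Phi ms \<le> Phi ms'"
    and "(\<Sum>m\<leftarrow>ms'. g m) < (\<Sum>m\<leftarrow>ms. g m) \<Longrightarrow> Phi ms < Phi ms'"
  unfolding Phi_def using assms t lam2
  by (auto intro!: divide_right_mono divide_strict_right_mono mult_left_mono mult_strict_left_mono divide_pos_pos)

end

section \<open>Optimal path lengths\<close>

context path_resolvent begin

lemma one_plus_pos: "1 + t ^ k > 0" using t by (intro add_pos_pos) auto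

lemma g_0 [simp]: "g 0 = 0" by (simp add: g_def)

lemma g_lt_1: "g m < 1"
  using one_plus_pos[of "m + 1"] zero_less_power[OF t(1), of m] zero_less_power[OF t(1), of "m + 1"]
  by (simp add: g_def divide_less_eq)

text \<open>Together with \<open>g_lt_1\<close> this shows that for small \<open>t\<close> the
  values of \<open>g\<close> at positive lengths are almost 1, so the sum of \<open>g\<close>
  essentially counts the paths.\<close>

lemma g_ge: assumes "m \<ge> 1" shows "g m \<ge> 1 - 2 * t"
proof -
  have "t ^ m \<le> t" using power_decreasing[OF assms, of t] t by simp
  have "1 - 2 * t \<le> 1 - 2 * t ^ m" using \<open>t ^ m \<le> t\<close> by simp
  also have "\<dots> \<le> g m"
  proof -
    have "t ^ (m + 1) \<le> t ^ m" using t by (intro power_decreasing) auto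
    moreover have "t ^ m * t ^ (m + 1) \<ge> 0" using t by simp
    ultimately have "(1 - 2 * t ^ m) * (1 + t ^ (m + 1)) \<le> 1 - t ^ m" by (simp add: algebra_simps)
    thus ?thesis unfolding g_def using one_plus_pos[of "m + 1"] by (simp add: pos_le_divide_eq)
  qed
  finally show ?thesis .
qed

section \<open>Strict concavity of \<open>g\<close>\<close>

definition dg :: "nat \<Rightarrow> real" where "dg m = g (Suc m) - g m"

lemma dg_eq: "dg m = (1 - t\<^sup>2) * t ^ m / ((1 + t ^ (m + 1)) * (1 + t ^ (m + 2)))"
proof -
  have "1 + t ^ (m + 1) \<noteq> 0" "1 + t ^ (m + 2) \<noteq> 0"
    using one_plus_pos[of "m + 1"] one_plus_pos[of "m + 2"] by linarith+
  moreover have "(1 - t ^ Suc m) * (1 + t ^ (m + 1)) - (1 - t ^ m) * (1 + t ^ (m + 2)) = (1 - t\<^sup>2) * t ^ m"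
    by (simp add: power2_eq_square algebra_simps)
  ultimately show ?thesis unfolding dg_def g_def by (simp add: diff_frac_eq mult.commute del: power_Suc)
qed

lemma dg_Suc_less: "dg (Suc m) < dg m"
proof -
  define p where "p = t ^ m"
  have p: "0 < p" "p \<le> 1" using t by (auto simp: p_def power_le_one)
  have q: "1 + t * p > 0" "1 + t * (t * p) > 0" "1 + t * (t * (t * p)) > 0"
    using one_plus_pos[of "m + 1"] one_plus_pos[of "m + 2"] one_plus_pos[of "m + 3"] by (simp_all add: p_def numeral_3_eq_3)
  have "t * t < 1 * 1" using t by (intro mult_strict_mono) auto
  hence t2: "1 - t\<^sup>2 > 0" by (simp add: power2_eq_square)
  \<comment> \<open>The factor \<open>1 + t ^ (m + 2)\<close> occurs in both quotients given by
    \<open>dg_eq\<close>. After cancelling it this inequality remains, whose two sides differ by (1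
    - t) (1 - t^2 p).\<close>
  have "t * (1 + t * p) < 1 + t * (t * (t * p))"
  proof -
    have "t * p \<le> 1 * 1" using t p by (intro mult_mono) auto
    hence "t * (t * p) \<le> t * 1" using t by (intro mult_left_mono) auto
    hence "t * (t * p) < 1" using t by linarith
    hence "0 < (1 - t) * (1 - t * (t * p))" using t by simp
    thus ?thesis by (simp add: algebra_simps)
  qed
  hence "(1 - t\<^sup>2) * p * (t * (1 + t * p)) < (1 - t\<^sup>2) * p * (1 + t * (t * (t * p)))"
    using t2 p by (intro mult_strict_left_mono) auto
  hence le: "(1 - t\<^sup>2) * (t * p) * (1 + t * p) < (1 - t\<^sup>2) * p * (1 + t * (t * (t * p)))"
    by (simp only: mult_ac)
  have frac: "a / (b * c) < a' / (b' * b)" if "a * b' < a' * c" "b > 0" "b' > 0" "c > 0" for a a' b b' c :: real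
  proof -
    have "a * b' * b < a' * c * b" using that by (intro mult_strict_right_mono) auto
    thus ?thesis using that by (simp add: divide_less_eq less_divide_eq mult_ac)
  qed
  have "(1 - t\<^sup>2) * (t * p) / ((1 + t * (t * p)) * (1 + t * (t * (t * p)))) < (1 - t\<^sup>2) * p / ((1 + t * p) * (1 + t * (t * p)))"
    by (rule frac[OF le q(2,1,3)])
  thus ?thesis unfolding dg_eq by (simp add: p_def numeral_3_eq_3)
qed

lemma dg_strict_antimono: "i < j \<Longrightarrow> dg j < dg i"
  by (rule lift_Suc_mono_less[of "\<lambda>n. - dg n" i j, simplified]) (use dg_Suc_less in auto)

lemma g_diff: "g (p + d) - g p = (\<Sum>i<d. dg (p + i))"
  by (induction d) (auto simp: dg_def)

text \<open>The exchange form of concavity: of two pairs of lengths with the same sum, the more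
  unequal one has the smaller sum of \<open>g\<close>.\<close>

lemma g_concave:
  assumes "0 < d" "0 < e"
  shows "g p + g (p + d + e) < g (p + d) + g (p + e)"
proof -
  have "(\<Sum>i<d. dg (p + e + i)) < (\<Sum>i<d. dg (p + i))"
    using assms by (intro sum_strict_mono dg_strict_antimono) auto
  hence "g (p + e + d) - g (p + e) < g (p + d) - g p" unfolding g_diff .
  thus ?thesis by (simp add: add_ac)
qed

text \<open>The sum of g over parts of size s and one smaller part, with total T.\<close>

definition G :: "nat \<Rightarrow> nat \<Rightarrow> real" where
  "G s T = real (T div s) * g s + g (T mod s)"

text \<open>The remainder r = \<open>T mod s\<close> and the new part \<open>b\<close> are replaced
  by the most unequal pair with the same sum and entries between 0 and \<open>s\<close>: either r +
  b and 0, or s and r + b - s. By concavity this is a strict improvement if both r and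
  \<open>b\<close> lie strictly between 0 and \<open>s\<close>.\<close>

lemma G_add:
  assumes s: "1 \<le> s" and b: "1 \<le> b" "b \<le> s"
  shows "G s (T + b) \<le> G s T + g b" and "T mod s \<noteq> 0 \<Longrightarrow> b < s \<Longrightarrow> G s (T + b) < G s T + g b"
proof -
  define q r where "q = T div s" and "r = T mod s"
  have T: "T = q * s + r" "r < s" using s by (auto simp: q_def r_def)
  have GT: "G s T = real q * g s + g r" by (simp add: G_def q_def r_def)
  show "G s (T + b) < G s T + g b" if nz: "T mod s \<noteq> 0" and bs: "b < s"
  proof (cases "r + b < s")
    case True
    hence "G s (T + b) = real q * g s + g (r + b)" using s by (simp add: G_def T add.assoc)
    moreover have "g (r + b) < g r + g b" using g_concave[of r b 0] nz b by (simp add: r_def)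
    ultimately show ?thesis using GT by simp
  next
    case False
    define p where "p = r + b - s"
    have p: "r + b = s + p" "p < s" using False T bs by (auto simp: p_def)
    have "T + b = (q + 1) * s + p" using p T by (simp add: algebra_simps)
    hence "G s (T + b) = real (q + 1) * g s + g p" using p s by (simp add: G_def del: mult_Suc)
    moreover have "g p + g (p + (s - b) + (s - r)) < g (p + (s - b)) + g (p + (s - r))"
      using bs T by (intro g_concave) auto
    moreover have "p + (s - b) + (s - r) = s" "p + (s - b) = r" "p + (s - r) = b" using p bs T by auto
    ultimately show ?thesis using GT by (simp add: algebra_simps)
  qed
  note strict = this
  show "G s (T + b) \<le> G s T + g b"
  proof (cases "b = s")
    case True
    thus ?thesis using s by (simp add: G_def algebra_simps)
  next
    case bs: False
    show ?thesis
    proof (cases "r = 0")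
      case True
      hence "G s (T + b) = real q * g s + g b" using s bs b by (simp add: G_def T)
      thus ?thesis using GT True by simp
    next
      case False
      thus ?thesis using strict bs b by (simp add: r_def less_imp_le)
    qed
  qed
qed

end

definition block_parts :: "nat \<Rightarrow> nat \<Rightarrow> nat multiset" where
  "block_parts s T = replicate_mset (T div s) s + (if T mod s = 0 then {#} else {# T mod s #})"

context path_resolvent begin

lemma sum_g_block_parts: "(\<Sum>m\<in>#block_parts s T. g m) = G s T"
  by (auto simp: block_parts_def G_def image_replicate_mset sum_mset_replicate_mset)

text \<open>Parts are added one at a time by \<open>G_add\<close>. In the case of equality no step
  is strict, so each new part either equals \<open>s\<close> or meets the remainder 0, and the
  multiset keeps its block form.\<close>

lemma G_le:
  assumes s: "1 \<le> s"
  shows "(\<forall>m\<in>#M. 1 \<le> m \<and> m \<le> s) \<Longrightarrow> G s (sum_mset M) \<le> (\<Sum>m\<in>#M. g m) \<and>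
     (G s (sum_mset M) = (\<Sum>m\<in>#M. g m) \<longrightarrow> M = block_parts s (sum_mset M))"
proof (induction M)
  case empty
  show ?case by (simp add: G_def block_parts_def)
next
  case (add b M)
  let ?T = "sum_mset M"
  have b: "1 \<le> b" "b \<le> s" and IH: "G s ?T \<le> (\<Sum>m\<in>#M. g m)" "G s ?T = (\<Sum>m\<in>#M. g m) \<Longrightarrow> M = block_parts s ?T"
    using add by auto
  have le: "G s (?T + b) \<le> G s ?T + g b" by (rule G_add(1)[OF s b])
  show ?case
  proof (intro conjI impI)
    show "G s (sum_mset (add_mset b M)) \<le> (\<Sum>m\<in>#add_mset b M. g m)" using le IH by (simp add: add.commute)
    assume "G s (sum_mset (add_mset b M)) = (\<Sum>m\<in>#add_mset b M. g m)"
    hence eq: "G s (?T + b) = (\<Sum>m\<in>#M. g m) + g b" by (simp add: add.commute)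
    hence M: "M = block_parts s ?T" and ns: "\<not> G s (?T + b) < G s ?T + g b" using le IH by auto
    have c: "?T mod s = 0 \<or> b = s"
    proof (rule ccontr)
      assume "\<not> ?thesis"
      hence "?T mod s \<noteq> 0" "b < s" using b by auto
      from G_add(2)[OF s b this] ns show False by simp
    qed
    have "add_mset b (block_parts s ?T) = block_parts s (?T + b)"
    proof (cases "b = s")
      case True
      thus ?thesis using s by (simp add: block_parts_def)
    next
      case False
      hence m0: "?T mod s = 0" and "b < s" using c b by auto
      have "(?T + b) div s = ?T div s" "(?T + b) mod s = b"
        using m0 \<open>b < s\<close> by (auto simp: mod_eq_0_iff_dvd elim!: dvdE) 
      thus ?thesis using m0 b by (simp add: block_parts_def)
    qed
    moreover have "add_mset b M = add_mset b (block_parts s ?T)" using M by (rule arg_cong)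
    moreover have "sum_mset (add_mset b M) = ?T + b" by (simp add: add.commute)
    ultimately show "add_mset b M = block_parts s (sum_mset (add_mset b M))" by metis
  qed
qed

text \<open>If the largest part is at most n1, concavity suffices. A larger first part forces all other parts to be
  at most s - 1, which increases the number of parts too much; only this case needs N to be large.\<close>

lemma parts_extremal:
  assumes s: "1 \<le> s" and n1: "n1 = s \<or> n1 = s + 1"
    and pos: "\<forall>m\<in>#M. 1 \<le> m"
    and pair: "\<And>a b. {#a, b#} \<subseteq># M \<Longrightarrow> a + b \<le> n1 + s"
    and lt: "\<forall>m\<in>#M. m < N"
    and N: "sum_mset M = N" "19 * (real s)\<^sup>2 \<le> real N" "2 * s + 2 \<le> N" and ts: "4 * t * real s \<le> 1"
  defines "H \<equiv> add_mset n1 (block_parts s (N - n1))"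
  shows "(\<Sum>m\<in>#H. g m) \<le> (\<Sum>m\<in>#M. g m)" and "(\<Sum>m\<in>#H. g m) = (\<Sum>m\<in>#M. g m) \<Longrightarrow> M = H"
proof -
  have "M \<noteq> {#}" using N by auto
  define m1 where "m1 = Max_mset M"
  have m1: "m1 \<in># M" and mx: "\<And>m. m \<in># M \<Longrightarrow> m \<le> m1" using \<open>M \<noteq> {#}\<close> by (auto simp: m1_def)
  define M' where "M' = M - {#m1#}"
  have M: "M = add_mset m1 M'" using m1 by (simp add: M'_def)
  have oth: "m + m1 \<le> n1 + s" if "m \<in># M'" for m
    using pair[of m1 m] that by (simp add: M)
  have sumM': "sum_mset M' = N - m1" using N(1) by (simp add: M)
  have HG: "(\<Sum>m\<in>#H. g m) = g n1 + G s (N - n1)" by (simp add: H_def sum_g_block_parts)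
  have "(\<Sum>m\<in>#H. g m) \<le> (\<Sum>m\<in>#M. g m) \<and> ((\<Sum>m\<in>#H. g m) = (\<Sum>m\<in>#M. g m) \<longrightarrow> M = H)"
  proof (cases "m1 \<le> n1")
    case le: True
    consider "m1 = n1" "n1 = s + 1" | "m1 \<le> s" using n1 le by linarith
    thus ?thesis
    proof cases
      case 1
      have "\<forall>m\<in>#M'. 1 \<le> m \<and> m \<le> s" using oth pos 1 by (fastforce simp: M)
      from G_le[OF s this] show ?thesis using 1 unfolding HG sumM' by (auto simp: M H_def)
    next
      case 2
      have "\<forall>m\<in>#M. 1 \<le> m \<and> m \<le> s" using mx pos 2 by fastforce
      note GM = G_le[OF s this, unfolded N(1)]
      show ?thesis
      proof (cases "n1 = s")
        case True
        have N_eq: "N = (N - s) + s" using N by simp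
        have "G s N = G s (N - s) + g s" by (subst N_eq) (use s in \<open>simp add: G_def algebra_simps\<close>)
        moreover have "block_parts s N = add_mset s (block_parts s (N - s))" by (subst N_eq) (use s in \<open>simp add: block_parts_def\<close>)
        ultimately have "(\<Sum>m\<in>#H. g m) = G s N" "block_parts s N = H" unfolding HG unfolding H_def True by simp_all
        thus ?thesis using GM by auto
      next
        case False
        hence n1: "n1 = s + 1" using n1 by simp
        define T where "T = N - n1"
        have NT: "N = (T + s) + 1" using N n1 by (simp add: T_def)
        define q r where "q = T div s" and "r = T mod s"
        have T: "T = q * s + r" "r < s" using s by (auto simp: q_def r_def)
        \<comment> \<open>Exchanging a part \<open>s\<close> and the remainder r + 1 for s + 1 and r
          makes the pair more unequal; so blocks of size \<open>s\<close> alone are not optimal when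
          n1 = s + 1.\<close>
        have "g n1 + G s T < G s N"
        proof -
          have c: "g r + g (r + 1 + (s - r)) < g (r + 1) + g (r + (s - r))"
            using T by (intro g_concave) auto
          have GT: "G s T = real q * g s + g r" by (simp add: G_def q_def r_def)
          have "G s N = real (q + 1) * g s + g (r + 1)"
          proof (cases "r + 1 = s")
            case True
            have "N = (q + 2) * s" using NT T True by simp
            thus ?thesis using True s by (simp add: G_def algebra_simps del: mult_Suc add_mult_distrib)
          next
            case False
            have "N = (q + 1) * s + (r + 1)" using NT T by simp
            thus ?thesis using False T s by (simp add: G_def del: mult_Suc add_Suc_right)
          qed
          thus ?thesis using c GT T n1 by (simp add: algebra_simps)
        qed
        thus ?thesis using GM unfolding HG T_def by auto
      qed
    qed
  next
    case False
    have "M' \<noteq> {#}"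
    proof
      assume "M' = {#}"
      hence "N = m1" using M N(1) by simp
      thus False using bspec[OF lt m1] by simp
    qed
    then obtain m where m: "m \<in># M'" by auto
    have m1_le: "m1 \<le> 2 * s" using oth[OF m] pos m n1 by (fastforce simp: M)
    have M'_le: "\<forall>m\<in>#M'. m \<le> s - 1" using oth False by fastforce
    have s2: "2 \<le> s" using M'_le m pos by (fastforce simp: M)
    have "sum_mset A \<le> size A * c" if "\<forall>m\<in>#A. m \<le> c" for A and c :: nat
      using that by (induction A) auto
    from this[OF M'_le] have NM': "N - m1 \<le> size M' * (s - 1)" by (simp add: sumM')
    define S z where "S = real s" and "z = real (size M')"
    have S: "S \<ge> 2" using s2 by (simp add: S_def)
    have "real (N - m1) \<le> real (size M' * (s - 1))" using NM' by (rule of_nat_mono)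
    moreover have "m1 < N" using lt m1 by simp
    ultimately have Nz: "real N - real m1 \<le> (S - 1) * z" using s2 by (simp add: S_def z_def of_nat_diff mult.commute)
    have "real (size A) * (1 - 2 * t) \<le> (\<Sum>m\<in>#A. g m)" if "\<forall>m\<in>#A. 1 \<le> m" for A
      using that
    proof (induction A)
      case (add x A)
      thus ?case using g_ge[of x] by (simp add: distrib_right)
    qed simp
    from this[OF pos] have lo: "(1 + z) * (1 - 2 * t) \<le> (\<Sum>m\<in>#M. g m)" by (simp add: M z_def)
    have n1N: "n1 \<le> N" "real n1 \<ge> S" using n1 N(3) by (auto simp: S_def)
    have "(\<Sum>m\<in>#H. g m) \<le> 1 + (real ((N - n1) div s) * 1 + 1)"
      unfolding HG G_def using g_lt_1 by (intro add_mono mult_left_mono) (auto intro: less_imp_le)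
    also have "real ((N - n1) div s) \<le> (real N - real n1) / S"
      using of_nat_div_le_of_nat[of "N - n1" s, where ?'a = real] n1N by (simp add: S_def of_nat_diff)
    finally have hi: "(\<Sum>m\<in>#H. g m) \<le> 2 + (real N - real n1) / S" by simp
    have zp: "z \<ge> 0" by (simp add: z_def)
    \<comment> \<open>Since (2 S + 1) (S - 1) = 2 S^2 - S - 1, this multiplier produces the
      coefficient 2 S^2 - S of \<open>z\<close> in \<open>key\<close>.\<close>
    have "(2 * S + 1) * (real N - real m1) \<le> (2 * S + 1) * ((S - 1) * z)" using Nz S by (intro mult_left_mono) auto
    also have "\<dots> = (2 * S\<^sup>2 - S) * z - z" by (simp add: power2_eq_square algebra_simps)
    finally have z1: "(2 * S + 1) * (real N - real m1) \<le> (2 * S\<^sup>2 - S) * z" using zp by linarith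
    have m1S: "(2 * S + 1) * real m1 \<le> (2 * S + 1) * (2 * S)" using m1_le S by (intro mult_left_mono) (auto simp: S_def)
    have n1S: "2 * S * S \<le> 2 * S * real n1" using n1N S by (intro mult_left_mono) auto
    have SS: "2 * S \<le> S * S" using S by (intro mult_right_mono) auto
    have N19: "19 * (S * S) \<le> real N" using N(2) by (simp add: S_def power2_eq_square)
    \<comment> \<open>States that the bound in \<open>hi\<close> lies below the one in
      \<open>lo\<close>, multiplied by 2 S^2 and with 1 - 2 t replaced by its lower bound 1 - 1 / (2
      S). It comes down to 4 S^2 + 3 S < N.\<close>
    have key: "4 * S\<^sup>2 + 2 * S * (real N - real n1) < (2 * S\<^sup>2 - S) * (1 + z)"
    proof -
      have "2 * (S * real m1) + real m1 \<le> 4 * (S * S) + 2 * S" using m1S by (simp add: algebra_simps)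
      moreover have "2 * (S * S) \<le> 2 * (S * real n1)" using n1S by (simp only: mult.assoc)
      ultimately have "4 * (S * S) + 2 * (S * real N) - 2 * (S * real n1) < 2 * (S * S) - S + (2 * (S * real N) + real N - (2 * (S * real m1) + real m1))"
        using N19 SS S by linarith
      also have "\<dots> = 2 * (S * S) - S + (2 * S + 1) * (real N - real m1)" by (simp add: algebra_simps)
      also have "\<dots> \<le> 2 * (S * S) - S + (2 * S\<^sup>2 - S) * z" using z1 by simp
      finally show ?thesis by (simp add: power2_eq_square algebra_simps)
    qed
    have "2 + (real N - real n1) / S = (4 * S\<^sup>2 + 2 * S * (real N - real n1)) / (2 * S\<^sup>2)"
      using S by (simp add: field_simps power2_eq_square)
    also have "\<dots> < (2 * S\<^sup>2 - S) * (1 + z) / (2 * S\<^sup>2)" using key S by (intro divide_strict_right_mono) auto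
    also have "\<dots> = (1 + z) * (1 - 1 / (2 * S))" using S by (simp add: field_simps power2_eq_square)
    also have "\<dots> \<le> (1 + z) * (1 - 2 * t)"
    proof (rule mult_left_mono)
      have "2 * t \<le> 1 / (2 * S)" using ts S by (simp add: S_def field_simps)
      thus "1 - 1 / (2 * S) \<le> 1 - 2 * t" by simp
    qed (use zp in simp)
    finally show ?thesis using hi lo by linarith
  qed
  thus "(\<Sum>m\<in>#H. g m) \<le> (\<Sum>m\<in>#M. g m)" and "(\<Sum>m\<in>#H. g m) = (\<Sum>m\<in>#M. g m) \<Longrightarrow> M = H" by auto
qed

end

section \<open>Linear forests in theta-free graphs\<close>

lemma path_edges_nthI: "Suc i < length P \<Longrightarrow> {P ! i, P ! Suc i} \<in> path_edges P"
  unfolding path_edges_nth by auto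

lemma simple_graph_edge_subset: "simple_graph V E \<Longrightarrow> e \<in> E \<Longrightarrow> e \<subseteq> V"
  by (auto simp: simple_graph_def dest!: bspec)

lemma path_edges_interior:
  assumes "distinct P" "path_edges P \<subseteq> F" "simple_graph R F" "card (nb F (P ! i)) \<le> 2" "0 < i" "Suc i < length P"
  shows "nb F (P ! i) = {P ! (i - 1), P ! Suc i}"
proof -
  have "{P ! (i - 1), P ! i} \<in> path_edges P" "{P ! i, P ! Suc i} \<in> path_edges P"
    using path_edges_nthI[of "i - 1" P] path_edges_nthI[of i P] assms(5,6) by auto
  hence "{P ! (i - 1), P ! Suc i} \<subseteq> nb F (P ! i)" using assms(2) by (auto simp: insert_commute)
  moreover have "card {P ! (i - 1), P ! Suc i} = 2" using assms by (simp add: nth_eq_iff_index_eq)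
  ultimately show ?thesis using card_seteq[OF finite_nb[OF assms(3)], of "{P ! (i - 1), P ! Suc i}" "P ! i"] assms(4) by simp
qed

text \<open>By maximality a neighbour \<open>b\<close> of the first vertex lies on the path. At an
  interior position beyond the second it would have three neighbours, and at the far end it would
  close a cycle; so it is the second vertex.\<close>

lemma maximal_path_endpoint:
  assumes s: "simple_graph R F" and deg: "\<And>z. card (nb F z) \<le> 2"
    and nocyc: "\<And>vs. length vs \<ge> 3 \<Longrightarrow> distinct vs \<Longrightarrow> path_edges vs \<subseteq> F \<Longrightarrow> {last vs, hd vs} \<notin> F"
    and P: "P \<noteq> []" "distinct P" "path_edges P \<subseteq> F"
    and mx: "\<And>z. {z, hd P} \<in> F \<Longrightarrow> z \<in> set P"
    and b: "{hd P, b} \<in> F"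
  shows "{hd P, b} \<in> path_edges P"
proof -
  have "b \<in> set P" using mx b by (simp add: insert_commute)
  then obtain j where j: "j < length P" "b = P ! j" by (auto simp: in_set_conv_nth)
  have h: "hd P = P ! 0" using P by (simp add: hd_conv_nth)
  have "hd P \<noteq> b" using simple_graph_edge[OF s b] by simp
  hence "j \<noteq> 0" using j(2) h by metis
  consider "j = 1" | "1 < j" "Suc j < length P" | "1 < j" "Suc j = length P" using \<open>j \<noteq> 0\<close> j by linarith
  thus ?thesis
  proof cases
    case 1
    thus ?thesis using j h unfolding path_edges_nth by (auto intro!: exI[of _ 0])
  next
    case 2
    have "nb F (P ! j) = {P ! (j - 1), P ! Suc j}" by (rule path_edges_interior[OF P(2,3) s deg]) (use 2 in auto)
    moreover have "P ! 0 \<in> nb F (P ! j)" using b j h by (simp add: insert_commute)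
    ultimately have "P ! 0 = P ! (j - 1) \<or> P ! 0 = P ! Suc j" by auto
    moreover have "P ! 0 \<noteq> P ! (j - 1)" "P ! 0 \<noteq> P ! Suc j"
      using nth_eq_iff_index_eq[OF P(2), of 0 "j - 1"] nth_eq_iff_index_eq[OF P(2), of 0 "Suc j"] 2 P(1)
        less_trans[OF lessI 2(2)] by (auto simp: less_imp_diff_less)
    ultimately show ?thesis by blast
  next
    case 3
    have "j = length P - 1" using 3 by simp
    hence "last P = b" using j P(1) by (simp add: last_conv_nth)
    hence "{last P, hd P} \<in> F" using b by (simp add: insert_commute)
    thus ?thesis using nocyc[of P] P 3 by auto
  qed
qed

text \<open>A longest path is a whole component, since maximality, the degree bound and the absence
  of cycles leave no further edge at its vertices. It is removed, and induction decomposes the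
  rest.\<close>

lemma linear_forest_decomposition:
  assumes "simple_graph R F" "\<And>z. card (nb F z) \<le> 2"
    "\<And>vs. length vs \<ge> 3 \<Longrightarrow> distinct vs \<Longrightarrow> path_edges vs \<subseteq> F \<Longrightarrow> {last vs, hd vs} \<notin> F"
  shows "\<exists>vss. distinct (concat vss) \<and> [] \<notin> set vss \<and> set (concat vss) = R \<and> lf_F vss = F"
  using assms
proof (induction "card R" arbitrary: R F rule: less_induct)
  case less
  note s = less.prems(1) and deg = less.prems(2) and nocyc = less.prems(3)
  have fin: "finite R" using s by (simp add: simple_graph_def)
  show ?case
  proof (cases "R = {}")
    case True
    hence "F = {}" using s by (auto simp: simple_graph_def)
    thus ?thesis using True by (intro exI[of _ "[]"]) (auto simp: lf_F_def)
  next
    case False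
    then obtain r where r: "r \<in> R" by auto
    define PP where "PP = {vs. distinct vs \<and> set vs \<subseteq> R \<and> path_edges vs \<subseteq> F \<and> vs \<noteq> []}"
    have "PP \<subseteq> {vs. set vs \<subseteq> R \<and> length vs \<le> card R}"
      unfolding PP_def using fin by (auto simp: distinct_card[symmetric] intro: card_mono)
    hence finPP: "finite PP" using finite_lists_length_le[OF fin] finite_subset by blast
    have "[r] \<in> PP" using r by (simp add: PP_def)
    hence "Max (length ` PP) \<in> length ` PP" using finPP by (intro Max_in) auto
    then obtain P where P: "P \<in> PP" "Max (length ` PP) = length P" by auto
    have mx: "length Q \<le> length P" if "Q \<in> PP" for Q
      unfolding P(2)[symmetric] using that finPP by (intro Max_ge) auto
    have P': "P \<noteq> []" "distinct P" "set P \<subseteq> R" "path_edges P \<subseteq> F" using P by (auto simp: PP_def)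
    \<comment> \<open>Stated for every path of maximal length because both \<open>P\<close> and
      \<open>rev P\<close> are needed, one for each end.\<close>
    have mxh: "z \<in> set Q" if Q: "Q \<in> PP" "length Q = length P" and z: "{z, hd Q} \<in> F" for z Q
    proof (rule ccontr)
      assume "z \<notin> set Q"
      moreover have "z \<in> R" using simple_graph_edge[OF s z] by simp
      ultimately have "z # Q \<in> PP" using Q z by (auto simp: PP_def path_edges_Cons)
      from mx[OF this] show False using Q(2) by simp
    qed
    have revP: "rev P \<in> PP" using P by (auto simp: PP_def)
    have closed: "{a, b} \<in> path_edges P" if ab: "{a, b} \<in> F" "a \<in> set P" for a b
    proof -
      obtain i where i: "i < length P" "a = P ! i" using ab by (auto simp: in_set_conv_nth)
      consider "i = 0" | "0 < i" "Suc i < length P" | "Suc i = length P" using i by linarith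
      thus ?thesis
      proof cases
        case 1
        hence "a = hd P" using i P' by (simp add: hd_conv_nth)
        thus ?thesis using maximal_path_endpoint[OF s deg nocyc P'(1,2,4) mxh[OF P(1)]] ab by auto
      next
        case 2
        have "nb F a = {P ! (i - 1), P ! Suc i}" unfolding i(2)
          by (rule path_edges_interior[OF P'(2,4) s deg]) (use 2 in auto)
        moreover have "b \<in> nb F a" using ab by simp
        ultimately have "b = P ! (i - 1) \<or> b = P ! Suc i" by blast
        thus ?thesis using i 2 path_edges_nthI[of "i - 1" P] path_edges_nthI[of i P] by (auto simp: insert_commute)
      next
        case 3
        hence "i = length P - 1" by simp
        hence "a = last P" using i P'(1) by (simp add: last_conv_nth)
        hence "a = hd (rev P)" by (simp add: hd_rev)
        have "{hd (rev P), b} \<in> path_edges (rev P)"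
        proof (rule maximal_path_endpoint[OF s deg nocyc])
          show "rev P \<noteq> []" "distinct (rev P)" "path_edges (rev P) \<subseteq> F" using P' by auto
          show "z \<in> set (rev P)" if "{z, hd (rev P)} \<in> F" for z using mxh[OF revP _ that] by simp
          show "{hd (rev P), b} \<in> F" using ab \<open>a = hd (rev P)\<close> by simp
        qed auto
        thus ?thesis using \<open>a = hd (rev P)\<close> by simp
      qed
    qed
    define R' F' where "R' = R - set P" and "F' = {e \<in> F. e \<inter> set P = {}}"
    have F_eq: "F = path_edges P \<union> F'"
    proof
      show "F \<subseteq> path_edges P \<union> F'"
      proof
        fix e assume e: "e \<in> F"
        then obtain a b where ab: "e = {a, b}" using s unfolding simple_graph_def by blast
        have "e = {b, a}" using ab by auto
        thus "e \<in> path_edges P \<union> F'" using e ab closed[of a b] closed[of b a] by (auto simp: F'_def)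
      qed
    qed (use P' in \<open>auto simp: F'_def\<close>)
    have s': "simple_graph R' F'"
    proof (rule simple_graph_subset[OF s])
      show "F' \<subseteq> F" by (auto simp: F'_def)
      show "\<Union>F' \<subseteq> R'" using simple_graph_edge_subset[OF s] unfolding F'_def R'_def by blast
    qed (use fin in \<open>auto simp: R'_def\<close>)
    have nbF': "nb F' z \<subseteq> nb F z" for z by (auto simp: F'_def)
    have "card R' < card R" unfolding R'_def using P' fin by (intro psubset_card_mono) (auto simp: psubset_eq neq_Nil_conv)
    moreover have "card (nb F' z) \<le> 2" for z
      using deg[of z] card_mono[OF finite_nb[OF s] nbF', of z] by simp
    moreover have "{last vs, hd vs} \<notin> F'" if "length vs \<ge> 3" "distinct vs" "path_edges vs \<subseteq> F'" for vs
      using nocyc[of vs] that by (auto simp: F'_def)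
    ultimately obtain vss where vss: "distinct (concat vss)" "[] \<notin> set vss" "set (concat vss) = R'" "lf_F vss = F'"
      using less.hyps[of R' F'] s' by blast
    show ?thesis
    proof (intro exI[of _ "P # vss"] conjI)
      show "distinct (concat (P # vss))" using vss P' by (auto simp: R'_def)
      show "[] \<notin> set (P # vss)" using vss P' by auto
      show "set (concat (P # vss)) = R" using vss P' by (auto simp: R'_def)
      show "lf_F (P # vss) = F" using vss F_eq by (simp add: lf_F_def)
    qed
  qed
qed

section \<open>Theta graphs and minors from paths and cycles next to \<open>u\<close> and
  \<open>v\<close>\<close>

lemma contains_thetaI:
  assumes "length vs = k" "k \<ge> 4" "distinct vs" "set vs \<subseteq> V" "path_edges vs \<subseteq> E" "{last vs, hd vs} \<in> E" "{vs ! 0, vs ! 2} \<in> E"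
  shows "contains_theta k V E"
  unfolding contains_theta_def
proof (intro exI[of _ vs] conjI allI impI)
  fix i assume i: "i < k"
  show "{vs ! i, vs ! ((i + 1) mod k)} \<in> E"
  proof (cases "i + 1 < k")
    case True
    hence "{vs ! i, vs ! (i + 1)} \<in> path_edges vs" unfolding path_edges_nth using assms(1) by auto
    thus ?thesis using True assms(5) by auto
  next
    case False
    hence "i + 1 = k" using i by simp
    hence "i = length vs - 1" "(i + 1) mod k = 0" "vs \<noteq> []" using assms(1) by auto
    thus ?thesis using assms(6) by (simp add: last_conv_nth hd_conv_nth)
  qed
next
  show "\<exists>i<k. \<exists>j<k. i \<noteq> j \<and> j \<noteq> (i + 1) mod k \<and> i \<noteq> (j + 1) mod k \<and> {vs ! i, vs ! j} \<in> E"
  proof (rule exI[of _ 0], intro conjI, use assms(2) in simp, rule exI[of _ 2])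
    show "2 < k \<and> 0 \<noteq> (2::nat) \<and> 2 \<noteq> (0 + 1) mod k \<and> 0 \<noteq> (2 + 1) mod k \<and> {vs ! 0, vs ! 2} \<in> E"
      using assms(2,7) by simp
  qed
qed (use assms in auto)

lemma path_edges_take: "path_edges (take m vs) \<subseteq> path_edges vs"
  using path_edges_append[of "take m vs" "drop m vs"] by auto

text \<open>The cycle through \<open>u\<close> and the first k - 1 vertices of the path has the
  chord from \<open>u\<close> to the second of these vertices.\<close>

lemma theta_of_long_path:
  assumes k: "k \<ge> 5" and P: "distinct P" "length P \<ge> k - 1" "path_edges P \<subseteq> E" "set P \<subseteq> nb E u" "u \<notin> set P" "insert u (set P) \<subseteq> V"
  shows "contains_theta k V E"
proof (rule contains_thetaI[of "u # take (k - 1) P"])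
  let ?Q = "take (k - 1) P"
  have Q: "?Q \<noteq> []" "length ?Q = k - 1" "set ?Q \<subseteq> set P" using P k by (auto simp: set_take_subset)
  show "length (u # ?Q) = k" using Q k by simp
  show "distinct (u # ?Q)" using P Q by auto
  show "set (u # ?Q) \<subseteq> V" using P Q by auto
  have hl: "hd ?Q \<in> set P" "last ?Q \<in> set P" "?Q ! 1 \<in> set P"
    using Q k hd_in_set[OF Q(1)] last_in_set[OF Q(1)] nth_mem[of 1 ?Q] by auto
  have ue: "{u, hd ?Q} \<in> E" "{u, last ?Q} \<in> E" "{u, ?Q ! 1} \<in> E" using hl P(4) unfolding nb_def by blast+
  show "path_edges (u # ?Q) \<subseteq> E"
    unfolding path_edges_Cons using ue(1) path_edges_take[of "k - 1" P] P(3) Q(1) by (simp only: if_False) blast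
  show "{last (u # ?Q), hd (u # ?Q)} \<in> E" unfolding last_ConsR[OF Q(1)] list.sel using ue(2) by (simp only: insert_commute)
  show "{(u # ?Q) ! 0, (u # ?Q) ! 2} \<in> E" using ue(3) by (simp add: numeral_2_eq_2)
qed (use k in auto)

text \<open>The cycle runs through \<open>u\<close>, a piece of \<open>P\<close>, \<open>v\<close>
  and a piece of \<open>Q\<close>; the chord joins \<open>u\<close> to the second vertex of the
  piece of \<open>P\<close>.\<close>

lemma theta_of_two_paths:
  assumes k: "k \<ge> 5" and P: "distinct P" "path_edges P \<subseteq> E" "set P \<subseteq> nb E u \<inter> nb E v"
    and Q: "distinct Q" "path_edges Q \<subseteq> E" "set Q \<subseteq> nb E u \<inter> nb E v" "set P \<inter> set Q = {}"
    and len: "length P \<ge> 2" "length Q \<ge> 1" "k - 2 \<le> length P + length Q"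
    and uv: "u \<noteq> v" "{u, v} \<inter> (set P \<union> set Q) = {}" "{u, v} \<union> set P \<union> set Q \<subseteq> V"
  shows "contains_theta k V E"
proof -
  \<comment> \<open>At most k - 4 vertices are taken from \<open>Q\<close>, so at least two remain
    for \<open>P\<close>, as the chord demands.\<close>
  define b where "b = min (length Q) (k - 4)"
  define a where "a = k - 2 - b"
  have ab: "a \<ge> 2" "b \<ge> 1" "a \<le> length P" "b \<le> length Q" "a + b = k - 2" using len k by (auto simp: a_def b_def)
  define P' Q' where "P' = take a P" and "Q' = take b Q"
  have P': "P' \<noteq> []" "length P' = a" "set P' \<subseteq> set P" "path_edges P' \<subseteq> E" "distinct P'"
    using ab P path_edges_take[of a P] by (auto simp: P'_def set_take_subset)
  have Q': "Q' \<noteq> []" "length Q' = b" "set Q' \<subseteq> set Q" "path_edges Q' \<subseteq> E" "distinct Q'"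
    using ab Q path_edges_take[of b Q] by (auto simp: Q'_def set_take_subset)
  have PE: "{u, z} \<in> E \<and> {v, z} \<in> E" if "z \<in> set P'" for z using that P' P by auto
  have QE: "{u, z} \<in> E \<and> {v, z} \<in> E" if "z \<in> set Q'" for z using that Q' Q by auto
  note hl = PE[OF hd_in_set[OF P'(1)]] PE[OF last_in_set[OF P'(1)]] QE[OF hd_in_set[OF Q'(1)]] QE[OF last_in_set[OF Q'(1)]]
  show ?thesis
  proof (rule contains_thetaI[of "u # P' @ v # Q'"])
    show "length (u # P' @ v # Q') = k" using P' Q' ab k by simp
    show "distinct (u # P' @ v # Q')" using P' Q' uv Q(4) by auto
    show "set (u # P' @ v # Q') \<subseteq> V" using P' Q' uv by auto
    show "path_edges (u # P' @ v # Q') \<subseteq> E"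
      using P' Q' hl by (auto simp: path_edges_Cons path_edges_append insert_commute)
    show "{last (u # P' @ v # Q'), hd (u # P' @ v # Q')} \<in> E" using Q' hl by (auto simp: insert_commute)
    have "P' ! 1 \<in> set P'" using P' ab by (intro nth_mem) auto
    thus "{(u # P' @ v # Q') ! 0, (u # P' @ v # Q') ! 2} \<in> E" using PE P' ab by (simp add: nth_append numeral_2_eq_2)
  qed (use k in auto)
qed

lemma connected_in_path_set: "path_edges vs \<subseteq> E \<Longrightarrow> connected_in E (set vs)"
proof (induction vs)
  case (Cons x vs)
  show ?case
  proof (cases "vs = []")
    case False
    let ?r = "{(a, b). a \<in> set (x # vs) \<and> b \<in> set (x # vs) \<and> {a, b} \<in> E}"
    have e: "(x, hd vs) \<in> ?r" "(hd vs, x) \<in> ?r" using Cons.prems False by (auto simp: path_edges_Cons insert_commute)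
    have "connected_in E (set vs)" using Cons False by (simp add: path_edges_Cons)
    moreover have "{(a, b). a \<in> set vs \<and> b \<in> set vs \<and> {a, b} \<in> E}\<^sup>* \<subseteq> ?r\<^sup>*" by (rule rtrancl_mono) auto
    ultimately have c: "(a, b) \<in> ?r\<^sup>*" if "a \<in> set vs" "b \<in> set vs" for a b
      using that unfolding connected_in_def by blast
    have h: "hd vs \<in> set vs" using False by simp
    have 1: "(x, b) \<in> ?r\<^sup>*" if "b \<in> set vs" for b using c[OF h that] e(1) by (rule converse_rtrancl_into_rtrancl[rotated])
    have 2: "(b, x) \<in> ?r\<^sup>*" if "b \<in> set vs" for b using c[OF that h] e(2) by (rule rtrancl_into_rtrancl)
    show ?thesis unfolding connected_in_def using c 1 2 by auto
  qed simp
qed (simp add: connected_in_def)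

lemma K33_minor_of_wheel:
  assumes "distinct (u # v # w # a # b # c # ws)" "ws \<noteq> []"
    "path_edges (a # b # c # ws) \<subseteq> E" "{last ws, a} \<in> E"
    "\<And>z. z \<in> {w, a, b, c} \<union> set ws \<Longrightarrow> {u, z} \<in> E \<and> {v, z} \<in> E"
  shows "K33_minor E"
proof -
  \<comment> \<open>Contracting the edge vw makes u and v adjacent, and the rest of the cycle becomes one vertex.\<close>
  define X where "X i = (if i = 0 then {u} else if i = 1 then {a} else {c})" for i :: nat
  define Y where "Y i = (if i = 0 then set [v, w] else if i = 1 then {b} else set ws)" for i :: nat
  have cons: "connected_in E (X i)" "connected_in E (Y i)" for i
  proof -
    show "connected_in E (X i)" by (simp add: X_def)
    have "connected_in E (set [v, w])" by (rule connected_in_path_set) (use assms(5) in simp)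
    moreover have "connected_in E (set ws)" by (rule connected_in_path_set) (use assms(2,3) in \<open>auto simp: path_edges_Cons\<close>)
    ultimately show "connected_in E (Y i)" by (simp add: Y_def)
  qed
  have dis: "X i \<inter> Y j = {}" for i j using assms(1) by (auto simp: X_def Y_def)
  have disX: "X i \<inter> X j = {}" "Y i \<inter> Y j = {}" if "i < 3" "j < 3" "i \<noteq> j" for i j
    using assms(1) that by (auto simp: X_def Y_def)
  have pe: "{a, b} \<in> E" "{b, c} \<in> E" "{c, hd ws} \<in> E" using assms(2,3) by (auto simp: path_edges_Cons)
  have hl: "hd ws \<in> set ws" "last ws \<in> set ws" using assms(2) by auto
  have ed: "\<exists>s\<in>X i. \<exists>t\<in>Y j. {s, t} \<in> E" for i j
    unfolding X_def Y_def using pe hl assms(4) assms(5)[of w] assms(5)[of a] assms(5)[of b] assms(5)[of c] assms(5)[of "hd ws"]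
    by (auto simp: insert_commute)
  show ?thesis unfolding K33_minor_def using cons dis disX ed by (intro exI[of _ X] exI[of _ Y]) auto
qed

text \<open>The test vector is the Perron vector of K(2,N), with \<open>sqrt (N / 2)\<close> at
  \<open>u\<close> and \<open>v\<close> and 1 elsewhere. The edge uv and the forest edges only
  increase the form.\<close>

lemma lf_lower_bound:
  assumes ok: "lf_ok u v vss"
  shows "2 * real (length (concat vss)) \<le> (spectral_radius (lf_V u v vss) (lf_E u v vss))\<^sup>2"
proof -
  let ?V = "lf_V u v vss" and ?E = "lf_E u v vss" and ?R = "set (concat vss)" and ?F = "lf_F vss"
  define N where "N = real (length (concat vss))"
  have cR: "real (card ?R) = N" using ok by (simp add: N_def lf_ok_def distinct_card del: set_concat)
  have un: "u \<notin> ?R" "v \<notin> ?R" "u \<noteq> v" using ok by (auto simp: lf_ok_def)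
  have fin: "finite ?V" "?V \<noteq> {}" by (auto simp: lf_V_def)
  have N0: "N \<ge> 0" by (simp add: N_def)
  define a where "a = sqrt (N / 2)"
  have a: "a \<ge> 0" "a\<^sup>2 = N / 2" using N0 by (auto simp: a_def)
  show ?thesis
  proof (cases "N = 0")
    case False
    define y where "y w = (if w \<in> {u, v} then a else 1)" for w
    have y0: "y w \<ge> 0" for w using a by (simp add: y_def)
    have yR: "y w = 1" if "w \<in> ?R" for w using that un by (auto simp: y_def)
    have sR: "(\<Sum>w\<in>?R. y w) = N" using yR cR by simp
    have au: "adjop ?V ?E y u \<ge> N" "adjop ?V ?E y v \<ge> N"
      using un sR a unfolding adjop_nb[OF simple_lf_E[OF ok]] nb_lf_E(1,2)[OF ok] by (auto simp: y_def)
    have aw: "adjop ?V ?E y w \<ge> 2 * a" if w: "w \<in> ?R" for w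
    proof -
      have "2 * a = (\<Sum>z\<in>{u, v}. y z)" using un by (simp add: y_def)
      also have "\<dots> \<le> (\<Sum>z\<in>{u, v} \<union> nb ?F w. y z)"
        using finite_nb[OF simple_lf_F[OF ok]] y0 by (intro sum_mono2) auto
      finally show ?thesis unfolding adjop_nb[OF simple_lf_E[OF ok]] nb_lf_E(3)[OF ok w] .
    qed
    have Vsum: "(\<Sum>w\<in>?V. h w) = h u + h v + (\<Sum>w\<in>?R. h w)" for h :: "'a \<Rightarrow> real"
    proof -
      have "(\<Sum>w\<in>{u, v} \<union> ?R. h w) = (\<Sum>w\<in>{u, v}. h w) + (\<Sum>w\<in>?R. h w)" using un by (intro sum.union_disjoint) auto
      thus ?thesis using un by (simp add: lf_V_def)
    qed
    have yu: "y u = a" "y v = a" by (auto simp: y_def)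
    have "4 * a * N = a * N + a * N + (\<Sum>w\<in>?R. 1 * (2 * a))" using cR by simp
    also have "\<dots> \<le> y u * adjop ?V ?E y u + y v * adjop ?V ?E y v + (\<Sum>w\<in>?R. y w * adjop ?V ?E y w)"
      unfolding yu using au aw a yR by (intro add_mono mult_left_mono sum_mono) auto
    also have "\<dots> = qform ?V ?E y" unfolding qform_def Vsum ..
    also have "\<dots> \<le> spectral_radius ?V ?E * (\<Sum>w\<in>?V. (y w)\<^sup>2)" by (rule rayleigh_le[OF fin])
    also have "(\<Sum>w\<in>?V. (y w)\<^sup>2) = 2 * N" unfolding Vsum yu using yR a cR by simp
    finally have "2 * a \<le> spectral_radius ?V ?E" using False N0 by simp
    hence "(2 * a)\<^sup>2 \<le> (spectral_radius ?V ?E)\<^sup>2" using a by (intro power_mono) auto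
    thus ?thesis using a by (simp add: power_mult_distrib N_def)
  next
    case True
    thus ?thesis unfolding N_def[symmetric] by simp
  qed
qed

section \<open>The copy of a join on consecutive natural numbers\<close>

fun blocks :: "nat \<Rightarrow> nat list \<Rightarrow> nat list list" where
  "blocks s [] = []"
| "blocks s (l # ls) = [s..<s + l] # blocks (s + l) ls"

lemma concat_blocks: "concat (blocks s ms) = [s..<s + sum_list ms]"
proof (induction ms arbitrary: s)
  case (Cons l ms)
  thus ?case using upt_add_eq_append[of s "s + l" "sum_list ms"] by (simp add: add.assoc)
qed simp

lemma length_blocks: "map length (blocks s ms) = ms"
  by (induction ms arbitrary: s) auto

lemma path_edges_upt: "path_edges [s..<s + l] = {{s + i, s + i + 1} | i. i + 1 < l}"
  unfolding path_edges_nth by force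

lemma lf_F_blocks: "lf_F (blocks s ms) = paths_edges s ms"
  by (induction ms arbitrary: s) (auto simp: lf_F_def path_edges_upt)

lemma map_nth_blocks: "map (map ((!) (xs @ concat vss @ zs))) (blocks (length xs) (map length vss)) = vss"
proof (induction vss arbitrary: xs)
  case (Cons vs vss)
  have "map ((!) (xs @ vs @ concat vss @ zs)) [length xs..<length xs + length vs] = vs"
    by (rule nth_equalityI) (auto simp: nth_append)
  thus ?case using Cons[of "xs @ vs"] by simp
qed simp

lemma path_edges_map: "path_edges (map f vs) = (`) f ` path_edges vs"
  by (induction vs rule: path_edges.induct) auto

lemma lf_E_map: "lf_E (f u) (f v) (map (map f) vss) = (`) f ` lf_E u v vss"
proof -
  have "lf_F (map (map f) vss) = (`) f ` lf_F vss"
    unfolding lf_F_def by (auto simp: path_edges_map)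
  moreover have "{{w, z} |w z. w \<in> {f u, f v} \<and> z \<in> f ` R} = (`) f ` {{w, z} |w z. w \<in> {u, v} \<and> z \<in> R}" for R
  proof (intro equalityI subsetI)
    fix e assume "e \<in> {{w, z} |w z. w \<in> {f u, f v} \<and> z \<in> f ` R}"
    then obtain w z where "e = f ` {w, z}" "w \<in> {u, v}" "z \<in> R" by auto
    thus "e \<in> (`) f ` {{w, z} |w z. w \<in> {u, v} \<and> z \<in> R}" by blast
  next
    fix e assume "e \<in> (`) f ` {{w, z} |w z. w \<in> {u, v} \<and> z \<in> R}"
    then obtain w z where "e = f ` {w, z}" "w \<in> {u, v}" "z \<in> R" by blast
    thus "e \<in> {{w, z} |w z. w \<in> {f u, f v} \<and> z \<in> f ` R}" by auto
  qed
  moreover have "set (concat (map (map f) vss)) = f ` set (concat vss)" by (auto simp: image_iff)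
  ultimately show ?thesis unfolding lf_E_def join2_def image_Un by simp
qed

lemma lf_ok_blocks: "\<forall>m\<in>set ms. 1 \<le> m \<Longrightarrow> lf_ok 0 1 (blocks 2 ms)"
proof -
  assume a: "\<forall>m\<in>set ms. 1 \<le> m"
  have "[] \<notin> set (blocks s ms)" for s using a by (induction ms arbitrary: s) (auto simp: eq_commute[of "[]"])
  moreover have "distinct (0 # 1 # [2..<2 + m])" for m :: nat by auto
  ultimately show ?thesis unfolding lf_ok_def concat_blocks by blast
qed

text \<open>The isomorphism is indexing into the list of \<open>u\<close>, \<open>v\<close> and the
  concatenated paths: the number of a vertex is its position there.\<close>

lemma graph_iso_blocks:
  assumes ok: "lf_ok u v vss"
  shows "graph_iso (lf_V 0 1 (blocks 2 (map length vss))) (lf_E 0 1 (blocks 2 (map length vss))) (lf_V u v vss) (lf_E u v vss)"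
proof -
  define L where "L = [u, v] @ concat vss @ []"
  let ?B = "blocks 2 (map length vss)" and ?n = "2 + length (concat vss)"
  have dL: "distinct L" "length L = ?n" using ok by (auto simp: L_def lf_ok_def)
  have B: "map (map ((!) L)) ?B = vss" using map_nth_blocks[of "[u, v]" vss "[]"] by (simp add: L_def numeral_2_eq_2)
  have VB: "lf_V 0 1 ?B = {0..<?n}"
    unfolding lf_V_def concat_blocks by (auto simp: length_concat)
  have okB: "lf_ok 0 1 ?B" using ok by (intro lf_ok_blocks) (auto simp: lf_ok_def Suc_le_eq)
  have inj: "inj_on ((!) L) {0..<?n}" using dL by (auto simp: inj_on_def nth_eq_iff_index_eq)
  have E: "lf_E u v vss = (`) ((!) L) ` lf_E 0 1 ?B"
    using lf_E_map[of "(!) L" 0 1 ?B] unfolding B by (simp add: L_def)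
  show ?thesis unfolding graph_iso_def
  proof (intro exI[of _ "(!) L"] conjI ballI)
    have "(!) L ` {0..<?n} = set L" using dL(2) by (auto simp: set_conv_nth image_iff Bex_def)
    also have "set L = lf_V u v vss" by (simp add: L_def lf_V_def)
    finally show "bij_betw ((!) L) (lf_V 0 1 ?B) (lf_V u v vss)" unfolding VB bij_betw_def using inj by simp
    fix a b assume ab: "a \<in> lf_V 0 1 ?B" "b \<in> lf_V 0 1 ?B"
    show "{a, b} \<in> lf_E 0 1 ?B \<longleftrightarrow> {L ! a, L ! b} \<in> lf_E u v vss"
    proof
      assume "{a, b} \<in> lf_E 0 1 ?B"
      thus "{L ! a, L ! b} \<in> lf_E u v vss" unfolding E by (auto intro!: image_eqI[of _ _ "{a, b}"])
    next
      assume "{L ! a, L ! b} \<in> lf_E u v vss"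
      then obtain e where e: "e \<in> lf_E 0 1 ?B" "(!) L ` {a, b} = (!) L ` e" unfolding E by auto
      have "e \<subseteq> lf_V 0 1 ?B" using simple_graph_edge_subset[OF simple_lf_E[OF okB] e(1)] .
      hence "{a, b} = e" using e(2) ab inj VB inj_on_image_eq_iff[of "(!) L" "{0..<?n}" "{a, b}" e] by auto
      thus "{a, b} \<in> lf_E 0 1 ?B" using e by simp
    qed
  qed
qed

text \<open>Brings the paths into the order of \<open>H_parts\<close> once the multisets of lengths
  agree.\<close>

lemma rearrange_by_length:
  assumes "mset (map f xs) = mset ys"
  shows "\<exists>xs'. mset xs' = mset xs \<and> map f xs' = ys"
  using assms
proof (induction ys arbitrary: xs)
  case (Cons y ys)
  have "y \<in># mset (map f xs)" using Cons.prems by simp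
  then obtain x where x: "x \<in> set xs" "y = f x" by auto
  then obtain as bs where xs: "xs = as @ x # bs" by (meson split_list)
  have "mset (map f (as @ bs)) = mset ys" using Cons.prems x(2) by (simp add: xs)
  from Cons.IH[OF this] obtain xs' where "mset xs' = mset (as @ bs)" "map f xs' = ys" by blast
  thus ?case using x(2) xs by (intro exI[of _ "x # xs'"]) auto
qed auto

lemma lf_cong_mset:
  assumes "mset vss' = mset vss"
  shows "lf_ok u v vss' = lf_ok u v vss" "lf_V u v vss' = lf_V u v vss" "lf_E u v vss' = lf_E u v vss"
proof -
  have s: "set vss' = set vss" using assms by (rule mset_eq_setD)
  have "mset (concat vss') = mset (concat vss)" by (simp add: mset_concat sum_mset_sum_list[symmetric] assms)
  hence m: "mset (u # v # concat vss') = mset (u # v # concat vss)" by simp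
  have "distinct (u # v # concat vss') = distinct (u # v # concat vss)"
    using m by (rule mset_eq_imp_distinct_iff)
  thus "lf_ok u v vss' = lf_ok u v vss" unfolding lf_ok_def using s by simp
  show "lf_V u v vss' = lf_V u v vss" "lf_E u v vss' = lf_E u v vss"
    using s by (simp_all add: lf_V_def lf_E_def lf_F_def)
qed

section \<open>Comparison with the extremal graph\<close>

lemma sum_mset_block_parts [simp]: "sum_mset (block_parts s T) = T"
proof (cases "T mod s = 0")
  case True
  hence "T div s * s = T" by (simp add: mod_eq_0_iff_dvd)
  thus ?thesis using True by (simp add: block_parts_def)
qed (simp add: block_parts_def)

text \<open>The bound of \<open>lf_rayleigh\<close>, taken at the radius of the first graph,
  together with \<open>ge\<close> leaves only equality; different multisets of lengths would make
  the bound strict.\<close>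

lemma lf_compare:
  assumes ok: "lf_ok u v vss" "lf_ok u' v' vss'"
    and s: "1 \<le> s" and n1: "n1 = s \<or> n1 = s + 1"
    and N: "sum_list (map length vss) = N" "19 * (real s)\<^sup>2 \<le> real N" "2 * s + 2 \<le> N" "32 * (real s)\<^sup>2 \<le> real N" "5 \<le> N"
    and lt: "\<And>m. m \<in> set (map length vss) \<Longrightarrow> m < N"
    and pair: "\<And>a b. {#a, b#} \<subseteq># mset (map length vss) \<Longrightarrow> a + b \<le> n1 + s"
    and H: "mset (map length vss') = add_mset n1 (block_parts s (N - n1))"
    and ge: "spectral_radius (lf_V u' v' vss') (lf_E u' v' vss') \<le> spectral_radius (lf_V u v vss) (lf_E u v vss)"
    and lam0: "0 \<le> spectral_radius (lf_V u v vss) (lf_E u v vss)"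
  shows "spectral_radius (lf_V u v vss) (lf_E u v vss) = spectral_radius (lf_V u' v' vss') (lf_E u' v' vss')"
    and "mset (map length vss) = mset (map length vss')"
proof -
  define lam where "lam = spectral_radius (lf_V u v vss) (lf_E u v vss)"
  have len: "length (concat vss) = N" using N(1) by (simp add: length_concat)
  have lam2: "2 * real N \<le> lam\<^sup>2" using lf_lower_bound[OF ok(1)] by (simp add: len lam_def)
  have "lam > 2"
  proof (rule ccontr)
    assume "\<not> 2 < lam"
    hence "lam\<^sup>2 \<le> 2\<^sup>2" using lam0 by (intro power_mono) (auto simp: lam_def)
    thus False using lam2 N(5) by simp
  qed
  \<comment> \<open>With \<open>lam * t \<le> 2\<close> this gives
    \<open>4 * t * real s \<le> 1\<close>, which \<open>parts_extremal\<close> uses when the largest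
    part exceeds n1.\<close>
  have "(8 * real s)\<^sup>2 \<le> lam\<^sup>2" using lam2 N(4) by (simp add: power_mult_distrib)
  hence s8: "8 * real s \<le> lam" using lam0 unfolding lam_def by (rule power2_le_imp_le)
  define t where "t = (lam - sqrt (lam\<^sup>2 - 4)) / 2"
  have "2\<^sup>2 < lam\<^sup>2" using \<open>lam > 2\<close> by (intro power_strict_mono) auto
  hence l4: "lam\<^sup>2 - 4 > 0" by simp
  have sq: "(sqrt (lam\<^sup>2 - 4))\<^sup>2 = lam\<^sup>2 - 4" using l4 by simp
  have sq_lt: "sqrt (lam\<^sup>2 - 4) < lam" using \<open>lam > 2\<close> by (intro real_less_lsqrt) auto
  have sq_gt: "lam - 2 < sqrt (lam\<^sup>2 - 4)" using \<open>lam > 2\<close> by (intro real_less_rsqrt) (simp add: power2_eq_square algebra_simps)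
  interpret path_resolvent t lam
  proof
    show "0 < t" using sq_lt by (simp add: t_def)
    show "t < 1" using sq_gt by (simp add: t_def)
    show "lam * t = t\<^sup>2 + 1"
    proof -
      have "4 * (t\<^sup>2) = (lam - sqrt (lam\<^sup>2 - 4))\<^sup>2" by (simp add: t_def power_divide)
      also have "\<dots> = 2 * lam\<^sup>2 - 4 - 2 * lam * sqrt (lam\<^sup>2 - 4)" using sq by (simp add: power2_diff)
      also have "\<dots> = 4 * (lam * t) - 4" by (simp add: t_def power2_eq_square algebra_simps)
      finally show ?thesis by simp
    qed
  qed
  have ts: "4 * t * real s \<le> 1"
  proof -
    have "t\<^sup>2 + 1 \<le> 2" using t by (simp add: power_le_one)
    hence "lam * t \<le> 2" using lam by simp
    moreover have "8 * real s * t \<le> lam * t" using s8 t by (intro mult_right_mono) auto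
    ultimately show ?thesis by (simp add: mult_ac)
  qed
  let ?M = "mset (map length vss)"
  have pos: "\<forall>m\<in>#?M. 1 \<le> m" using ok(1) by (auto simp: lf_ok_def Suc_le_eq)
  have ltM: "\<forall>m\<in>#?M. m < N" using lt by auto
  have sumM: "sum_mset ?M = N" unfolding sum_mset_sum_list by (rule N(1))
  have n1N: "n1 \<le> N" using n1 N(3) by auto
  note ext = parts_extremal[OF s n1 pos pair ltM sumM N(2,3) ts]
  have gs': "(\<Sum>m\<leftarrow>xs. g m) = (\<Sum>m\<in>#mset xs. g m)" for xs
    unfolding mset_map[symmetric] by (rule sum_mset_sum_list[symmetric])
  have sH: "sum_list (map length vss') = N"
  proof -
    have "sum_list (map length vss') = sum_mset (mset (map length vss'))" by (rule sum_mset_sum_list[symmetric])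
    also have "\<dots> = N" unfolding H using n1N by simp
    finally show ?thesis .
  qed
  have lamPhi: "lam = 1 + 2 * Phi (map length vss)" by (rule lf_eigen_Phi[OF ok(1)]) (simp add: lam_def)
  have sums: "sum_list (map length vss) = sum_list (map length vss')" using N(1) sH by simp
  have "Phi (map length vss) \<le> Phi (map length vss')"
    by (rule Phi_mono(1)[OF sums]) (use ext(1) in \<open>simp only: gs' H\<close>)
  hence "lam \<le> spectral_radius (lf_V u' v' vss') (lf_E u' v' vss')"
    using lf_rayleigh(1)[OF ok(2)] lamPhi by simp
  thus "spectral_radius (lf_V u v vss) (lf_E u v vss) = spectral_radius (lf_V u' v' vss') (lf_E u' v' vss')"
    using ge by (simp add: lam_def)
  show "mset (map length vss) = mset (map length vss')"
  proof (rule ccontr)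
    assume "mset (map length vss) \<noteq> mset (map length vss')"
    hence "(\<Sum>m\<in>#add_mset n1 (block_parts s (N - n1)). g m) < (\<Sum>m\<in>#?M. g m)" using ext unfolding H by fastforce
    hence "Phi (map length vss) < Phi (map length vss')"
      by (intro Phi_mono(2)[OF sums]) (simp only: gs' H)
    hence "lam < spectral_radius (lf_V u' v' vss') (lf_E u' v' vss')"
      using lf_rayleigh(2)[OF ok(2)] lamPhi by simp
    thus False using ge by (simp add: lam_def)
  qed
qed

context perron_pair begin

text \<open>A cycle of \<open>F\<close> together with \<open>u\<close>, \<open>v\<close> and a spare
  common neighbour gives a subdivision of K(5) if it is a triangle, and a K(3,3) minor otherwise.
  The path lengths are limited because paths inside \<open>C\<close> close up to theta graphs
  through \<open>u\<close> alone or through \<open>u\<close> and \<open>v\<close>.\<close>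

lemma F_structure:
  assumes k: "k \<ge> 5" "2 * k \<le> card V" and pl: "planar V E" and th: "\<not> contains_theta k V E"
  obtains vss where "lf_ok u v vss" "V = lf_V u v vss" "join2 u v R F = lf_E u v vss"
    "\<And>m. m \<in> set (map length vss) \<Longrightarrow> m \<le> k - 2"
    "\<And>a b. {#a, b#} \<subseteq># mset (map length vss) \<Longrightarrow> a + b \<le> k - 3"
proof -
  \<comment> \<open>A path inside \<open>C\<close> has at most k - 2 vertices, so it always leaves a
    common neighbour to spare.\<close>
  have cC: "card C > k"
  proof -
    have "card R = card V - 2" using V_eq finV v u unfolding R_def by (simp add: card_Diff_subset)
    moreover have "card R \<le> card C + card D" using R_eq card_Un_le[of C D] by simp
    ultimately have "n - 2 \<le> real (card C) + real (card D)" using big by linarith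
    hence "real (card C) \<ge> n - 2 - n / 20" using card_D by simp
    moreover have "real (2 * k) \<le> n" using k by (intro of_nat_mono)
    ultimately have "real (card C) > real k" using big by simp
    thus ?thesis by simp
  qed
  have CE: "C \<subseteq> nb E u \<inter> nb E v" by (simp add: C_def)
  have uvC: "u \<notin> C" "v \<notin> C" using CR by (auto simp: R_def)
  have no_long: "length P \<le> k - 2" if P: "distinct P" "path_edges P \<subseteq> E" "set P \<subseteq> C" for P
  proof (rule ccontr)
    assume "\<not> length P \<le> k - 2"
    hence l: "length P \<ge> k - 1" by simp
    have "contains_theta k V E"
      by (rule theta_of_long_path[OF k(1) P(1) l P(2), of u]) (use P CE uvC RV u in auto)
    thus False using th by simp
  qed
  have two: "length P + length Q \<le> k - 3" if P: "distinct P" "path_edges P \<subseteq> E" "set P \<subseteq> C" "length P \<ge> 2"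
    and Q: "distinct Q" "path_edges Q \<subseteq> E" "set Q \<subseteq> C" "length Q \<ge> 1" and d: "set P \<inter> set Q = {}" for P Q
  proof (rule ccontr)
    assume "\<not> length P + length Q \<le> k - 3"
    hence l: "k - 2 \<le> length P + length Q" by simp
    have PC: "set P \<subseteq> nb E u \<inter> nb E v" "set Q \<subseteq> nb E u \<inter> nb E v" using P Q CE by auto
    have uv: "u \<noteq> v" "{u, v} \<inter> (set P \<union> set Q) = {}" "{u, v} \<union> set P \<union> set Q \<subseteq> V"
      using v u P Q uvC RV by auto
    have "contains_theta k V E"
      by (rule theta_of_two_paths[OF k(1) P(1,2) PC(1) Q(1,2) PC(2) d P(4) Q(4) l uv])
    thus False using th by simp
  qed
  have degF: "card (nb F z) \<le> 2" for z
  proof (cases "z \<in> C")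
    case True
    have "nb F z \<subseteq> nb E z \<inter> C" by (auto simp: F_def)
    hence "card (nb F z) \<le> card (nb E z \<inter> C)" by (intro card_mono) auto
    also have "\<dots> \<le> 2" using True CR by (intro card_nb_C) auto
    finally show ?thesis .
  next
    case False
    hence "nb F z = {}" by (auto simp: F_def)
    thus ?thesis by simp
  qed
  have pathC: "set vs \<subseteq> C" if "path_edges vs \<subseteq> F" "length vs \<ge> 2" for vs
  proof
    fix z assume "z \<in> set vs"
    then obtain i where i: "i < length vs" "z = vs ! i" by (auto simp: in_set_conv_nth)
    have "\<exists>e\<in>path_edges vs. z \<in> e"
    proof (cases "Suc i < length vs")
      case True thus ?thesis using path_edges_nthI[of i vs] i by blast
    next
      case False
      hence "0 < i" using that(2) i by simp
      thus ?thesis using path_edges_nthI[of "i - 1" vs] i by (intro bexI[of _ "{vs ! (i - 1), vs ! i}"]) auto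
    qed
    thus "z \<in> C" using that(1) by (auto simp: F_def)
  qed
  have FE: "F \<subseteq> E" by (auto simp: F_def)
  have nocyc: "{last vs, hd vs} \<notin> F" if vs: "length vs \<ge> 3" "distinct vs" "path_edges vs \<subseteq> F" for vs
  proof
    assume cyc: "{last vs, hd vs} \<in> F"
    have vC: "set vs \<subseteq> C" using pathC vs by auto
    have "path_edges vs \<subseteq> E" using vs(3) FE by blast
    hence "card (set vs) < card C" using no_long[of vs] vs vC cC k by (simp add: distinct_card)
    hence "\<not> C \<subseteq> set vs" by (meson card_mono finite_set linorder_not_less)
    then obtain w where w: "w \<in> C" "w \<notin> set vs" by auto
    obtain a b c ws where abc: "vs = a # b # c # ws" using vs(1) by (auto simp: numeral_3_eq_3 Suc_le_length_iff)
    have adj: "{u, z} \<in> E \<and> {v, z} \<in> E" if "z \<in> insert w (set vs)" for z using that vC w CE by auto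
    have dist: "distinct (u # v # w # vs)" using vs(2) w vC uvC v by auto
    show False
    proof (cases "ws = []")
      case True
      have vs3: "vs = [a, b, c]" using abc True by simp
      obtain p c' where "drawing V E p c'" using planar_imp_drawing[OF simple pl] by blast
      then interpret drawing V E p c' .
      show False
      proof (rule no_K5_subdivision[of u v w a b c])
        show "distinct [u, v, w, a, b, c]" using dist vs3 by simp
        show "{u, r} \<in> E \<and> {r, v} \<in> E" if "r \<in> {w, a, b, c}" for r
          using adj[of r] that vs3 by (auto simp: insert_commute)
        show "{a, b} \<in> E" "{c, a} \<in> E" "{c, b} \<in> E" using vs(3) cyc FE vs3 by (auto simp: insert_commute)
      qed
    next
      case False
      have "K33_minor E"
      proof (rule K33_minor_of_wheel[of u v w a b c ws])
        show "distinct (u # v # w # a # b # c # ws)" using dist abc by simp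
        show "path_edges (a # b # c # ws) \<subseteq> E" using vs(3) FE abc by auto
        show "{last ws, a} \<in> E" using cyc FE abc False by auto
        show "{u, z} \<in> E \<and> {v, z} \<in> E" if "z \<in> {w, a, b, c} \<union> set ws" for z
          using adj[of z] that abc by auto
      qed (rule False)
      thus False using nomin by simp
    qed
  qed
  obtain vss where vss: "distinct (concat vss)" "[] \<notin> set vss" "set (concat vss) = R" "lf_F vss = F"
    using linear_forest_decomposition[OF simple_F degF nocyc] by blast
  have ok: "lf_ok u v vss" unfolding lf_ok_def using vss V_eq v by auto
  have peF: "path_edges vs \<subseteq> F" if "vs \<in> set vss" for vs using that vss(4) by (auto simp: lf_F_def)
  have dvs: "distinct vs" if "vs \<in> set vss" for vs using that vss(1) by (simp add: distinct_concat_iff)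
  have short: "length vs \<le> k - 2" if "vs \<in> set vss" for vs
  proof (cases "length vs \<ge> 2")
    case True
    thus ?thesis using no_long[of vs] pathC[of vs] peF[OF that] dvs[OF that] FE by blast
  qed (use k in auto)
  have pr: "length vs + length ws \<le> k - 3" if vs: "vs \<in> set vss" "ws \<in> set vss" "set vs \<inter> set ws = {}" "length ws \<le> length vs" for vs ws
  proof (cases "length vs \<ge> 2")
    case True
    have vC: "set vs \<subseteq> C" "path_edges vs \<subseteq> E" "distinct vs" using pathC[of vs] peF[OF vs(1)] True FE dvs vs by auto
    have wne: "ws \<noteq> []" using vss(2) vs by auto
    show ?thesis
    proof (cases "length ws \<ge> 2")
      case True
      hence "set ws \<subseteq> C" "path_edges ws \<subseteq> E" "distinct ws" using pathC[of ws] peF[OF vs(2)] FE dvs vs by auto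
      thus ?thesis using two[of vs ws] vC \<open>length vs \<ge> 2\<close> True vs(3) by simp
    next
      case False
      \<comment> \<open>The one-vertex path \<open>ws\<close> may lie in \<open>D\<close>, where an
        edge of \<open>E\<close> to \<open>u\<close> or \<open>v\<close> is missing; a spare vertex
        of \<open>C\<close> takes its place.\<close>
      have "card (set vs) < card C" using no_long[of vs] vC cC k by (simp add: distinct_card)
      hence "\<not> C \<subseteq> set vs" by (meson card_mono finite_set linorder_not_less)
      then obtain c where c: "c \<in> C" "c \<notin> set vs" by auto
      have "length vs + length [c] \<le> k - 3" by (rule two) (use vC c \<open>length vs \<ge> 2\<close> in auto)
      thus ?thesis using False by simp
    qed
  next
    case False
    thus ?thesis using vs(4) k by simp
  qed
  show thesis
  proof
    show "lf_ok u v vss" by (rule ok)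
    show "V = lf_V u v vss" using V_eq vss(3) by (simp add: lf_V_def)
    show "join2 u v R F = lf_E u v vss" using vss by (simp add: lf_E_def)
    show "m \<le> k - 2" if "m \<in> set (map length vss)" for m using short that by auto
    show "a + b \<le> k - 3" if ab: "{#a, b#} \<subseteq># mset (map length vss)" for a b
    proof -
      have "a \<in># mset (map length vss)" using ab by (simp add: insert_subset_eq_iff)
      then obtain vs where "vs \<in> set vss" and a: "a = length vs" by auto
      then obtain xs ys where xy: "vss = xs @ vs # ys" by (meson split_list)
      have "{#b#} \<subseteq># mset (map length (xs @ ys))" using ab a by (simp add: xy)
      then obtain ws where ws: "ws \<in> set (xs @ ys)" "b = length ws" by auto
      have disj: "set vs \<inter> set ws = {}" using vss(1) ws(1) unfolding xy by auto
      have m: "vs \<in> set vss" "ws \<in> set vss" using ws xy by auto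
      show ?thesis
      proof (cases "b \<le> a")
        case True thus ?thesis using pr[OF m disj] a ws by simp
      next
        case False thus ?thesis using pr[OF m(2,1)] disj a ws by (simp add: Int_commute)
      qed
    qed
  qed
qed

end

text \<open>Both sides equal 1152 at s = 6. From there on the right side doubles at each step, while
  the square at most doubles.\<close>

lemma square_le_power: "32 * s\<^sup>2 \<le> 9 * 2 ^ (s + 1)" if "s \<ge> 6" for s :: nat
  using that
proof (induction s rule: nat_induct_at_least)
  case base show ?case by simp
next
  case (Suc m)
  have "Suc m ^ 2 \<le> 2 * m\<^sup>2"
  proof -
    have "6 * m \<le> m * m" using Suc.hyps by (rule mult_le_mono1)
    hence "2 * m + 1 \<le> m * m" using Suc.hyps by linarith
    thus ?thesis by (simp add: power2_eq_square algebra_simps)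
  qed
  hence "32 * (Suc m)\<^sup>2 \<le> 2 * (32 * m\<^sup>2)" by linarith
  also have "\<dots> \<le> 2 * (9 * 2 ^ (m + 1))" using Suc.IH by (intro mult_le_mono2)
  finally show ?case by simp
qed

theorem theorem4:
  fixes k n :: nat and V :: "'a set" and E :: "'a set set"
  assumes "k \<ge> 5"
    and "real n \<ge> 2.16 * 10 ^ 17"
    and "n \<ge> 9 * 2 ^ ((k - 1) div 2) + 3"
    and "real n \<ge> 625 / 32 * (real ((k - 3) div 2))^2 + 2"
    and "simple_graph V E" and "card V = n"
    and "planar V E"
    and "\<not> contains_theta k V E"
  shows "spectral_radius V E \<le> spectral_radius (KH_vertices n) (KH_edges n ((k - 2) div 2) ((k - 3) div 2))
    \<and> (spectral_radius V E = spectral_radius (KH_vertices n) (KH_edges n ((k - 2) div 2) ((k - 3) div 2))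
       \<longleftrightarrow> graph_iso V E (KH_vertices n) (KH_edges n ((k - 2) div 2) ((k - 3) div 2)))"
proof -
  \<comment> \<open>\<open>(k - 2) div 2\<close> is half of k - 3 rounded up, so \<open>n1\<close>
    is \<open>s\<close> or \<open>s + 1\<close>, and \<open>n1 + s = k - 3\<close> is the bound for
    two paths in \<open>F_structure\<close>.\<close>
  define s n1 where "s = (k - 3) div 2" and "n1 = (k - 2) div 2"
  define N where "N = n - 2"
  define ms where "ms = H_parts n n1 s"
  let ?KV = "KH_vertices n" and ?KE = "KH_edges n n1 s"
  have s1: "1 \<le> s" using assms(1) by (simp add: s_def)
  have n1: "n1 = s \<or> n1 = s + 1" "n1 + s = k - 3" using assms(1) by (auto simp: s_def n1_def)
  have ks: "(k - 1) div 2 = s + 1" using assms(1) by (simp add: s_def)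
  have n_pow: "9 * 2 ^ (s + 1) + 3 \<le> n" using assms(3) unfolding ks .
  have n_big: "216000000000000000 \<le> n" using assms(2) by simp
  have "s < 2 ^ s" by (rule less_exp)
  moreover have "18 * 2 ^ s + 3 \<le> n" using n_pow by simp
  ultimately have s_lin: "18 * s + 21 \<le> n" by linarith
  have k_le: "k \<le> 2 * s + 4" using assms(1) by (simp add: s_def)
  have k2: "2 * k \<le> n" using k_le s_lin by linarith
  have nN: "n = N + 2" "real n = real N + 2" using n_big by (auto simp: N_def)
  have N19: "19 * (real s)\<^sup>2 \<le> real N" using assms(4) nN by (simp add: s_def)
  \<comment> \<open>For s >= 6 this follows from the exponential lower bound on n, for smaller s
    from its absolute size.\<close>
  have N32: "32 * (real s)\<^sup>2 \<le> real N"
  proof (cases "6 \<le> s")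
    case True
    have "32 * s\<^sup>2 \<le> N" using square_le_power[OF True] n_pow nN by simp
    hence "real (32 * s\<^sup>2) \<le> real N" by (rule of_nat_mono)
    thus ?thesis by simp
  next
    case False
    hence "(real s)\<^sup>2 \<le> 6\<^sup>2" by (intro power_mono) auto
    thus ?thesis using n_big nN by simp
  qed
  have N2: "2 * s + 2 \<le> N" "5 \<le> N" using s_lin nN by auto
  have n1N: "n1 \<le> N" using n1 N2 by auto
  have ms_mset: "mset ms = add_mset n1 (block_parts s (N - n1))"
    by (simp add: ms_def H_parts_def Let_def block_parts_def N_def)
  have ms_pos: "\<forall>m\<in>set ms. 1 \<le> m" using s1 n1 by (auto simp: ms_def H_parts_def Let_def)
  have ms_sum: "sum_list ms = N"
  proof -
    have "sum_list ms = sum_mset (mset ms)" by (rule sum_mset_sum_list[symmetric])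
    also have "\<dots> = N" unfolding ms_mset using n1N by simp
    finally show ?thesis .
  qed
  define vss' where "vss' = blocks 2 ms"
  have ok': "lf_ok 0 1 vss'" unfolding vss'_def by (rule lf_ok_blocks[OF ms_pos])
  have len': "map length vss' = ms" by (simp add: vss'_def length_blocks)
  have set': "set (concat vss') = {2..<n}" unfolding vss'_def concat_blocks using ms_sum nN by auto
  have KV: "?KV = lf_V 0 1 vss'" unfolding KH_vertices_def lf_V_def set' using n_big by auto
  have KE: "?KE = lf_E 0 1 vss'"
  proof -
    have "lf_F vss' = paths_edges 2 ms" by (simp add: vss'_def lf_F_blocks)
    moreover have "{{a, b} | a b. a < 2 \<and> 2 \<le> b \<and> b < n} = {{w, z} | w z. w \<in> {0, 1} \<and> z \<in> {2..<n}}"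
      by (auto simp: less_2_cases_iff)
    ultimately show ?thesis unfolding KH_edges_def lf_E_def join2_def set' ms_def[symmetric] by simp
  qed
  have finV: "finite V" using assms(5) by (simp add: simple_graph_def)
  have neV: "V \<noteq> {}" using assms(6) n_big by auto
  \<comment> \<open>This implication yields both claims: a radius not below the extremal one forces
    isomorphism, and isomorphic graphs have equal radii.\<close>
  have main: "graph_iso V E ?KV ?KE" if ge: "spectral_radius ?KV ?KE \<le> spectral_radius V E"
  proof -
    define \<rho> where "\<rho> = spectral_radius V E"
    have "spectral_radius ?KV ?KE \<ge> 0"
    proof -
      have "finite ?KV" "?KV \<noteq> {}" using n_big by (auto simp: KH_vertices_def)
      from ex_perron_vector[OF this, of ?KE] obtain y where y: "\<forall>v. 0 \<le> y v" "\<exists>v\<in>?KV. y v \<noteq> 0"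
        "\<forall>v\<in>?KV. adjop ?KV ?KE y v = spectral_radius ?KV ?KE * y v" by blast
      then obtain v where v: "v \<in> ?KV" "y v > 0" by (metis less_eq_real_def)
      have "0 \<le> adjop ?KV ?KE y v" unfolding adjop_def using y(1) by (intro sum_nonneg) auto
      thus ?thesis using y(3) v by (simp add: zero_le_mult_iff)
    qed
    hence \<rho>0: "0 \<le> \<rho>" using ge by (simp add: \<rho>_def)
    have "2 * real N \<le> (spectral_radius ?KV ?KE)\<^sup>2"
      using lf_lower_bound[OF ok'] KV KE len' ms_sum by (simp add: length_concat)
    also have "\<dots> \<le> \<rho>\<^sup>2" unfolding \<rho>_def using ge \<open>spectral_radius ?KV ?KE \<ge> 0\<close> by (rule power_mono)
    finally have \<rho>2: "2 * real n - 4 \<le> \<rho>\<^sup>2" using nN by simp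
    obtain y where y: "\<forall>v. 0 \<le> y v" "\<exists>v\<in>V. y v \<noteq> 0" "\<forall>v\<in>V. adjop V E y v = \<rho> * y v"
      using ex_perron_vector[OF finV neV, of E] unfolding \<rho>_def by blast
    have "Max (y ` V) \<in> y ` V" using finV neV by (intro Max_in) auto
    then obtain u where u: "u \<in> V" and u_max: "Max (y ` V) = y u" by auto
    have yle: "y v \<le> y u" if "v \<in> V" for v
      unfolding u_max[symmetric] using that finV by (intro Max_ge) auto
    have yu: "y u > 0" using y(1,2) yle by (metis less_eq_real_def order_less_le_trans)
    define x where "x v = y v / y u" for v
    obtain p c where "drawing V E p c" using planar_imp_drawing[OF assms(5,7)] by blast
    then interpret d: drawing V E p c .
    interpret perron V E x \<rho> u
    proof
      show "simple_graph V E" by fact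
      show "\<not> K33_minor E" by (rule d.no_K33_minor)
      show "2.16 * 10 ^ 17 \<le> real (card V)" using assms(2,6) by simp
      show "0 \<le> x v" for v using y(1) yu by (simp add: x_def)
      show "adjop V E x v = \<rho> * x v" if "v \<in> V" for v
        using y(3) that unfolding x_def adjop_def by (simp add: sum_divide_distrib[symmetric])
      show "0 \<le> \<rho>" by (rule \<rho>0)
      show "2 * real (card V) - 4 \<le> \<rho>\<^sup>2" using \<rho>2 assms(6) by simp
      show "u \<in> V" "x u = 1" using u yu by (auto simp: x_def)
      show "x v \<le> 1" if "v \<in> V" for v using yle[OF that] yu by (simp add: x_def)
    qed
    obtain v where "v \<in> V" "v \<noteq> u" "x v \<ge> 0.976" "real (card (nb E u)) \<ge> 0.988 * real (card V)" "real (card (nb E v)) \<ge> 0.964 * real (card V)"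
      using second_vertex by blast
    then interpret perron_pair V E x \<rho> u v by unfold_locales
    obtain vss where ok: "lf_ok u v vss" and V_lf: "V = lf_V u v vss" and E_lf: "join2 u v R F = lf_E u v vss"
      and short: "\<And>m. m \<in> set (map length vss) \<Longrightarrow> m \<le> k - 2"
      and pair: "\<And>a b. {#a, b#} \<subseteq># mset (map length vss) \<Longrightarrow> a + b \<le> k - 3"
      using F_structure[OF assms(1) _ assms(7,8)] k2 assms(6) by blast
    note gain = spectral_gain[OF \<rho>_def, unfolded E_lf]
    have sumN: "sum_list (map length vss) = N"
    proof -
      have "card V = card (set (u # v # concat vss))" by (subst V_lf) (simp add: lf_V_def)
      also have "\<dots> = length (u # v # concat vss)" using ok by (intro distinct_card) (simp add: lf_ok_def)
      finally show ?thesis using assms(6) nN by (simp add: length_concat)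
    qed
    have lamG: "spectral_radius V E \<le> spectral_radius (lf_V u v vss) (lf_E u v vss)" using gain(1) V_lf by simp
    have ge': "spectral_radius (lf_V 0 1 vss') (lf_E 0 1 vss') \<le> spectral_radius (lf_V u v vss) (lf_E u v vss)"
      using ge lamG by (simp add: KV KE)
    have lam0: "0 \<le> spectral_radius (lf_V u v vss) (lf_E u v vss)" using lamG \<rho>0 by (simp add: \<rho>_def)
    have shortN: "m < N" if "m \<in> set (map length vss)" for m using short[OF that] k2 nN assms(1) by linarith
    have pair': "a + b \<le> n1 + s" if "{#a, b#} \<subseteq># mset (map length vss)" for a b using pair[OF that] n1(2) by simp
    have H: "mset (map length vss') = add_mset n1 (block_parts s (N - n1))" using ms_mset len' by simp
    note cmp = lf_compare[OF ok ok' s1 n1(1) sumN N19 N2(1) N32 N2(2) shortN pair' H ge' lam0]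
    \<comment> \<open>The radius of G lies between that of the extremal graph and that of the
      modified graph, which agree by \<open>cmp(1)\<close>. So the replacement gained nothing, and
      by \<open>gain(2)\<close> it changed no edge.\<close>
    have "spectral_radius V E = spectral_radius V (lf_E u v vss)"
      using cmp(1) ge gain(1) V_lf by (simp add: KV KE)
    hence E_eq: "E = lf_E u v vss" by (rule gain(2))
    have "mset (map length vss) = mset ms" using cmp(2) len' by simp
    then obtain vss2 where v2: "mset vss2 = mset vss" "map length vss2 = ms" using rearrange_by_length by blast
    note v2c = lf_cong_mset[OF v2(1), of u v]
    have "lf_ok u v vss2" using ok v2c by simp
    from graph_iso_blocks[OF this] have "graph_iso ?KV ?KE V E"
      unfolding v2(2) vss'_def[symmetric] KV KE v2c using V_lf E_eq by simp
    thus ?thesis by (rule graph_iso_sym)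
  qed
  have "graph_iso V E ?KV ?KE \<Longrightarrow> spectral_radius V E = spectral_radius ?KV ?KE" by (rule spectral_radius_iso)
  with main show ?thesis unfolding s_def[symmetric] n1_def[symmetric] by fastforce
qed

end
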